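(* Let $P$ be a finite poset. Let $\mathcal{S}=\{p_{1,1},\ldots,p_{1,n_1}\}\cup\{p_{2,1},\ldots,p_{2,n_2}\}$ be a subset of the underlying set of $P$ such that (1) for each $i\in\{1,2\}$, $\{p_{i,1},\ldots,p_{i,n_i}\}$ is a chain in $P$ with $p_{i,1}\lessdot\cdots\lessdot p_{i,n_i}$ (cover relations in $P$); (2) $p_{1,1}$ and $p_{2,1}$ are incomparable in $P$; (3) $p_{1,n_1}$ and $p_{2,n_2}$ are incomparable in $P$. Let $P'$ be the induced subposet of $P$ on the set $\mathcal{S}$. If $R[\mathcal{I}(P')]$ does not satisfy property $N_2$, then $R[\mathcal{I}(P)]$ does not satisfy property $N_2$ either.
   Context: $K$ is a field and all posets are finite. For a poset $P=\{p_1,\ldots,p_n\}$, $\mathcal{I}(P)$ is the distributive lattice of order ideals (down-closed subsets, including $\emptyset$ and $P$) of $P$, ordered by inclusion. The Hibi ring $R[\mathcal{I}(P)]$ is the $K$-subalgebra of the polynomial ring $K[t,z_1,\ldots,z_n]$ generated by the monomials $u_\alpha=t\prod_{p_i\in\alpha}z_i$, $\alpha\in\mathcal{I}(P)$; it is standard graded via $\deg t=1$, $\deg z_i=0$. It is a quotient of the polynomial ring $K[\mathcal{I}(P)]=K[x_\alpha:\alpha\in\mathcal{I}(P)]$ via $x_\alpha\mapsto u_\alpha$, and $\beta_{ij}(R[\mathcal{I}(P)])$ denotes its graded Betti numbers (homological degree $i$, internal degree $j$) over $K[\mathcal{I}(P)]$. For $p\in\mathbb{N}$, the ring satisfies (Green–Lazarsfeld)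 property $N_p$ if it is normal and $\beta_{ij}=0$ for all $1\le i\le p$ and $j\ne i+1$. The notation $x\lessdot y$ means that $y$ covers $x$: $x<y$ and no $z$ satisfies $x<z<y$. The two chains in $\mathcal S$ are allowed to share elements. *)

theory Defs
  imports
    "HOL-Library.Poly_Mapping"
    "HOL-Algebra.Generated_Rings"
    "HOL-Algebra.Algebraic_Closure_Type"
begin

section \<open>Normal domains\<close>

definition frac_rel :: "('r, 'm) ring_scheme \<Rightarrow> (('r \<times> 'r) \<times> ('r \<times> 'r)) set" where
  "frac_rel R = {((a, b), (c, d)) | a b c d.
     a \<in> carrier R \<and> b \<in> carrier R - {\<zero>\<^bsub>R\<^esub>} \<and> c \<in> carrier R \<and> d \<in> carrier R - {\<zero>\<^bsub>R\<^esub>} \<and>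
     a \<otimes>\<^bsub>R\<^esub> d = c \<otimes>\<^bsub>R\<^esub> b}"

definition fraction :: "('r, 'm) ring_scheme \<Rightarrow> 'r \<Rightarrow> 'r \<Rightarrow> ('r \<times> 'r) set" where
  "fraction R a b = frac_rel R `` {(a, b)}"

text \<open>
  The operations are the usual ones on representatives. All members of the unions below
  coincide, so that each union is a single equivalence class.
\<close>

definition fraction_field :: "('r, 'm) ring_scheme \<Rightarrow> ('r \<times> 'r) set ring" where
  "fraction_field R = \<lparr>
     carrier = {fraction R a b | a b. a \<in> carrier R \<and> b \<in> carrier R - {\<zero>\<^bsub>R\<^esub>}},
     monoid.mult = (\<lambda>x y. \<Union>(a, b) \<in> x. \<Union>(c, d) \<in> y. fraction R (a \<otimes>\<^bsub>R\<^esub> c) (b \<otimes>\<^bsub>R\<^esub> d)),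
     one = fraction R \<one>\<^bsub>R\<^esub> \<one>\<^bsub>R\<^esub>,
     ring.zero = fraction R \<zero>\<^bsub>R\<^esub> \<one>\<^bsub>R\<^esub>,
     add = (\<lambda>x y. \<Union>(a, b) \<in> x. \<Union>(c, d) \<in> y.
              fraction R (a \<otimes>\<^bsub>R\<^esub> d \<oplus>\<^bsub>R\<^esub> c \<otimes>\<^bsub>R\<^esub> b) (b \<otimes>\<^bsub>R\<^esub> d))\<rparr>"

definition integral_over :: "('r, 'm) ring_scheme \<Rightarrow> ('r \<times> 'r) set \<Rightarrow> bool" where
  "integral_over R x \<longleftrightarrow> (\<exists>(n::nat) c. (\<forall>i<n. c i \<in> carrier R) \<and>
     (let L = fraction_field R in
        x [^]\<^bsub>L\<^esub> n \<oplus>\<^bsub>L\<^esub> (\<Oplus>\<^bsub>L\<^esub>i\<in>{..<n}. fraction R (c i) \<one>\<^bsub>R\<^esub> \<otimes>\<^bsub>L\<^esub> x [^]\<^bsub>L\<^esub> i) = \<zero>\<^bsub>L\<^esub>))"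

definition normal_domain :: "('r, 'm) ring_scheme \<Rightarrow> bool" where
  "normal_domain R \<longleftrightarrow> domain R \<and>
     (\<forall>x \<in> carrier (fraction_field R). integral_over R x \<longrightarrow> (\<exists>a \<in> carrier R. x = fraction R a \<one>\<^bsub>R\<^esub>))"


section \<open>Polynomials\<close>

text \<open>
  A monomial in variables of type \<open>'v\<close> is its exponent function \<open>'v \<Rightarrow>\<^sub>0 nat\<close>, and the product of
  the library on \<open>('v \<Rightarrow>\<^sub>0 nat) \<Rightarrow>\<^sub>0 'k\<close> is the convolution product, i.e. that of polynomials.
\<close>

type_synonym ('v, 'k) mpoly = "('v \<Rightarrow>\<^sub>0 nat) \<Rightarrow>\<^sub>0 'k"

definition total_deg :: "('v \<Rightarrow>\<^sub>0 nat) \<Rightarrow> nat" where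
  "total_deg m = (\<Sum>v \<in> Poly_Mapping.keys m. Poly_Mapping.lookup m v)"

definition const :: "'k \<Rightarrow> ('v, 'k::zero) mpoly" where
  "const c = Poly_Mapping.single 0 c"

definition polys_in :: "'v set \<Rightarrow> ('v, 'k::zero) mpoly set" where
  "polys_in V = {f. \<forall>m \<in> Poly_Mapping.keys f. Poly_Mapping.keys m \<subseteq> V}"

definition subst :: "('v \<Rightarrow> ('w, 'k::comm_ring_1) mpoly) \<Rightarrow> ('v, 'k) mpoly \<Rightarrow> ('w, 'k) mpoly" where
  "subst u f = (\<Sum>m \<in> Poly_Mapping.keys f. const (Poly_Mapping.lookup f m) *
     (\<Prod>v \<in> Poly_Mapping.keys m. u v ^ Poly_Mapping.lookup m v))"


section \<open>Minimal graded free resolutions and graded Betti numbers\<close>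

text \<open>
  \<open>S = polys_in V\<close> is standard graded. The free graded module \<open>\<Oplus>\<^sub>l S(- \<delta> l)\<close> with basis indexed by
  \<open>l \<in> B\<close> consists of the finitely supported families of elements of \<open>S\<close> indexed by \<open>B\<close>; its
  basis element with index \<open>l\<close> has degree \<open>\<delta> l\<close>.
\<close>

definition free_module :: "'v set \<Rightarrow> nat set \<Rightarrow> (nat \<Rightarrow>\<^sub>0 ('v, 'k::comm_ring_1) mpoly) set" where
  "free_module V B = {x. Poly_Mapping.keys x \<subseteq> B \<and> (\<forall>l. Poly_Mapping.lookup x l \<in> polys_in V)}"

definition free_component ::
  "'v set \<Rightarrow> nat set \<Rightarrow> (nat \<Rightarrow> nat) \<Rightarrow> nat \<Rightarrow> (nat \<Rightarrow>\<^sub>0 ('v, 'k::comm_ring_1) mpoly) set" where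
  "free_component V B \<delta> j =
     {x \<in> free_module V B.
        \<forall>l. \<forall>m \<in> Poly_Mapping.keys (Poly_Mapping.lookup x l). total_deg m + \<delta> l = j}"

definition scale ::
  "('v, 'k::comm_ring_1) mpoly \<Rightarrow> (nat \<Rightarrow>\<^sub>0 ('v, 'k) mpoly) \<Rightarrow> (nat \<Rightarrow>\<^sub>0 ('v, 'k) mpoly)"
  where "scale s x = Poly_Mapping.map (\<lambda>f. s * f) x"

text \<open>The submodule \<open>\<mm> F\<close>, where \<open>\<mm>\<close> is the ideal of \<open>S\<close> generated by the variables.\<close>

definition max_submodule :: "'v set \<Rightarrow> nat set \<Rightarrow> (nat \<Rightarrow>\<^sub>0 ('v, 'k::comm_ring_1) mpoly) set" where
  "max_submodule V B =
     {x \<in> free_module V B. \<forall>l. Poly_Mapping.lookup (Poly_Mapping.lookup x l) 0 = 0}"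

text \<open>
  The module resolved is the additive group \<open>M\<close> on which \<open>s \<in> S\<close> acts as multiplication by \<open>\<phi> s\<close>,
  with graded components \<open>G j\<close>. The free module in homological degree \<open>i\<close> is given by \<open>B i\<close> and
  \<open>\<delta> i\<close>, the differential \<open>d i\<close> goes from homological degree \<open>Suc i\<close> to \<open>i\<close>, and \<open>\<epsilon>\<close> is the
  augmentation onto \<open>M\<close>. Free modules of countable rank are admitted: if \<open>V\<close> is finite and \<open>M\<close> is
  finitely generated, minimality forces all ranks to be finite.
\<close>

definition minimal_graded_free_resolution ::
  "'v set \<Rightarrow> (('v, 'k::comm_ring_1) mpoly \<Rightarrow> 'm::comm_ring_1) \<Rightarrow> 'm set \<Rightarrow> (nat \<Rightarrow> 'm set) \<Rightarrow>
   (nat \<Rightarrow> nat set) \<Rightarrow> (nat \<Rightarrow> nat \<Rightarrow> nat) \<Rightarrow>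
   (nat \<Rightarrow> (nat \<Rightarrow>\<^sub>0 ('v, 'k) mpoly) \<Rightarrow> (nat \<Rightarrow>\<^sub>0 ('v, 'k) mpoly)) \<Rightarrow>
   ((nat \<Rightarrow>\<^sub>0 ('v, 'k) mpoly) \<Rightarrow> 'm) \<Rightarrow> bool" where
  "minimal_graded_free_resolution V \<phi> M G B \<delta> d \<epsilon> \<longleftrightarrow>
     (let F = (\<lambda>i. free_module V (B i)) in
       \<comment> \<open>graded \<open>S\<close>-linear maps\<close>
       (\<forall>i. \<forall>x \<in> F (Suc i). \<forall>y \<in> F (Suc i). d i (x + y) = d i x + d i y) \<and>
       (\<forall>i. \<forall>s \<in> polys_in V. \<forall>x \<in> F (Suc i). d i (scale s x) = scale s (d i x)) \<and>
       (\<forall>i j. d i ` free_component V (B (Suc i)) (\<delta> (Suc i)) j \<subseteq> free_component V (B i) (\<delta> i) j) \<and>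
       (\<forall>x \<in> F 0. \<forall>y \<in> F 0. \<epsilon> (x + y) = \<epsilon> x + \<epsilon> y) \<and>
       (\<forall>s \<in> polys_in V. \<forall>x \<in> F 0. \<epsilon> (scale s x) = \<phi> s * \<epsilon> x) \<and>
       (\<forall>j. \<epsilon> ` free_component V (B 0) (\<delta> 0) j \<subseteq> G j) \<and>
       \<comment> \<open>exactness\<close>
       \<epsilon> ` F 0 = M \<and>
       d 0 ` F (Suc 0) = {x \<in> F 0. \<epsilon> x = 0} \<and>
       (\<forall>i. d (Suc i) ` F (Suc (Suc i)) = {x \<in> F (Suc i). d i x = 0}) \<and>
       \<comment> \<open>minimality\<close>
       (\<forall>i. d i ` F (Suc i) \<subseteq> max_submodule V (B i)))"

definition graded_betti ::
  "'v set \<Rightarrow> (('v, 'k::comm_ring_1) mpoly \<Rightarrow> 'm::comm_ring_1) \<Rightarrow> 'm set \<Rightarrow> (nat \<Rightarrow> 'm set) \<Rightarrow>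
   nat \<Rightarrow> nat \<Rightarrow> nat" where
  "graded_betti V \<phi> M G i j = (THE b. \<exists>B \<delta> d \<epsilon>.
     minimal_graded_free_resolution V \<phi> M G B \<delta> d \<epsilon> \<and> b = card {l \<in> B i. \<delta> i l = j})"


section \<open>Posets and Hibi rings\<close>

text \<open>
  A poset is a set \<open>P\<close> with a relation \<open>r\<close> such that \<open>partial_order_on P r\<close>; \<open>(x, y) \<in> r\<close> means
  \<open>x \<le> y\<close>.
\<close>

definition order_ideals :: "'a set \<Rightarrow> 'a rel \<Rightarrow> 'a set set" where
  "order_ideals P r = {\<alpha>. \<alpha> \<subseteq> P \<and> (\<forall>x \<in> \<alpha>. \<forall>y \<in> P. (y, x) \<in> r \<longrightarrow> y \<in> \<alpha>)}"

definition covered_by :: "'a rel \<Rightarrow> 'a \<Rightarrow> 'a \<Rightarrow> bool" where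
  "covered_by r x y \<longleftrightarrow> (x, y) \<in> r \<and> x \<noteq> y \<and>
     \<not> (\<exists>z. (x, z) \<in> r \<and> x \<noteq> z \<and> (z, y) \<in> r \<and> z \<noteq> y)"

definition incomparable :: "'a rel \<Rightarrow> 'a \<Rightarrow> 'a \<Rightarrow> bool" where
  "incomparable r x y \<longleftrightarrow> (x, y) \<notin> r \<and> (y, x) \<notin> r"

text \<open>The variable \<open>None\<close> is \<open>t\<close>, and \<open>Some p\<close> is the variable \<open>z\<close> attached to \<open>p\<close>.\<close>

definition hibi_monomial :: "'a set \<Rightarrow> ('a option, 'k::field) mpoly" where
  "hibi_monomial \<alpha> =
     Poly_Mapping.single (Poly_Mapping.single None 1 + (\<Sum>p \<in> \<alpha>. Poly_Mapping.single (Some p) 1)) 1"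

definition hibi_ring :: "'a set \<Rightarrow> 'a rel \<Rightarrow> ('a option, 'k::field) mpoly ring" where
  "hibi_ring P r = ring_of_type_algebra
     \<lparr>carrier := generate_ring ring_of_type_algebra
        ({const c | c. True} \<union> hibi_monomial ` order_ideals P r)\<rparr>"

definition hibi_component :: "'a set \<Rightarrow> 'a rel \<Rightarrow> nat \<Rightarrow> ('a option, 'k::field) mpoly set" where
  "hibi_component P r j =
     {f \<in> carrier (hibi_ring P r). \<forall>m \<in> Poly_Mapping.keys f. Poly_Mapping.lookup m None = j}"

text \<open>The coefficient field enters only through its type.\<close>

definition hibi_betti :: "'k::field itself \<Rightarrow> 'a set \<Rightarrow> 'a rel \<Rightarrow> nat \<Rightarrow> nat \<Rightarrow> nat" where
  "hibi_betti K P r i j =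
     graded_betti (order_ideals P r)
       (subst hibi_monomial :: ('a set, 'k) mpoly \<Rightarrow> ('a option, 'k) mpoly)
       (carrier (hibi_ring P r)) (hibi_component P r) i j"

definition hibi_property_N :: "'k::field itself \<Rightarrow> nat \<Rightarrow> 'a set \<Rightarrow> 'a rel \<Rightarrow> bool" where
  "hibi_property_N K p P r \<longleftrightarrow>
     normal_domain (hibi_ring P r :: ('a option, 'k) mpoly ring) \<and>
     (\<forall>i j. 1 \<le> i \<and> i \<le> p \<and> j \<noteq> i + 1 \<longrightarrow> hibi_betti K P r i j = 0)"

end

theory Submission
  imports Defs "HOL-Library.Function_Algebras" "HOL-Library.Nat_Bijection"
begin

text \<open>
  Let \<open>I\<close> be the defining ideal of a Hibi ring, and \<open>xs\<close> and \<open>ys\<close> the two chains. The first two Betti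
  numbers vanish in a given degree iff \<open>I\<close> has no minimal generator of that degree, respectively the first
  Koszul homology of \<open>I\<close> vanishes in that degree.

  If both \<open>xs ! 0 \<le> last ys\<close> and \<open>ys ! 0 \<le> last xs\<close>, the ideals generated near the bottom and near the top of the
  chains give two quadratic relations whose Koszul syzygy, of degree four, is minimal; so \<open>N\<^sub>2\<close> fails for
  \<open>P\<close>, whatever happens on the chains. Otherwise, say \<open>xs ! 0\<close> lies below no element of \<open>ys\<close>. Then \<open>P\<close> retracts
  monotonically onto the two chains with a least and a greatest element added, the Hibi ring of the chains is
  an algebra retract of that of \<open>P\<close>, and both normality and the vanishing of Betti numbers pass to retracts.
\<close>

text \<open>\<open>graded_betti\<close> is a definite description over all minimal resolutions, so a
  Betti number can be evaluated only after existence and independence of the choice are known. Both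
  rest on one fact about a minimal step F -> N with kernel Z: it identifies F/\<mm>F with N/\<mm>N,
  and Z/\<mm>Z with the first Koszul homology of N. For N = I the counts of generators become
  dimensions of spaces in which no resolution occurs and which are functorial for substitutions of
  variables. The case distinction decides whether a retraction can be monotone. If
  \<open>xs ! 0\<close> is below no element of \<open>ys\<close>, the elements of P above
  \<open>xs ! 0\<close> can be sent upwards into \<open>xs\<close> and all others downwards into
  \<open>ys\<close>. The added least and greatest elements catch those without a target; the
  greatest one lies in no ideal, so its fibre enters no formula. In the other case the ends of the
  chains form two incomparable pairs, one below the other, and the syzygy is detected by quadratic
  monomials that are alone in their fibres.\<close>

abbreviation "lookup \<equiv> Poly_Mapping.lookup"
abbreviation "keys \<equiv> Poly_Mapping.keys"
abbreviation "single \<equiv> Poly_Mapping.single"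

section \<open>Polynomials and their homogeneous parts\<close>

lemma poly_mapping_sum_single: "f = (\<Sum>m\<in>keys f. single m (lookup f m))"
  by (rule poly_mapping_eqI) (auto simp: lookup_sum lookup_single when_def in_keys_iff sum.delta')

lemma lookup_sum_single:
  "finite L \<Longrightarrow> lookup (\<Sum>l\<in>L. single l (g l)) k = (if k \<in> L then g k else 0)"
  by (auto simp: lookup_sum lookup_single when_def sum.delta')

lemma total_deg_superset: "finite A \<Longrightarrow> keys m \<subseteq> A \<Longrightarrow> total_deg m = (\<Sum>v\<in>A. lookup m v)"
  unfolding total_deg_def by (rule sum.mono_neutral_left) (auto simp: in_keys_iff)

lemma total_deg_add: "total_deg (m + n) = total_deg m + total_deg n"
proof -
  have "keys (m + n) \<subseteq> keys m \<union> keys n" by (rule Poly_Mapping.keys_add)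
  then show ?thesis
    using total_deg_superset[of "keys m \<union> keys n" m] total_deg_superset[of "keys m \<union> keys n" n]
      total_deg_superset[of "keys m \<union> keys n" "m + n"]
    by (simp add: lookup_add sum.distrib)
qed

lemma total_deg_zero [simp]: "total_deg 0 = 0"
  by (simp add: total_deg_def)

lemma total_deg_single [simp]: "total_deg (single v k) = k"
  by (cases "k = 0") (simp_all add: total_deg_def)

lemma total_deg_eq_0_iff [simp]: "total_deg m = 0 \<longleftrightarrow> m = 0"
  by (auto simp: total_deg_def in_keys_iff poly_mapping_eq_iff fun_eq_iff)

lemma keys_add_nat: "keys (m + n :: 'v \<Rightarrow>\<^sub>0 nat) = keys m \<union> keys n"
  by (auto simp: in_keys_iff lookup_add)

definition indet :: "'v \<Rightarrow> ('v, 'k::zero_neq_one) mpoly" where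
  "indet v = single (single v 1) 1"

lemma const_mult: "const a * const b = const (a * b :: 'k::comm_ring_1)"
  by (simp add: const_def mult_single)

lemma const_add: "const a + const b = const (a + b :: 'k::comm_ring_1)"
  by (simp add: const_def single_add)

lemma const_uminus: "const (- a) = - const (a :: 'k::comm_ring_1)"
  by (simp add: const_def single_uminus)

lemma const_0 [simp]: "const 0 = 0"
  by (simp add: const_def)

lemma const_1 [simp]: "const 1 = 1"
  by (simp add: const_def)

lemma lookup_single_mult:
  fixes g :: "('v, 'k::comm_ring_1) mpoly"
  shows "lookup (single m c * g) n =
    (if \<forall>v. lookup m v \<le> lookup n v then c * lookup g (n - m) else 0)"
proof -
  have *: "n = m + q \<longleftrightarrow> (\<forall>v. lookup m v \<le> lookup n v) \<and> q = n - m" for q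
    by (auto simp: poly_mapping_eq_iff fun_eq_iff lookup_add lookup_minus)
  have "lookup (single m c * g) n = c * Sum_any (\<lambda>q. lookup g q when n = m + q)"
    by (simp add: lookup_mult lookup_single when_mult)
  also have "\<dots> = (if \<forall>v. lookup m v \<le> lookup n v then c * lookup g (n - m) else 0)"
    by (simp add: *)
  finally show ?thesis .
qed

lemma lookup_indet_mult:
  fixes g :: "('v, 'k::comm_ring_1) mpoly"
  shows "lookup (indet v * g) n = (if v \<in> keys n then lookup g (n - single v 1) else 0)"
  unfolding indet_def lookup_single_mult
  by (auto simp: lookup_single when_def in_keys_iff Suc_le_eq)

lemma lookup_indet_mult_add:
  fixes g :: "('v, 'k::comm_ring_1) mpoly"
  shows "lookup (indet v * g) (single v 1 + n) = lookup g n"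
  unfolding lookup_indet_mult keys_add_nat by simp

lemma zero_in_polys_in [simp]: "0 \<in> polys_in V"
  by (simp add: polys_in_def)

lemma const_in_polys_in [simp]: "const c \<in> polys_in V"
  by (simp add: polys_in_def const_def)

lemma one_in_polys_in [simp]: "1 \<in> polys_in V"
  by (simp add: polys_in_def)

lemma indet_in_polys_in [simp]: "indet v \<in> polys_in V \<longleftrightarrow> v \<in> V"
  by (simp add: polys_in_def indet_def)

lemma polys_in_add: "f \<in> polys_in V \<Longrightarrow> g \<in> polys_in V \<Longrightarrow> f + g \<in> polys_in V"
  using Poly_Mapping.keys_add[of f g] by (auto simp: polys_in_def)

lemma polys_in_uminus: "f \<in> polys_in V \<Longrightarrow> - (f :: ('v, 'k::comm_ring_1) mpoly) \<in> polys_in V"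
  by (auto simp: polys_in_def in_keys_iff)

lemma polys_in_diff:
  "f \<in> polys_in V \<Longrightarrow> g \<in> polys_in V \<Longrightarrow> f - (g :: ('v, 'k::comm_ring_1) mpoly) \<in> polys_in V"
  using polys_in_add[of f V "- g"] polys_in_uminus[of g V] by simp

lemma polys_in_mult:
  "f \<in> polys_in V \<Longrightarrow> g \<in> polys_in V \<Longrightarrow> f * (g :: ('v, 'k::comm_ring_1) mpoly) \<in> polys_in V"
  using Poly_Mapping.keys_mult[of f g] by (fastforce simp: polys_in_def keys_add_nat)

lemma polys_in_sum: "(\<And>i. i \<in> A \<Longrightarrow> f i \<in> polys_in V) \<Longrightarrow> sum f A \<in> polys_in V"
  by (induction A rule: infinite_finite_induct) (auto intro: polys_in_add)

definition hom_polys :: "'v set \<Rightarrow> nat \<Rightarrow> ('v, 'k::zero) mpoly set" where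
  "hom_polys V j = {f \<in> polys_in V. \<forall>m \<in> keys f. total_deg m = j}"

lemma hom_polys_polys_in: "f \<in> hom_polys V j \<Longrightarrow> f \<in> polys_in V"
  by (simp add: hom_polys_def)

lemma hom_polys_0 [simp]: "0 \<in> hom_polys V j"
  by (simp add: hom_polys_def)

lemma hom_polys_add: "f \<in> hom_polys V j \<Longrightarrow> g \<in> hom_polys V j \<Longrightarrow> f + g \<in> hom_polys V j"
  using Poly_Mapping.keys_add[of f g] by (auto simp: hom_polys_def intro: polys_in_add)

lemma hom_polys_sum: "(\<And>i. i \<in> A \<Longrightarrow> f i \<in> hom_polys V j) \<Longrightarrow> sum f A \<in> hom_polys V j"
  by (induction A rule: infinite_finite_induct) (auto intro: hom_polys_add)

lemma hom_polys_mult: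
  "f \<in> hom_polys V i \<Longrightarrow> g \<in> hom_polys V j \<Longrightarrow> f * (g :: ('v, 'k::comm_ring_1) mpoly) \<in> hom_polys V (i + j)"
  using Poly_Mapping.keys_mult[of f g]
  by (fastforce simp: hom_polys_def total_deg_add intro: polys_in_mult)

lemma hom_polys_const: "const c \<in> hom_polys V 0"
  by (simp add: hom_polys_def const_def polys_in_def)

lemma hom_polys_indet: "v \<in> V \<Longrightarrow> indet v \<in> hom_polys V 1"
  by (simp add: hom_polys_def indet_def polys_in_def)

lemma hom_polys_const_mult:
  "f \<in> hom_polys V j \<Longrightarrow> const c * (f :: ('v, 'k::comm_ring_1) mpoly) \<in> hom_polys V j"
  using hom_polys_mult[OF hom_polys_const, of f V j c] by simp

lemma hom_polys_indet_mult:
  "f \<in> hom_polys V j \<Longrightarrow> v \<in> V \<Longrightarrow> indet v * (f :: ('v, 'k::comm_ring_1) mpoly) \<in> hom_polys V (Suc j)"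
  using hom_polys_mult[OF hom_polys_indet, of v V f j] by simp

definition hom_part :: "nat \<Rightarrow> ('v, 'k::comm_monoid_add) mpoly \<Rightarrow> ('v, 'k) mpoly" where
  "hom_part j f = (\<Sum>m\<in>{m \<in> keys f. total_deg m = j}. single m (lookup f m))"

lemma lookup_hom_part: "lookup (hom_part j f) m = (if total_deg m = j then lookup f m else 0)"
  by (auto simp: hom_part_def lookup_sum_single in_keys_iff)

lemma hom_part_in_hom_polys: "f \<in> polys_in V \<Longrightarrow> hom_part j f \<in> hom_polys V j"
  by (auto simp: hom_polys_def polys_in_def in_keys_iff lookup_hom_part split: if_splits)

lemma hom_part_id: "f \<in> hom_polys V j \<Longrightarrow> hom_part j f = f"
  by (rule poly_mapping_eqI) (auto simp: hom_polys_def in_keys_iff lookup_hom_part)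

text \<open>The components of the twisted module N(-d). Below degree \<open>d\<close> the value is
  {0}, where truncated subtraction would yield \<open>N 0\<close>.\<close>

definition shift :: "nat \<Rightarrow> (nat \<Rightarrow> 'm::zero set) \<Rightarrow> nat \<Rightarrow> 'm set" where
  "shift d N j = (if d \<le> j then N (j - d) else {0})"

abbreviation "prev \<equiv> shift (Suc 0)"

lemma shift_Suc [simp]: "prev N (Suc j) = N j"
  by (simp add: shift_def)

lemma shift_0 [simp]: "shift 0 N = N"
  by (rule ext) (simp add: shift_def)

lemma shift_shift: "shift d (shift e N) = shift (d + e) N"
  by (rule ext) (auto simp: shift_def)

text \<open>Each monomial of \<open>f\<close> is divisible by some variable; charging it to one such
  variable, chosen by \<open>pick\<close>, sorts \<open>f\<close> into the summands without changing
  a coefficient.\<close>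

lemma hom_polys_split:
  fixes f :: "('v, 'k::comm_ring_1) mpoly"
  assumes "finite V" "f \<in> hom_polys V j" "lookup f 0 = 0"
  shows "\<exists>w. (\<forall>v\<in>V. w v \<in> prev (hom_polys V) j) \<and> f = (\<Sum>v\<in>V. indet v * w v)"
proof (cases j)
  case 0
  have "f = 0"
  proof (rule poly_mapping_eqI)
    show "lookup f m = lookup 0 m" for m
      using assms 0 by (cases "m = 0") (auto simp: hom_polys_def in_keys_iff)
  qed
  then show ?thesis by (intro exI[of _ "\<lambda>_. 0"]) (simp add: 0 shift_def)
next
  case (Suc i)
  define pick where "pick m = (SOME v. v \<in> keys m)" for m :: "'v \<Rightarrow>\<^sub>0 nat"
  have pick: "pick m \<in> keys m" "pick m \<in> V" if "m \<in> keys f" for m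
  proof -
    have "m \<noteq> 0" using assms(3) that by (auto simp: in_keys_iff)
    then have "keys m \<noteq> {}" by simp
    then show "pick m \<in> keys m" unfolding pick_def by (rule some_in_eq[THEN iffD2])
    then show "pick m \<in> V" using assms(2) that by (auto simp: hom_polys_def polys_in_def)
  qed
  define w where "w v = (\<Sum>m\<in>{m \<in> keys f. pick m = v}. single (m - single v 1) (lookup f m))" for v
  have single_split: "indet v * single (m - single v 1) c = single m c" if "v \<in> keys m"
    for v m and c :: 'k
  proof -
    have "single v 1 + (m - single v 1) = m"
      using that by (auto simp: poly_mapping_eq_iff fun_eq_iff lookup_add lookup_minus lookup_single when_def in_keys_iff)
    then show ?thesis by (simp add: indet_def mult_single)
  qed
  have "(\<Sum>v\<in>V. indet v * w v) = (\<Sum>v\<in>V. \<Sum>m\<in>{m \<in> keys f. pick m = v}. single m (lookup f m))"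
    unfolding w_def sum_distrib_left by (intro sum.cong refl, clarify) (rule single_split[OF pick(1)])
  also have "\<dots> = (\<Sum>m\<in>keys f. single m (lookup f m))"
    by (rule sum.group) (use assms(1) pick in auto)
  finally have "f = (\<Sum>v\<in>V. indet v * w v)" using poly_mapping_sum_single[of f] by simp
  moreover have "w v \<in> hom_polys V i" for v
  proof -
    have "single (m - single v 1) (lookup f m) \<in> hom_polys V i" if "m \<in> keys f" "pick m = v" for m
    proof -
      have v: "v \<in> keys m" using pick that by auto
      have eq: "single v 1 + (m - single v 1) = m"
        using v by (auto simp: poly_mapping_eq_iff fun_eq_iff lookup_add lookup_minus lookup_single when_def in_keys_iff)
      have "total_deg m = Suc i" "keys m \<subseteq> V" using assms(2) that Suc by (auto simp: hom_polys_def polys_in_def)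
      then have "total_deg (m - single v 1) = i" "keys (m - single v 1) \<subseteq> V"
        using total_deg_add[of "single v 1" "m - single v 1"] keys_add_nat[of "single v 1" "m - single v 1"]
        unfolding eq by auto
      then show ?thesis by (auto simp: hom_polys_def polys_in_def)
    qed
    then show ?thesis unfolding w_def by (intro hom_polys_sum) auto
  qed
  ultimately show ?thesis unfolding Suc shift_Suc by (intro exI[of _ w] conjI ballI)
qed

section \<open>Bases modulo a subspace\<close>

text \<open>Independence in the quotient by \<open>U\<close>, without a quotient type. Families are
  used instead of sets so that the number of generators of a resolution is the cardinality of the
  index set itself; finite subfamilies occur because that set may be infinite.\<close>

definition indep_mod :: "('k::field \<Rightarrow> 'b::ab_group_add \<Rightarrow> 'b) \<Rightarrow> 'b set \<Rightarrow> 'i set \<Rightarrow> ('i \<Rightarrow> 'b) \<Rightarrow> bool" where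
  "indep_mod s U A f \<longleftrightarrow> (\<forall>c A0. finite A0 \<longrightarrow> A0 \<subseteq> A \<longrightarrow> (\<Sum>l\<in>A0. s (c l) (f l)) \<in> U \<longrightarrow> (\<forall>l\<in>A0. c l = 0))"

definition spans_mod ::
  "('k::field \<Rightarrow> 'b::ab_group_add \<Rightarrow> 'b) \<Rightarrow> 'b set \<Rightarrow> 'b set \<Rightarrow> 'i set \<Rightarrow> ('i \<Rightarrow> 'b) \<Rightarrow> bool" where
  "spans_mod s U W A f \<longleftrightarrow> (\<forall>w\<in>W. \<exists>c A0. finite A0 \<and> A0 \<subseteq> A \<and> w - (\<Sum>l\<in>A0. s (c l) (f l)) \<in> U)"

definition basis_mod ::
  "('k::field \<Rightarrow> 'b::ab_group_add \<Rightarrow> 'b) \<Rightarrow> 'b set \<Rightarrow> 'b set \<Rightarrow> 'i set \<Rightarrow> ('i \<Rightarrow> 'b) \<Rightarrow> bool" where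
  "basis_mod s U W A f \<longleftrightarrow> f ` A \<subseteq> W \<and> indep_mod s U A f \<and> spans_mod s U W A f"

lemma indep_modD:
  "indep_mod s U A f \<Longrightarrow> finite A0 \<Longrightarrow> A0 \<subseteq> A \<Longrightarrow> (\<Sum>l\<in>A0. s (c l) (f l)) \<in> U \<Longrightarrow> l \<in> A0 \<Longrightarrow> c l = 0"
  unfolding indep_mod_def by blast

lemma sum_fun_apply: "(\<Sum>i\<in>A. f i :: 'd \<Rightarrow> 'b::comm_monoid_add) x = (\<Sum>i\<in>A. f i x)"
  by (induction A rule: infinite_finite_induct) simp_all

lemma vector_space_fun: "vector_space (\<lambda>(c::'k::field) g (x::'d). c * g x)"
  by unfold_locales (auto simp: fun_eq_iff algebra_simps)

context vector_space
begin

lemma spans_mod_finite: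
  assumes "spans_mod scale U W A f" "finite A" "w \<in> W"
  obtains c where "w - (\<Sum>l\<in>A. c l *s f l) \<in> U"
proof -
  obtain c A0 where c: "A0 \<subseteq> A" "w - (\<Sum>l\<in>A0. c l *s f l) \<in> U"
    using assms(1,3) unfolding spans_mod_def by blast
  have "(\<Sum>l\<in>A0. c l *s f l) = (\<Sum>l\<in>A. (if l \<in> A0 then c l else 0) *s f l)"
    by (rule sum.mono_neutral_cong_left) (use assms(2) c in auto)
  with c show thesis by (intro that[of "\<lambda>l. if l \<in> A0 then c l else 0"]) simp
qed

text \<open>Steinitz modulo \<open>U\<close>: each \<open>f l\<close> is a combination of the
  spanning family modulo \<open>U\<close>, and a dependence of the coefficient vectors would be a
  dependence of the \<open>f l\<close>. The vectors live in a space of dimension at most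
  \<open>card A'\<close>.\<close>

lemma card_le_of_indep_mod:
  fixes f :: "'i \<Rightarrow> 'b" and f' :: "'d \<Rightarrow> 'b"
  assumes U: "subspace U" and ind: "indep_mod scale U A f" and fW: "f ` A \<subseteq> W"
    and sp: "spans_mod scale U W A' f'" and fin: "finite A'"
  shows "finite A \<and> card A \<le> card A'"
proof -
  interpret fv: vector_space "\<lambda>c g (x::'d). (c::'a) * g x"
    by (rule vector_space_fun)
  have "\<forall>l\<in>A. \<exists>t. f l - (\<Sum>l'\<in>A'. t l' *s f' l') \<in> U"
  proof
    fix l assume "l \<in> A"
    then have "f l \<in> W" using fW by blast
    then obtain c where "f l - (\<Sum>l'\<in>A'. c l' *s f' l') \<in> U" by (rule spans_mod_finite[OF sp fin])
    then show "\<exists>t. f l - (\<Sum>l'\<in>A'. t l' *s f' l') \<in> U" by blast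
  qed
  from bchoice[OF this] obtain t where t: "\<And>l. l \<in> A \<Longrightarrow> f l - (\<Sum>l'\<in>A'. t l l' *s f' l') \<in> U" by blast
  \<comment> \<open>\<open>tt l\<close> is the coefficient vector of \<open>f l\<close>, cut off
    outside \<open>A'\<close> so that it lies in the span of the coordinate functions
    \<open>e l'\<close>.\<close>
  define tt where "tt l = (\<lambda>x. if x \<in> A' then t l x else 0)" for l
  define e where "e l' = (\<lambda>x. if x = l' then 1 else 0 :: 'a)" for l' :: 'd
  have key: "\<forall>l\<in>A0. c l = 0"
    if A0: "finite A0" "A0 \<subseteq> A" and z: "\<And>x. (\<Sum>l\<in>A0. c l * tt l x) = 0" for A0 c
  proof -
    have "(\<Sum>l\<in>A0. c l *s (f l - (\<Sum>l'\<in>A'. t l l' *s f' l'))) \<in> U"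
      using A0 t by (intro subspace_sum[OF U] subspace_scale[OF U]) auto
    also have "(\<Sum>l\<in>A0. c l *s (f l - (\<Sum>l'\<in>A'. t l l' *s f' l')))
        = (\<Sum>l\<in>A0. c l *s f l) - (\<Sum>l\<in>A0. \<Sum>l'\<in>A'. (c l * t l l') *s f' l')"
      by (simp add: scale_right_diff_distrib sum_subtractf scale_sum_right)
    also have "(\<Sum>l\<in>A0. \<Sum>l'\<in>A'. (c l * t l l') *s f' l') = (\<Sum>l'\<in>A'. (\<Sum>l\<in>A0. c l * tt l l') *s f' l')"
      by (subst sum.swap) (auto simp: scale_sum_left tt_def intro!: sum.cong)
    finally have "(\<Sum>l\<in>A0. c l *s f l) \<in> U" by (simp add: z)
    then show ?thesis using indep_modD[OF ind A0] by blast
  qed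
  have *: "card A0 \<le> card A'" if A0: "finite A0" "A0 \<subseteq> A" for A0
  proof -
    \<comment> \<open>Coefficients 1 and -1 at two equal vectors would contradict
      \<open>key\<close>, so passing from the family to its set of values loses nothing.\<close>
    have inj: "inj_on tt A0"
    proof (rule inj_onI, rule ccontr)
      fix l m assume lm: "l \<in> A0" "m \<in> A0" "tt l = tt m" "l \<noteq> m"
      have "\<forall>i\<in>{l, m}. (if i = l then 1 else - 1 :: 'a) = 0"
        by (rule key) (use lm A0 in auto)
      then show False by simp
    qed
    have "fv.independent (tt ` A0)"
    proof (rule fv.independent_if_scalars_zero)
      show "finite (tt ` A0)" using A0 by simp
      fix c x assume s: "(\<Sum>x\<in>tt ` A0. (\<lambda>y. c x * x y)) = 0" and x: "x \<in> tt ` A0"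
      have "(\<Sum>l\<in>A0. c (tt l) * tt l y) = 0" for y
      proof -
        have "(\<Sum>x\<in>tt ` A0. (\<lambda>y. c x * x y)) y = (\<Sum>x\<in>tt ` A0. c x * x y)"
          by (rule sum_fun_apply)
        also have "\<dots> = (\<Sum>l\<in>A0. c (tt l) * tt l y)"
          by (simp add: sum.reindex[OF inj])
        finally show ?thesis using s by simp
      qed
      then have "\<forall>l\<in>A0. c (tt l) = 0" by (rule key[OF A0])
      then show "c x = 0" using x by blast
    qed
    moreover have "tt ` A0 \<subseteq> fv.span (e ` A')"
    proof safe
      fix l
      have "tt l = (\<Sum>l'\<in>A'. (\<lambda>x. t l l' * e l' x))"
      proof
        fix x
        have "(\<Sum>l'\<in>A'. (\<lambda>x. t l l' * e l' x)) x = (\<Sum>l'\<in>A'. t l l' * e l' x)"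
          by (rule sum_fun_apply)
        also have "\<dots> = (\<Sum>l'\<in>A'. if x = l' then t l l' else 0)"
          by (intro sum.cong) (auto simp: e_def)
        also have "\<dots> = tt l x"
          using fin by (simp add: tt_def)
        finally show "tt l x = (\<Sum>l'\<in>A'. (\<lambda>x. t l l' * e l' x)) x" ..
      qed
      also have "\<dots> \<in> fv.span (e ` A')"
        by (intro fv.span_sum fv.span_scale fv.span_base) auto
      finally show "tt l \<in> fv.span (e ` A')" .
    qed
    ultimately have "card (tt ` A0) \<le> card (e ` A')"
      using fv.independent_span_bound[of "e ` A'" "tt ` A0"] fin by simp
    also have "\<dots> \<le> card A'" by (rule card_image_le[OF fin])
    finally show ?thesis by (simp add: card_image[OF inj])
  qed
  have "finite A"
  proof (rule ccontr)
    assume "infinite A"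
    then obtain A0 where "A0 \<subseteq> A" "finite A0" "card A0 = Suc (card A')"
      using infinite_arbitrarily_large by metis
    then show False using *[of A0] by simp
  qed
  then show ?thesis using * by blast
qed

lemma basis_mod_card_unique:
  assumes "subspace U" "basis_mod scale U W A f" "basis_mod scale U W A' f'" "finite A'"
  shows "finite A \<and> card A = card A'"
  using card_le_of_indep_mod[of U A f W A' f'] card_le_of_indep_mod[of U A' f' W A f] assms
  unfolding basis_mod_def by (metis le_antisym)

text \<open>The lengths of independent families are bounded by the size of a spanning family. A
  longest one spans, since an element outside its span modulo \<open>U\<close> could be
  appended.\<close>

lemma basis_mod_exists:
  fixes f' :: "'d \<Rightarrow> 'b"
  assumes U: "subspace U" and sp: "spans_mod scale U W A' f'" and fin: "finite A'"
  shows "\<exists>n f. basis_mod scale U W {..<n::nat} f"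
proof -
  define Q where "Q n \<longleftrightarrow> (\<exists>f. f ` {..<n::nat} \<subseteq> W \<and> indep_mod scale U {..<n} f)" for n
  have "Q 0" by (auto simp: Q_def indep_mod_def)
  moreover have "n \<le> card A'" if "Q n" for n
    using that card_le_of_indep_mod[OF U _ _ sp fin, of "{..<n}"] unfolding Q_def by auto
  ultimately have "Q (GREATEST n. Q n)" and max: "\<And>n. Q n \<Longrightarrow> n \<le> (GREATEST n. Q n)"
    by (auto intro: GreatestI_nat Greatest_le_nat)
  then obtain n f where n: "n = (GREATEST n. Q n)" and f: "f ` {..<n} \<subseteq> W" "indep_mod scale U {..<n} f"
    unfolding Q_def by blast
  have "spans_mod scale U W {..<n} f"
  proof (rule ccontr)
    assume "\<not> ?thesis"
    then obtain w where w: "w \<in> W" "\<And>c A0. A0 \<subseteq> {..<n} \<Longrightarrow> w - (\<Sum>l\<in>A0. c l *s f l) \<notin> U"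
      unfolding spans_mod_def by (meson finite_lessThan rev_finite_subset)
    have "indep_mod scale U {..<Suc n} (f(n := w))"
      unfolding indep_mod_def
    proof (intro allI impI)
      fix c A0 assume A0: "finite A0" "A0 \<subseteq> {..<Suc n}" and s: "(\<Sum>l\<in>A0. c l *s (f(n := w)) l) \<in> U"
      define A1 where "A1 = A0 - {n}"
      have A1: "A1 \<subseteq> {..<n}" "finite A1" using A0 by (auto simp: A1_def less_Suc_eq)
      have eq: "(\<Sum>l\<in>A1. c l *s (f(n := w)) l) = (\<Sum>l\<in>A1. c l *s f l)"
        by (intro sum.cong) (auto simp: A1_def)
      have cn: "c n = 0" if "n \<in> A0"
      proof (rule ccontr)
        assume c: "c n \<noteq> 0"
        have eqn: "(\<Sum>l\<in>A0. c l *s (f(n := w)) l) = c n *s w + (\<Sum>l\<in>A1. c l *s f l)"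
          using that A0 eq by (simp add: sum.remove A1_def)
        \<comment> \<open>Dividing by \<open>c n\<close> would express \<open>w\<close> by the
          earlier vectors modulo \<open>U\<close>, contrary to its choice.\<close>
        have "inverse (c n) *s (c n *s w + (\<Sum>l\<in>A1. c l *s f l)) \<in> U"
          unfolding eqn[symmetric] by (rule subspace_scale[OF U s])
        also have "inverse (c n) *s (c n *s w + (\<Sum>l\<in>A1. c l *s f l))
            = w - (\<Sum>l\<in>A1. (- inverse (c n) * c l) *s f l)"
          by (simp only: scale_right_distrib scale_scale left_inverse[OF c] scale_one scale_sum_right
              mult_minus_left scale_minus_left sum_negf diff_minus_eq_add)
        finally show False using w(2)[OF A1(1)] by contradiction
      qed
      have "(\<Sum>l\<in>A0. c l *s (f(n := w)) l) = (\<Sum>l\<in>A1. c l *s (f(n := w)) l)"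
        unfolding A1_def by (rule sum.mono_neutral_right) (use A0 cn in auto)
      then have "(\<Sum>l\<in>A1. c l *s f l) \<in> U" using s eq by simp
      then have "\<forall>l\<in>A1. c l = 0" using indep_modD[OF f(2) A1(2,1)] by blast
      then show "\<forall>l\<in>A0. c l = 0" using cn by (auto simp: A1_def)
    qed
    moreover have "(f(n := w)) ` {..<Suc n} \<subseteq> W" using f(1) w(1) by (auto simp: less_Suc_eq)
    ultimately have "Q (Suc n)" unfolding Q_def by blast
    then show False using max n by fastforce
  qed
  then show ?thesis using f unfolding basis_mod_def by blast
qed

lemma basis_mod_empty_iff:
  assumes U: "subspace U" and "basis_mod scale U W A f"
  shows "A = {} \<longleftrightarrow> W \<subseteq> U"
proof
  assume "A = {}"
  then show "W \<subseteq> U" using assms(2) unfolding basis_mod_def spans_mod_def by auto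
next
  assume WU: "W \<subseteq> U"
  show "A = {}"
  proof (rule ccontr)
    assume "A \<noteq> {}"
    then obtain l where l: "l \<in> A" by blast
    then have "f l \<in> U" using assms(2) WU unfolding basis_mod_def by blast
    then show False
      using indep_modD[of scale U A f "{l}" "\<lambda>_. 1"] l assms(2) unfolding basis_mod_def by auto
  qed
qed

end

text \<open>\<open>Rel\<close> induces an isomorphism between the quotients \<open>Z / U\<close> and \<open>W / U'\<close>.\<close>

lemma basis_mod_transfer:
  fixes s1 :: "'k::field \<Rightarrow> 'b::ab_group_add \<Rightarrow> 'b" and s2 :: "'k \<Rightarrow> 'c::ab_group_add \<Rightarrow> 'c"
  assumes bas: "basis_mod s1 U Z A z"
    and U: "vector_space s1" "module.subspace s1 U"
    and zero: "Rel 0 0"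
    and add: "\<And>x y a b. Rel x a \<Longrightarrow> Rel y b \<Longrightarrow> Rel (x + y) (a + b)"
    and scl: "\<And>c x a. Rel x a \<Longrightarrow> Rel (s1 c x) (s2 c a)"
    and min: "\<And>x a. Rel x a \<Longrightarrow> Rel (- x) (- a)"
    and tot: "\<And>x. x \<in> Z \<Longrightarrow> \<exists>a. Rel x a" and sur: "\<And>a. a \<in> W \<Longrightarrow> \<exists>x. Rel x a"
    and dom: "\<And>x a. Rel x a \<Longrightarrow> x \<in> Z \<and> a \<in> W"
    and iff: "\<And>x a. Rel x a \<Longrightarrow> x \<in> U \<longleftrightarrow> a \<in> U'"
  shows "\<exists>f. basis_mod s2 U' W A f"
proof -
  have "\<forall>l\<in>A. \<exists>a. Rel (z l) a" using bas tot unfolding basis_mod_def by blast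
  then obtain f where f: "\<And>l. l \<in> A \<Longrightarrow> Rel (z l) (f l)" by metis
  have sum: "Rel (\<Sum>l\<in>A0. s1 (c l) (z l)) (\<Sum>l\<in>A0. s2 (c l) (f l))"
    if "finite A0" "A0 \<subseteq> A" for A0 c
    using that by (induction A0 rule: finite_induct) (auto intro!: zero add scl f)
  have "indep_mod s2 U' A f"
    unfolding indep_mod_def
  proof (intro allI impI)
    fix c A0 assume A0: "finite A0" "A0 \<subseteq> A" "(\<Sum>l\<in>A0. s2 (c l) (f l)) \<in> U'"
    have "indep_mod s1 U A z" using bas unfolding basis_mod_def by blast
    moreover have "(\<Sum>l\<in>A0. s1 (c l) (z l)) \<in> U" using iff[OF sum[OF A0(1,2)]] A0(3) by blast
    ultimately show "\<forall>l\<in>A0. c l = 0" using indep_modD[OF _ A0(1,2)] by blast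
  qed
  moreover have "spans_mod s2 U' W A f"
    unfolding spans_mod_def
  proof
    fix a assume "a \<in> W"
    then obtain x where x: "Rel x a" using sur by blast
    then obtain c A0 where c: "finite A0" "A0 \<subseteq> A" "x - (\<Sum>l\<in>A0. s1 (c l) (z l)) \<in> U"
      using bas dom unfolding basis_mod_def spans_mod_def by blast
    have "Rel (x + - (\<Sum>l\<in>A0. s1 (c l) (z l))) (a + - (\<Sum>l\<in>A0. s2 (c l) (f l)))"
      using c by (intro add min sum x)
    then have "a - (\<Sum>l\<in>A0. s2 (c l) (f l)) \<in> U'" using c(3) iff by fastforce
    then show "\<exists>c A0. finite A0 \<and> A0 \<subseteq> A \<and> a - (\<Sum>l\<in>A0. s2 (c l) (f l)) \<in> U'"
      using c by blast
  qed
  moreover have "f ` A \<subseteq> W" using f dom by blast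
  ultimately show ?thesis unfolding basis_mod_def by blast
qed

section \<open>The Koszul complex of a graded module\<close>

text \<open>The degree \<open>j\<close> part of \<mm>N. Its codimension in \<open>N j\<close> is the
  number of minimal generators of degree \<open>j\<close>.\<close>

definition irr_part ::
  "'v set \<Rightarrow> (('v, 'k::field) mpoly \<Rightarrow> 'm::ab_group_add \<Rightarrow> 'm) \<Rightarrow> (nat \<Rightarrow> 'm set) \<Rightarrow> nat \<Rightarrow> 'm set" where
  "irr_part V act N j = {\<Sum>v\<in>V. act (indet v) (n v) | n. \<forall>v\<in>V. n v \<in> prev N j}"

text \<open>A family \<open>a\<close> stands for the Koszul chain
  \<open>\<Sum>\<^sub>v a\<^sub>v e\<^sub>v\<close>. The index \<open>j\<close> is the degree of the
  coefficients, so the internal degree of the chain is \<open>j + 1\<close>.\<close>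

definition koszul_cycles ::
  "'v set \<Rightarrow> (('v, 'k::field) mpoly \<Rightarrow> 'm::ab_group_add \<Rightarrow> 'm) \<Rightarrow> (nat \<Rightarrow> 'm set) \<Rightarrow> nat \<Rightarrow> ('v \<Rightarrow> 'm) set" where
  "koszul_cycles V act N j = {a. (\<forall>v\<in>V. a v \<in> N j) \<and> (\<Sum>v\<in>V. act (indet v) (a v)) = 0}"

text \<open>The vanishing of the diagonal is demanded separately because it does not follow from the
  sign rule in characteristic 2.\<close>

definition alternating :: "'v set \<Rightarrow> ('v \<Rightarrow> 'v \<Rightarrow> 'm::ab_group_add) \<Rightarrow> bool" where
  "alternating V c \<longleftrightarrow> (\<forall>v\<in>V. c v v = 0) \<and> (\<forall>v\<in>V. \<forall>w\<in>V. c w v = - c v w)"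

text \<open>A second Koszul chain is stored as its alternating matrix of coefficients. As for
  cycles, \<open>j\<close> is the degree of the coefficients \<open>a v\<close>, so those of
  \<open>c\<close> have degree one less.\<close>

definition koszul_boundaries ::
  "'v set \<Rightarrow> (('v, 'k::field) mpoly \<Rightarrow> 'm::ab_group_add \<Rightarrow> 'm) \<Rightarrow> (nat \<Rightarrow> 'm set) \<Rightarrow> nat \<Rightarrow> ('v \<Rightarrow> 'm) set" where
  "koszul_boundaries V act N j = {a. \<exists>c. alternating V c \<and> (\<forall>v\<in>V. \<forall>w\<in>V. c v w \<in> prev N j) \<and>
     (\<forall>v\<in>V. a v = (\<Sum>w\<in>V. act (indet w) (c v w)))}"

lemma alternating_diag: "alternating V c \<Longrightarrow> v \<in> V \<Longrightarrow> c v v = 0"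
  by (simp add: alternating_def)

lemma alternating_swap: "alternating V c \<Longrightarrow> v \<in> V \<Longrightarrow> w \<in> V \<Longrightarrow> c w v = - c v w"
  unfolding alternating_def by blast

text \<open>The reason why two consecutive Koszul differentials compose to zero. The induction
  cancels the cross terms of each new index pairwise, so that no division by 2 occurs.\<close>

lemma (in Modules.module) alternating_sum_zero:
  assumes "finite V" "alternating V c"
  shows "(\<Sum>v\<in>V. s v *s (\<Sum>w\<in>V. s w *s c v w)) = 0"
  using assms(1,2)
proof (induction V rule: finite_induct)
  case empty
  then show ?case by simp
next
  case (insert u V)
  have alt: "alternating V c" "c u u = 0" "\<And>v. v \<in> V \<Longrightarrow> c v u = - c u v"
    using insert.prems unfolding alternating_def by blast+
  have "(\<Sum>v\<in>V. s v *s (s u *s c v u)) = - (\<Sum>v\<in>V. s u *s (s v *s c u v))"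
    unfolding sum_negf[symmetric] using alt(3)
    by (intro sum.cong) (simp_all add: mult.commute[of "s u"])
  then show ?case
    using insert alt by (simp add: scale_right_distrib sum.distrib scale_sum_right)
qed

text \<open>
  Only the action of constants and of the variables in \<open>V\<close> is relevant, so that a graded module is
  given by its homogeneous components.
\<close>

locale graded_module = Modules.module act
  for act :: "('v, 'k::field) mpoly \<Rightarrow> 'm::ab_group_add \<Rightarrow> 'm" +
  fixes V :: "'v set" and N :: "nat \<Rightarrow> 'm set"
  assumes finite_V: "finite V"
    and N_zero: "0 \<in> N j"
    and N_add: "x \<in> N j \<Longrightarrow> y \<in> N j \<Longrightarrow> x + y \<in> N j"
    and N_const: "x \<in> N j \<Longrightarrow> act (const c) x \<in> N j"
    and N_indet: "x \<in> N j \<Longrightarrow> v \<in> V \<Longrightarrow> act (indet v) x \<in> N (Suc j)"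
begin

lemma vector_space: "vector_space (\<lambda>c. act (const c))"
  by unfold_locales
    (simp_all add: scale_right_distrib scale_left_distrib const_add[symmetric] const_mult)

lemma vector_space_pointwise: "vector_space (\<lambda>c (a :: 'v \<Rightarrow> 'm) v. act (const c) (a v))"
  by unfold_locales
    (simp_all add: scale_right_distrib scale_left_distrib const_add[symmetric] const_mult fun_eq_iff)

lemma N_uminus: "x \<in> N j \<Longrightarrow> - x \<in> N j"
  using N_const[of x j "- 1"] by (simp add: const_uminus)

lemma N_diff: "x \<in> N j \<Longrightarrow> y \<in> N j \<Longrightarrow> x - y \<in> N j"
  using N_add[of x j "- y"] N_uminus[of y j] by simp

lemma N_sum: "(\<And>i. i \<in> A \<Longrightarrow> f i \<in> N j) \<Longrightarrow> sum f A \<in> N j"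
  by (induction A rule: infinite_finite_induct) (auto intro: N_add N_zero)

lemma graded_module_shift: "graded_module act V (shift d N)"
proof unfold_locales
  show "finite V" by (rule finite_V)
  fix j x y c v
  show "0 \<in> shift d N j" by (simp add: shift_def N_zero)
  show "x + y \<in> shift d N j" if "x \<in> shift d N j" "y \<in> shift d N j"
    using that by (auto simp: shift_def N_add split: if_splits)
  show "act (const c) x \<in> shift d N j" if "x \<in> shift d N j"
    using that by (auto simp: shift_def N_const split: if_splits)
  show "act (indet v) x \<in> shift d N (Suc j)" if "x \<in> shift d N j" "v \<in> V"
    using that by (auto simp: shift_def N_zero N_indet Suc_diff_le split: if_splits)
qed

lemma indet_prev: "x \<in> prev N j \<Longrightarrow> v \<in> V \<Longrightarrow> act (indet v) x \<in> N j"
  by (cases j) (auto simp: shift_def N_zero intro: N_indet)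

lemma irr_part_zero: "0 \<in> irr_part V act N j"
  unfolding irr_part_def
  using graded_module.N_zero[OF graded_module_shift] by (auto intro!: exI[of _ "\<lambda>_. 0"])

lemma irr_part_add:
  assumes "x \<in> irr_part V act N j" "y \<in> irr_part V act N j"
  shows "x + y \<in> irr_part V act N j"
proof -
  obtain n n' where n: "x = (\<Sum>v\<in>V. act (indet v) (n v))" "\<forall>v\<in>V. n v \<in> prev N j"
    "y = (\<Sum>v\<in>V. act (indet v) (n' v))" "\<forall>v\<in>V. n' v \<in> prev N j"
    using assms unfolding irr_part_def by blast
  then show ?thesis unfolding irr_part_def
    using graded_module.N_add[OF graded_module_shift]
    by (auto intro!: exI[of _ "\<lambda>v. n v + n' v"] simp: scale_right_distrib sum.distrib)
qed

lemma irr_part_const: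
  assumes "x \<in> irr_part V act N j"
  shows "act (const c) x \<in> irr_part V act N j"
proof -
  obtain n where n: "x = (\<Sum>v\<in>V. act (indet v) (n v))" "\<forall>v\<in>V. n v \<in> prev N j"
    using assms unfolding irr_part_def by blast
  have "act (const c) x = (\<Sum>v\<in>V. act (indet v) (act (const c) (n v)))"
    unfolding n scale_sum_right by (intro sum.cong refl scale_left_commute)
  moreover have "\<forall>v\<in>V. act (const c) (n v) \<in> prev N j"
    using n(2) graded_module.N_const[OF graded_module_shift] by blast
  ultimately show ?thesis unfolding irr_part_def
    by (intro CollectI exI[of _ "\<lambda>v. act (const c) (n v)"] conjI)
qed

lemma subspace_irr_part: "module.subspace (\<lambda>c. act (const c)) (irr_part V act N j)"
proof -
  interpret vs: vector_space "\<lambda>c. act (const c)" by (rule vector_space)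
  show ?thesis by (rule vs.subspaceI) (auto intro: irr_part_zero irr_part_add irr_part_const)
qed

lemma subspace_koszul_boundaries:
  "module.subspace (\<lambda>c (a :: 'v \<Rightarrow> 'm) v. act (const c) (a v)) (koszul_boundaries V act N j)"
proof -
  interpret vs: vector_space "\<lambda>c (a :: 'v \<Rightarrow> 'm) v. act (const c) (a v)" by (rule vector_space_pointwise)
  interpret P: graded_module act V "prev N" by (rule graded_module_shift)
  show ?thesis
  proof (rule vs.subspaceI)
    show "0 \<in> koszul_boundaries V act N j"
      unfolding koszul_boundaries_def alternating_def
      by (auto intro!: exI[of _ "\<lambda>_ _. 0"] P.N_zero)
  next
    fix a b :: "'v \<Rightarrow> 'm"
    assume "a \<in> koszul_boundaries V act N j" "b \<in> koszul_boundaries V act N j"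
    then obtain c d where c: "alternating V c" "\<forall>v\<in>V. \<forall>w\<in>V. c v w \<in> prev N j"
      "\<forall>v\<in>V. a v = (\<Sum>w\<in>V. act (indet w) (c v w))"
      and d: "alternating V d" "\<forall>v\<in>V. \<forall>w\<in>V. d v w \<in> prev N j"
      "\<forall>v\<in>V. b v = (\<Sum>w\<in>V. act (indet w) (d v w))"
      unfolding koszul_boundaries_def by blast
    have "alternating V (\<lambda>v w. c v w + d v w)"
      unfolding alternating_def
    proof (intro conjI ballI)
      fix v w assume "v \<in> V" "w \<in> V"
      then have "c w v = - c v w" "d w v = - d v w" using c(1) d(1) unfolding alternating_def by blast+
      then show "c w v + d w v = - (c v w + d v w)" by (simp only: minus_add_distrib)
    qed (use c(1) d(1) in \<open>simp add: alternating_def\<close>)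
    then show "a + b \<in> koszul_boundaries V act N j"
      unfolding koszul_boundaries_def using c(2,3) d(2,3)
      by (auto intro!: exI[of _ "\<lambda>v w. c v w + d v w"] P.N_add simp: scale_right_distrib sum.distrib)
  next
    fix k and a :: "'v \<Rightarrow> 'm"
    assume "a \<in> koszul_boundaries V act N j"
    then obtain c where c: "alternating V c" "\<forall>v\<in>V. \<forall>w\<in>V. c v w \<in> prev N j"
      "\<forall>v\<in>V. a v = (\<Sum>w\<in>V. act (indet w) (c v w))"
      unfolding koszul_boundaries_def by blast
    have "alternating V (\<lambda>v w. act (const k) (c v w))"
      unfolding alternating_def
    proof (intro conjI ballI)
      fix v w assume "v \<in> V" "w \<in> V"
      then have "c w v = - c v w" using c(1) unfolding alternating_def by blast
      then show "act (const k) (c w v) = - act (const k) (c v w)" by simp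
    qed (use c(1) in \<open>simp add: alternating_def\<close>)
    moreover have "act (const k) (a v) = (\<Sum>w\<in>V. act (indet w) (act (const k) (c v w)))" if "v \<in> V" for v
      using c(3) that by (simp add: scale_sum_right mult.commute)
    ultimately show "(\<lambda>v. act (const k) (a v)) \<in> koszul_boundaries V act N j"
      unfolding koszul_boundaries_def using c(2) P.N_const by blast
  qed
qed

end

section \<open>Exactness of the Koszul complex of the polynomial ring\<close>

lemma module_mult: "Modules.module ((*) :: 'a::comm_ring_1 \<Rightarrow> 'a \<Rightarrow> 'a)"
  by unfold_locales (simp_all add: algebra_simps)

lemma graded_module_hom_polys:
  "finite V \<Longrightarrow> graded_module ((*) :: ('v, 'k::field) mpoly \<Rightarrow> _) V (hom_polys V)"
  by (intro graded_module.intro module_mult graded_module_axioms.intro)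
    (auto intro: hom_polys_add hom_polys_const_mult hom_polys_indet_mult)

text \<open>Division with remainder by one variable: \<open>map_key\<close> keeps exactly the
  monomials divisible by \<open>u\<close> and divides them.\<close>

definition div_indet :: "'v \<Rightarrow> ('v, 'k::zero) mpoly \<Rightarrow> ('v, 'k) mpoly" where
  "div_indet u = Poly_Mapping.map_key (\<lambda>n. single u 1 + n)"

lemma lookup_div_indet: "lookup (div_indet u f) n = lookup f (single u 1 + n)"
proof -
  have "inj (\<lambda>n. single u (1::nat) + n)" by (rule injI) simp
  then show ?thesis by (simp add: div_indet_def map_key.rep_eq)
qed

definition mod_indet :: "'v \<Rightarrow> ('v, 'k::comm_ring_1) mpoly \<Rightarrow> ('v, 'k) mpoly" where
  "mod_indet u f = f - indet u * div_indet u f"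

lemma lookup_mod_indet: "lookup (mod_indet u f) n = (if u \<in> keys n then 0 else lookup f n)"
proof -
  have "single u 1 + (n - single u 1) = n" if "u \<in> keys n"
    using that by (auto simp: poly_mapping_eq_iff fun_eq_iff lookup_add lookup_minus lookup_single when_def in_keys_iff)
  then show ?thesis
    by (simp add: mod_indet_def lookup_minus lookup_indet_mult lookup_div_indet del: One_nat_def)
qed

lemma mod_indet_sum: "mod_indet u (\<Sum>i\<in>A. f i) = (\<Sum>i\<in>A. mod_indet u (f i))"
  by (rule poly_mapping_eqI) (simp add: lookup_mod_indet lookup_sum)

lemma mod_indet_mult:
  fixes g :: "('v, 'k::comm_ring_1) mpoly"
  shows "mod_indet u (indet v * g) = (if v = u then 0 else indet v * mod_indet u g)"
proof (rule poly_mapping_eqI)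
  fix n :: "'v \<Rightarrow>\<^sub>0 nat"
  have "u \<in> keys (n - single v 1) \<longleftrightarrow> u \<in> keys n" if "v \<noteq> u"
    using that by (simp add: in_keys_iff lookup_minus lookup_single when_def)
  then show "lookup (mod_indet u (indet v * g)) n = lookup (if v = u then 0 else indet v * mod_indet u g) n"
    by (simp add: lookup_mod_indet lookup_indet_mult)
qed

lemma indet_mult_eq_0_iff: "indet u * g = 0 \<longleftrightarrow> (g :: ('v, 'k::comm_ring_1) mpoly) = 0"
proof
  assume "indet u * g = 0"
  then have "lookup (indet u * g) (single u 1 + n) = 0" for n by simp
  then show "g = 0" unfolding lookup_indet_mult_add by (intro poly_mapping_eqI) simp
qed simp

lemma div_indet_hom: "f \<in> shift d (hom_polys V) j \<Longrightarrow> div_indet u f \<in> shift (Suc d) (hom_polys V) j"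
proof -
  assume f: "f \<in> shift d (hom_polys V) j"
  have *: "keys n \<subseteq> V \<and> Suc (total_deg n + d) = j" if "n \<in> keys (div_indet u f)" for n
  proof -
    have n: "single u 1 + n \<in> keys f" using that by (simp add: in_keys_iff lookup_div_indet)
    then have dj: "d \<le> j" and f': "f \<in> hom_polys V (j - d)" using f by (auto simp: shift_def split: if_splits)
    have "keys (single u 1 + n) \<subseteq> V" "total_deg (single u 1 + n) = j - d"
      using f' n unfolding hom_polys_def polys_in_def by blast+
    then show ?thesis using dj by (auto simp: keys_add_nat total_deg_add)
  qed
  show ?thesis
  proof (cases "Suc d \<le> j")
    case True
    then show ?thesis using * by (fastforce simp: shift_def hom_polys_def polys_in_def)
  next
    case False
    then have "keys (div_indet u f) = {}" using * by fastforce
    then have "div_indet u f = 0" by (simp add: poly_mapping_eq_iff fun_eq_iff in_keys_iff set_eq_iff)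
    then show ?thesis using False by (simp add: shift_def)
  qed
qed

text \<open>Induction on the variables that occur in the relation, inside a fixed ring: setting
  \<open>u\<close> to zero leaves a relation among the others, and the quotients by \<open>u\<close>
  supply the missing entries. The shift \<open>d\<close> is carried along for later use with
  generators of different degrees.\<close>

lemma koszul_exact_polys:
  fixes w :: "'v \<Rightarrow> ('v, 'k::field) mpoly"
  assumes "finite V" "finite V'" "V' \<subseteq> V" "\<And>v. v \<in> V' \<Longrightarrow> w v \<in> shift d (hom_polys V) j"
    "(\<Sum>v\<in>V'. indet v * w v) = 0"
  shows "\<exists>c. alternating V' c \<and> (\<forall>v\<in>V'. \<forall>w\<in>V'. c v w \<in> shift (Suc d) (hom_polys V) j) \<and>
    (\<forall>v\<in>V'. w v = (\<Sum>u\<in>V'. indet u * c v u))"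
  using assms(2-)
proof (induction V' arbitrary: w rule: finite_induct)
  case empty
  then show ?case by (auto simp: alternating_def)
next
  case (insert u V')
  interpret M: graded_module "(*) :: ('v, 'k) mpoly \<Rightarrow> _" V "shift d (hom_polys V)"
    by (intro graded_module.graded_module_shift graded_module_hom_polys assms(1))
  interpret M': graded_module "(*) :: ('v, 'k) mpoly \<Rightarrow> _" V "shift (Suc d) (hom_polys V)"
    by (intro graded_module.graded_module_shift graded_module_hom_polys assms(1))
  have "u \<in> V" using insert.prems by blast
  have wd: "div_indet u (w v) \<in> shift (Suc d) (hom_polys V) j" if "v \<in> insert u V'" for v
    using insert.prems(2) that by (intro div_indet_hom)
  have split: "w v = mod_indet u (w v) + indet u * div_indet u (w v)" for v
    by (simp add: mod_indet_def)
  have "prev (shift d (hom_polys V)) = shift (Suc d) (hom_polys V :: nat \<Rightarrow> ('v, 'k) mpoly set)"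
    by (simp add: shift_shift)
  then have "mod_indet u (w v) \<in> shift d (hom_polys V) j" if "v \<in> V'" for v
    unfolding mod_indet_def using insert.prems(2) that wd[of v] \<open>u \<in> V\<close>
    by (intro M.N_diff M.indet_prev) auto
  moreover have s0: "(\<Sum>v\<in>V'. indet v * mod_indet u (w v)) = 0"
  proof -
    \<comment> \<open>Reduction modulo \<open>u\<close> kills the summand of \<open>u\<close> itself
      and commutes with multiplication by the other variables.\<close>
    have "0 = mod_indet u (\<Sum>v\<in>insert u V'. indet v * w v)"
      unfolding insert.prems(3) by (rule poly_mapping_eqI) (simp add: lookup_mod_indet)
    also have "\<dots> = (\<Sum>v\<in>V'. indet v * mod_indet u (w v))"
      unfolding mod_indet_sum mod_indet_mult using insert.hyps by (auto intro!: sum.cong)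
    finally show ?thesis by simp
  qed
  ultimately obtain h where h: "alternating V' h" "\<forall>v\<in>V'. \<forall>w\<in>V'. h v w \<in> shift (Suc d) (hom_polys V) j"
    "\<forall>v\<in>V'. mod_indet u (w v) = (\<Sum>u\<in>V'. indet u * h v u)"
    using insert.IH[of "\<lambda>v. mod_indet u (w v)"] insert.prems(1) by auto
  \<comment> \<open>The new row and column consist of the quotients by \<open>u\<close>; the
    remaining block comes from the induction hypothesis.\<close>
  define c where "c a b = (if a = u then if b = u then 0 else - div_indet u (w b)
    else if b = u then div_indet u (w a) else h a b)" for a b
  have "alternating (insert u V') c"
    unfolding alternating_def
  proof (intro conjI ballI)
    fix v v' assume v: "v \<in> insert u V'" "v' \<in> insert u V'"
    have "h v' v = - h v v'" if "v \<in> V'" "v' \<in> V'" using h(1) that unfolding alternating_def by blast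
    then show "c v' v = - c v v'" using v by (auto simp: c_def)
  qed (use h(1) in \<open>auto simp: alternating_def c_def\<close>)
  moreover have "c v v' \<in> shift (Suc d) (hom_polys V) j" if "v \<in> insert u V'" "v' \<in> insert u V'" for v v'
    using that h(2) by (auto simp: c_def M'.N_zero wd intro!: M'.N_uminus)
  moreover have "w v = (\<Sum>u\<in>insert u V'. indet u * c v u)" if "v \<in> insert u V'" for v
  proof (cases "v = u")
    case False
    have "(\<Sum>u\<in>insert u V'. indet u * c v u) = indet u * div_indet u (w v) + (\<Sum>u\<in>V'. indet u * h v u)"
      using insert.hyps False by (auto simp: c_def intro!: sum.cong)
    then show ?thesis using split[of v] h(3) that False by (simp add: add.commute)
  next
    case True
    \<comment> \<open>The formula for \<open>w u\<close> is checked after multiplication by the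
      variable \<open>u\<close>, which is not a zero divisor.\<close>
    have "indet u * (w u + (\<Sum>v\<in>V'. indet v * div_indet u (w v)))
        = indet u * w u + (\<Sum>v\<in>V'. indet v * (indet u * div_indet u (w v)))"
      by (simp only: distrib_left sum_distrib_left mult_ac)
    also have "\<dots> = indet u * w u + (\<Sum>v\<in>V'. indet v * w v) - (\<Sum>v\<in>V'. indet v * mod_indet u (w v))"
      by (simp add: mod_indet_def right_diff_distrib sum_subtractf)
    also have "\<dots> = 0" using s0 insert.prems(3) insert.hyps by simp
    finally have "w u = - (\<Sum>v\<in>V'. indet v * div_indet u (w v))"
      unfolding indet_mult_eq_0_iff by (simp add: eq_neg_iff_add_eq_0)
    also have "\<dots> = (\<Sum>v\<in>insert u V'. indet v * c u v)"
      using insert.hyps by (auto simp: c_def sum_negf[symmetric] intro!: sum.cong)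
    finally show ?thesis using True by simp
  qed
  ultimately show ?case by blast
qed

section \<open>Graded free modules and minimal covers\<close>

lemma lookup_scale: "lookup (scale s x) l = s * lookup x l"
  by (auto simp: scale_def Poly_Mapping.map.rep_eq when_def)

lemma module_scale: "Modules.module (scale :: ('v, 'k::comm_ring_1) mpoly \<Rightarrow> _)"
  by unfold_locales (auto simp: poly_mapping_eq_iff fun_eq_iff lookup_scale lookup_add algebra_simps)

lemma free_module_add: "x \<in> free_module V B \<Longrightarrow> y \<in> free_module V B \<Longrightarrow> x + y \<in> free_module V B"
  using Poly_Mapping.keys_add[of x y] by (auto simp: free_module_def lookup_add polys_in_add)

lemma free_module_zero: "0 \<in> free_module V B"
  by (simp add: free_module_def)

lemma free_module_scale: "s \<in> polys_in V \<Longrightarrow> x \<in> free_module V B \<Longrightarrow> scale s x \<in> free_module V B"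
  by (auto simp: free_module_def lookup_scale in_keys_iff intro!: polys_in_mult) (metis in_keys_iff mult_zero_right subsetD)

lemma free_module_uminus: "x \<in> free_module V B \<Longrightarrow> - x \<in> free_module V B"
  by (simp add: free_module_def polys_in_uminus)

lemma free_module_sum: "(\<And>i. i \<in> A \<Longrightarrow> f i \<in> free_module V B) \<Longrightarrow> sum f A \<in> free_module V B"
  by (induction A rule: infinite_finite_induct) (auto intro: free_module_add free_module_zero)

text \<open>An entry at a generator of degree above \<open>j\<close> can have no monomial at all,
  which is exactly the default value of \<open>shift\<close>.\<close>

lemma free_component_iff:
  "x \<in> free_component V B \<delta> j \<longleftrightarrow> keys x \<subseteq> B \<and> (\<forall>l. lookup x l \<in> shift (\<delta> l) (hom_polys V) j)"
proof -
  have "lookup x l \<in> polys_in V \<and> (\<forall>m\<in>keys (lookup x l). total_deg m + \<delta> l = j)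
      \<longleftrightarrow> lookup x l \<in> shift (\<delta> l) (hom_polys V) j" for l
  proof (cases "\<delta> l \<le> j")
    case True
    then show ?thesis by (auto simp: shift_def hom_polys_def)
  next
    case False
    then have "(\<forall>m\<in>keys (lookup x l). total_deg m + \<delta> l = j) \<longleftrightarrow> keys (lookup x l) = {}" by auto
    also have "\<dots> \<longleftrightarrow> lookup x l = 0"
      by (auto simp: poly_mapping_eq_iff fun_eq_iff in_keys_iff set_eq_iff)
    finally show ?thesis using False by (auto simp: shift_def)
  qed
  then show ?thesis by (auto simp: free_component_def free_module_def)
qed

lemma free_component_free_module: "x \<in> free_component V B \<delta> j \<Longrightarrow> x \<in> free_module V B"
  by (simp add: free_component_def)

text \<open>Twisting the grading amounts to raising the degree of every generator, so a twisted free
  module is again of the same form.\<close>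

lemma prev_free_component: "prev (free_component V B \<delta>) = free_component V B (\<lambda>l. Suc (\<delta> l))"
proof (rule ext)
  fix j
  show "prev (free_component V B \<delta>) j = free_component V B (\<lambda>l. Suc (\<delta> l)) j"
  proof (cases j)
    case 0
    have "x = 0" if "x \<in> free_component V B (\<lambda>l. Suc (\<delta> l)) 0" for x
    proof (rule poly_mapping_eqI)
      show "lookup x l = lookup 0 l" for l using that by (simp add: free_component_iff shift_def)
    qed
    moreover have "0 \<in> free_component V B (\<lambda>l. Suc (\<delta> l)) 0" by (simp add: free_component_iff shift_def)
    ultimately show ?thesis unfolding 0 by (auto simp: shift_def)
  qed (auto simp: free_component_def)
qed

lemma single_in_free_component:
  "l \<in> B \<Longrightarrow> f \<in> shift (\<delta> l) (hom_polys V) j \<Longrightarrow> single l f \<in> free_component V B \<delta> j"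
  by (auto simp: free_component_iff lookup_single when_def shift_def)

lemma graded_module_free:
  assumes "finite V"
  shows "graded_module (scale :: ('v, 'k::field) mpoly \<Rightarrow> _) V (free_component V B \<delta>)"
proof (intro graded_module.intro module_scale graded_module_axioms.intro)
  fix j v c and x y :: "nat \<Rightarrow>\<^sub>0 ('v, 'k) mpoly"
  show "finite V" by (rule assms)
  have S: "graded_module ((*) :: ('v, 'k) mpoly \<Rightarrow> _) V (shift d (hom_polys V))" for d
    by (intro graded_module.graded_module_shift graded_module_hom_polys assms)
  note Sl = graded_module.N_zero[OF S] graded_module.N_add[OF S] graded_module.N_const[OF S]
    graded_module.N_indet[OF S]
  have ks: "keys (scale s x) \<subseteq> keys x" for s by (auto simp: in_keys_iff lookup_scale)
  show "0 \<in> free_component V B \<delta> j" by (simp add: free_component_iff shift_def)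
  show "x + y \<in> free_component V B \<delta> j" if "x \<in> free_component V B \<delta> j" "y \<in> free_component V B \<delta> j"
    using that Poly_Mapping.keys_add[of x y] by (auto simp: free_component_iff lookup_add intro!: Sl)
  show "scale (const c) x \<in> free_component V B \<delta> j" if "x \<in> free_component V B \<delta> j"
    using that ks[of "const c"] by (auto simp: free_component_iff lookup_scale intro!: Sl)
  show "scale (indet v) x \<in> free_component V B \<delta> (Suc j)" if "x \<in> free_component V B \<delta> j" "v \<in> V"
    using that ks[of "indet v"] by (auto simp: free_component_iff lookup_scale intro!: Sl)
qed

lemma hom_polys_shift_split:
  fixes f :: "('v, 'k::comm_ring_1) mpoly"
  assumes "finite V" "f \<in> shift d (hom_polys V) j" "lookup f 0 = 0"
  shows "\<exists>w. (\<forall>v\<in>V. w v \<in> shift (Suc d) (hom_polys V) j) \<and> f = (\<Sum>v\<in>V. indet v * w v)"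
proof (cases "d \<le> j")
  case True
  then have f: "f \<in> hom_polys V (j - d)" using assms(2) by (simp add: shift_def)
  have "prev (hom_polys V) (j - d) = shift (Suc d) (hom_polys V :: nat \<Rightarrow> ('v, 'k) mpoly set) j"
    using True by (auto simp: shift_def)
  then show ?thesis using hom_polys_split[OF assms(1) f assms(3)] by simp
next
  case False
  then show ?thesis using assms(2) by (intro exI[of _ "\<lambda>_. 0"]) (simp add: shift_def)
qed

lemma free_component_split:
  fixes x :: "nat \<Rightarrow>\<^sub>0 ('v, 'k::field) mpoly"
  assumes "finite V" and x: "x \<in> free_component V B \<delta> j" and "\<And>l. lookup (lookup x l) 0 = 0"
  shows "\<exists>w. (\<forall>v\<in>V. w v \<in> prev (free_component V B \<delta>) j) \<and> x = (\<Sum>v\<in>V. scale (indet v) (w v))"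
proof -
  interpret P: graded_module scale V "prev (free_component V B \<delta>) :: nat \<Rightarrow> (nat \<Rightarrow>\<^sub>0 ('v, 'k) mpoly) set"
    by (intro graded_module.graded_module_shift graded_module_free assms)
  have "\<forall>l. \<exists>w. (\<forall>v\<in>V. w v \<in> shift (Suc (\<delta> l)) (hom_polys V) j) \<and> lookup x l = (\<Sum>v\<in>V. indet v * w v)"
    using x assms(3) by (intro allI hom_polys_shift_split assms(1)) (auto simp: free_component_iff)
  then obtain w where w: "\<And>l v. v \<in> V \<Longrightarrow> w l v \<in> shift (Suc (\<delta> l)) (hom_polys V) j"
    "\<And>l. lookup x l = (\<Sum>v\<in>V. indet v * w l v)" by metis
  have "(\<Sum>l\<in>keys x. single l (w l v)) \<in> prev (free_component V B \<delta>) j" if "v \<in> V" for v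
  proof (rule P.N_sum)
    fix l assume "l \<in> keys x"
    then have "l \<in> B" using x by (auto simp: free_component_iff)
    then show "single l (w l v) \<in> prev (free_component V B \<delta>) j"
      unfolding prev_free_component using w(1)[OF that] by (rule single_in_free_component)
  qed
  moreover have "x = (\<Sum>v\<in>V. scale (indet v) (\<Sum>l\<in>keys x. single l (w l v)))"
  proof (rule poly_mapping_eqI)
    fix k
    have "lookup x k = (\<Sum>v\<in>V. indet v * w k v)" by (rule w(2))
    moreover have "lookup (\<Sum>v\<in>V. scale (indet v) (\<Sum>l\<in>keys x. single l (w l v))) k
        = (\<Sum>v\<in>V. indet v * (if k \<in> keys x then w k v else 0))"
      by (subst lookup_sum) (simp add: lookup_scale lookup_sum_single)
    ultimately show "lookup x k = lookup (\<Sum>v\<in>V. scale (indet v) (\<Sum>l\<in>keys x. single l (w l v))) k"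
      by (cases "k \<in> keys x") (simp_all add: Poly_Mapping.not_in_keys_iff_lookup_eq_zero)
  qed
  ultimately show ?thesis by (intro exI[of _ "\<lambda>v. \<Sum>l\<in>keys x. single l (w l v)"] conjI ballI)
qed

text \<open>The Koszul complex of a free module is a direct sum of twisted copies of that of the
  ring, so a cycle is filled one coordinate at a time. The finite set \<open>L\<close> of occurring
  coordinates keeps the filling finitely supported.\<close>

lemma koszul_exact_free:
  fixes w :: "'v \<Rightarrow> nat \<Rightarrow>\<^sub>0 ('v, 'k::field) mpoly"
  assumes "finite V" and w: "\<And>v. v \<in> V \<Longrightarrow> w v \<in> free_component V B \<delta> j"
    and s: "(\<Sum>v\<in>V. scale (indet v) (w v)) = 0"
  shows "\<exists>c. alternating V c \<and> (\<forall>v\<in>V. \<forall>u\<in>V. c v u \<in> prev (free_component V B \<delta>) j) \<and>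
    (\<forall>v\<in>V. w v = (\<Sum>u\<in>V. scale (indet u) (c v u)))"
proof -
  interpret P: graded_module scale V "prev (free_component V B \<delta>) :: nat \<Rightarrow> (nat \<Rightarrow>\<^sub>0 ('v, 'k) mpoly) set"
    by (intro graded_module.graded_module_shift graded_module_free assms)
  define L where "L = (\<Union>v\<in>V. keys (w v))"
  have L: "finite L" "L \<subseteq> B" using w assms(1) by (auto simp: L_def free_component_iff)
  have "\<forall>l. \<exists>c. alternating V c \<and> (\<forall>v\<in>V. \<forall>u\<in>V. c v u \<in> shift (Suc (\<delta> l)) (hom_polys V) j) \<and>
    (\<forall>v\<in>V. lookup (w v) l = (\<Sum>u\<in>V. indet u * c v u))"
  proof
    fix l
    have "(\<Sum>v\<in>V. indet v * lookup (w v) l) = lookup (\<Sum>v\<in>V. scale (indet v) (w v)) l"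
      by (subst lookup_sum) (simp add: lookup_scale)
    also have "\<dots> = 0" by (simp add: s)
    finally show "\<exists>c. alternating V c \<and> (\<forall>v\<in>V. \<forall>u\<in>V. c v u \<in> shift (Suc (\<delta> l)) (hom_polys V) j) \<and>
      (\<forall>v\<in>V. lookup (w v) l = (\<Sum>u\<in>V. indet u * c v u))"
      using w unfolding free_component_iff by (intro koszul_exact_polys[OF assms(1,1)]) blast+
  qed
  from choice[OF this] obtain c where c': "\<And>l. alternating V (c l) \<and>
      (\<forall>v\<in>V. \<forall>u\<in>V. c l v u \<in> shift (Suc (\<delta> l)) (hom_polys V) j) \<and>
      (\<forall>v\<in>V. lookup (w v) l = (\<Sum>u\<in>V. indet u * c l v u))" by blast
  have c: "alternating V (c l)"
    "v \<in> V \<Longrightarrow> u \<in> V \<Longrightarrow> c l v u \<in> shift (Suc (\<delta> l)) (hom_polys V) j"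
    "v \<in> V \<Longrightarrow> lookup (w v) l = (\<Sum>u\<in>V. indet u * c l v u)" for l v u
    using c'[of l] by blast+
  define C where "C v u = (\<Sum>l\<in>L. single l (c l v u))" for v u
  have "alternating V C"
    unfolding alternating_def
  proof (intro conjI ballI)
    fix v assume "v \<in> V"
    then have "c l v v = 0" for l using alternating_diag[OF c(1)] by blast
    then show "C v v = 0" unfolding C_def by simp
  next
    fix v u assume vu: "v \<in> V" "u \<in> V"
    have "c l u v = - c l v u" for l by (rule alternating_swap[OF c(1) vu])
    then have "C u v = (\<Sum>l\<in>L. single l (- c l v u))" unfolding C_def by simp
    then show "C u v = - C v u" unfolding C_def by (simp add: single_uminus sum_negf)
  qed
  moreover have "C v u \<in> prev (free_component V B \<delta>) j" if "v \<in> V" "u \<in> V" for v u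
    unfolding C_def
  proof (rule P.N_sum)
    fix l assume "l \<in> L"
    then have "l \<in> B" using L by auto
    then show "single l (c l v u) \<in> prev (free_component V B \<delta>) j"
      unfolding prev_free_component using c(2)[OF that] by (rule single_in_free_component)
  qed
  moreover have "w v = (\<Sum>u\<in>V. scale (indet u) (C v u))" if "v \<in> V" for v
  proof (rule poly_mapping_eqI)
    fix k
    have "lookup (\<Sum>u\<in>V. scale (indet u) (C v u)) k = (\<Sum>u\<in>V. indet u * (if k \<in> L then c k v u else 0))"
      unfolding C_def by (subst lookup_sum) (simp add: lookup_scale lookup_sum_single L)
    also have "\<dots> = (if k \<in> L then lookup (w v) k else 0)" using c(3)[OF that, of k] by simp
    also have "\<dots> = lookup (w v) k" using that by (auto simp: L_def in_keys_iff)
    finally show "lookup (w v) k = lookup (\<Sum>u\<in>V. scale (indet u) (C v u)) k" ..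
  qed
  ultimately show ?thesis by blast
qed

section \<open>Minimal covers and the connecting map\<close>

definition unit_vector :: "nat \<Rightarrow> nat \<Rightarrow>\<^sub>0 ('v, 'k::comm_ring_1) mpoly" where
  "unit_vector l = single l 1"

lemma lookup_unit_vector: "lookup (unit_vector l) k = (if k = l then 1 else 0)"
  by (simp add: unit_vector_def lookup_single when_def)

lemma unit_vector_in_free_component: "l \<in> B \<Longrightarrow> unit_vector l \<in> free_component V B \<delta> (\<delta> l)"
  unfolding unit_vector_def
  by (intro single_in_free_component) (simp_all add: shift_def hom_polys_const flip: const_1)

text \<open>In degree \<open>j\<close> a constant coefficient can occur only at a generator of
  degree exactly \<open>j\<close>; removing these constants leaves an element of \<mm>F.\<close>

lemma free_component_const_split:
  fixes x :: "nat \<Rightarrow>\<^sub>0 ('v, 'k::field) mpoly"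
  assumes "finite V" and x: "x \<in> free_component V B \<delta> j"
  defines "A0 \<equiv> {l \<in> keys x. \<delta> l = j}"
  shows "\<exists>w. (\<forall>v\<in>V. w v \<in> prev (free_component V B \<delta>) j) \<and>
    x = (\<Sum>l\<in>A0. scale (const (lookup (lookup x l) 0)) (unit_vector l)) + (\<Sum>v\<in>V. scale (indet v) (w v))"
proof -
  interpret F: graded_module scale V "free_component V B \<delta> :: nat \<Rightarrow> (nat \<Rightarrow>\<^sub>0 ('v, 'k) mpoly) set"
    by (intro graded_module_free assms)
  define y :: "nat \<Rightarrow>\<^sub>0 ('v, 'k) mpoly" where "y = (\<Sum>l\<in>A0. scale (const (lookup (lookup x l) 0)) (unit_vector l))"
  have lk: "lookup y k = (if k \<in> A0 then const (lookup (lookup x k) 0) else 0)" for k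
  proof -
    have "lookup y k = (\<Sum>l\<in>A0. if k = l then const (lookup (lookup x l) 0) else 0)"
      unfolding y_def by (subst lookup_sum) (auto simp: lookup_scale lookup_unit_vector intro!: sum.cong)
    then show ?thesis by (simp add: A0_def)
  qed
  have "y \<in> free_component V B \<delta> j"
    unfolding y_def
  proof (rule F.N_sum)
    fix l assume "l \<in> A0"
    then have "l \<in> B" "\<delta> l = j" using x by (auto simp: A0_def free_component_iff)
    then show "scale (const (lookup (lookup x l) 0)) (unit_vector l) \<in> free_component V B \<delta> j"
      using unit_vector_in_free_component[of l B V \<delta>] by (intro F.N_const) auto
  qed
  then have "x - y \<in> free_component V B \<delta> j" using x by (intro F.N_diff)
  moreover have "lookup (lookup (x - y) l) 0 = 0" for l
  proof (cases "l \<in> A0")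
    case True
    then show ?thesis by (simp add: lookup_minus lk const_def)
  next
    case False
    have "0 \<notin> keys (lookup x l)" if "l \<in> keys x"
    proof
      assume "0 \<in> keys (lookup x l)"
      then have "total_deg (0 :: 'v \<Rightarrow>\<^sub>0 nat) + \<delta> l = j" using x unfolding free_component_def by blast
      then show False using that False by (simp add: A0_def)
    qed
    moreover have "lookup x l = 0" if "l \<notin> keys x" using that by (simp add: in_keys_iff)
    ultimately have "lookup (lookup x l) 0 = 0" by (cases "l \<in> keys x") (auto simp: in_keys_iff)
    then show ?thesis using False by (simp add: lookup_minus lk)
  qed
  ultimately obtain w where "\<forall>v\<in>V. w v \<in> prev (free_component V B \<delta>) j" "x - y = (\<Sum>v\<in>V. scale (indet v) (w v))"
    using free_component_split[OF assms(1)] by blast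
  then show ?thesis unfolding y_def[symmetric] by (intro exI[of _ w]) (simp add: algebra_simps)
qed

text \<open>A single step of a minimal resolution, detached from the rest: a degreewise surjection
  from a free module whose kernel lies in \<mm>F (\<open>D_ker\<close>). Given resolutions are cut
  into such steps, and new ones are assembled from them.\<close>

locale minimal_cover = graded_module act V N
  for act :: "('v, 'k::field) mpoly \<Rightarrow> 'm::ab_group_add \<Rightarrow> 'm" and V :: "'v set" and N +
  fixes B :: "nat set" and \<delta> :: "nat \<Rightarrow> nat" and D :: "(nat \<Rightarrow>\<^sub>0 ('v, 'k) mpoly) \<Rightarrow> 'm"
  assumes D_add: "x \<in> free_module V B \<Longrightarrow> y \<in> free_module V B \<Longrightarrow> D (x + y) = D x + D y"
    and D_scale: "s \<in> polys_in V \<Longrightarrow> x \<in> free_module V B \<Longrightarrow> D (scale s x) = act s (D x)"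
    and D_onto: "D ` free_component V B \<delta> j = N j"
    and D_ker: "x \<in> free_component V B \<delta> j \<Longrightarrow> D x = 0 \<Longrightarrow> lookup (lookup x l) 0 = 0"
begin

abbreviation "FC \<equiv> free_component V B \<delta>"

sublocale F: graded_module "scale :: ('v, 'k) mpoly \<Rightarrow> _" V FC
  by (rule graded_module_free[OF finite_V])

sublocale pN: graded_module act V "prev N"
  by (rule graded_module_shift)

sublocale pF: graded_module "scale :: ('v, 'k) mpoly \<Rightarrow> _" V "prev FC"
  by (rule F.graded_module_shift)

lemma unit_vector_free: "l \<in> B \<Longrightarrow> unit_vector l \<in> free_module V B"
  by (rule free_component_free_module[OF unit_vector_in_free_component])

lemma FC_free: "x \<in> FC j \<Longrightarrow> x \<in> free_module V B"
  by (rule free_component_free_module)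

lemma prev_FC_free: "x \<in> prev FC j \<Longrightarrow> x \<in> free_module V B"
  unfolding prev_free_component by (rule free_component_free_module)

lemma D_zero: "D 0 = 0"
  using D_add[of 0 0] by (simp add: free_module_zero)

lemma D_sum: "(\<And>i. i \<in> A \<Longrightarrow> f i \<in> free_module V B) \<Longrightarrow> D (sum f A) = (\<Sum>i\<in>A. D (f i))"
  by (induction A rule: infinite_finite_induct) (auto simp: D_zero D_add free_module_sum)

lemma D_uminus: "x \<in> free_module V B \<Longrightarrow> D (- x) = - D x"
  using D_add[of x "- x"] free_module_uminus[of x V B] D_zero by (simp add: eq_neg_iff_add_eq_0 add.commute)

lemma D_diff: "x \<in> free_module V B \<Longrightarrow> y \<in> free_module V B \<Longrightarrow> D (x - y) = D x - D y"
  using D_add[of x "- y"] by (simp add: free_module_uminus D_uminus)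

lemma D_prev_onto: "D ` prev FC j = prev N j"
  by (cases j) (simp_all add: shift_def D_zero D_onto)

lemma D_const: "x \<in> free_module V B \<Longrightarrow> D (scale (const c) x) = act (const c) (D x)"
  by (simp add: D_scale)

lemma D_indet_sum:
  assumes "\<And>v. v \<in> V \<Longrightarrow> w v \<in> free_module V B"
  shows "D (\<Sum>v\<in>V. scale (indet v) (w v)) = (\<Sum>v\<in>V. act (indet v) (D (w v)))"
  using assms by (subst D_sum) (auto intro!: free_module_scale sum.cong D_scale)

lemma D_unit_sum:
  assumes "A0 \<subseteq> B"
  shows "D (\<Sum>l\<in>A0. scale (const (c l)) (unit_vector l)) = (\<Sum>l\<in>A0. act (const (c l)) (D (unit_vector l)))"
  using assms by (subst D_sum) (auto intro!: free_module_scale unit_vector_free sum.cong D_const)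

text \<open>Graded Nakayama: as the kernel lies in \<mm>F, the cover induces an isomorphism of
  F/\<mm>F onto N/\<mm>N, and the unit vectors form a basis of the former.\<close>

lemma unit_vectors_basis:
  "basis_mod (\<lambda>c. act (const c)) (irr_part V act N j) (N j) {l\<in>B. \<delta> l = j} (\<lambda>l. D (unit_vector l))"
  unfolding basis_mod_def
proof (intro conjI)
  show "(\<lambda>l. D (unit_vector l)) ` {l\<in>B. \<delta> l = j} \<subseteq> N j"
    using D_onto unit_vector_in_free_component by fastforce
next
  show "spans_mod (\<lambda>c. act (const c)) (irr_part V act N j) (N j) {l\<in>B. \<delta> l = j} (\<lambda>l. D (unit_vector l))"
    unfolding spans_mod_def
  proof
    fix n assume "n \<in> N j"
    then obtain x where x: "x \<in> FC j" "n = D x" using D_onto by blast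
    define A0 where "A0 = {l \<in> keys x. \<delta> l = j}"
    define c where "c l = lookup (lookup x l) 0" for l
    obtain w where w: "\<forall>v\<in>V. w v \<in> prev FC j"
      "x = (\<Sum>l\<in>A0. scale (const (c l)) (unit_vector l)) + (\<Sum>v\<in>V. scale (indet v) (w v))"
      using free_component_const_split[OF finite_V x(1)] unfolding A0_def c_def by blast
    have A0: "A0 \<subseteq> B" using x(1) by (auto simp: A0_def free_component_iff)
    have wF: "w v \<in> free_module V B" if "v \<in> V" for v using w(1) that prev_FC_free by blast
    have "(\<Sum>l\<in>A0. scale (const (c l)) (unit_vector l)) \<in> free_module V B"
      using A0 by (intro free_module_sum free_module_scale unit_vector_free) auto
    moreover have "(\<Sum>v\<in>V. scale (indet v) (w v)) \<in> free_module V B"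
      using wF by (intro free_module_sum free_module_scale) auto
    ultimately have "n = (\<Sum>l\<in>A0. act (const (c l)) (D (unit_vector l))) + (\<Sum>v\<in>V. act (indet v) (D (w v)))"
      unfolding x(2) by (subst w(2)) (simp add: D_add D_unit_sum[OF A0] D_indet_sum[OF wF])
    then have eq: "n - (\<Sum>l\<in>A0. act (const (c l)) (D (unit_vector l))) = (\<Sum>v\<in>V. act (indet v) (D (w v)))"
      by simp
    have "\<dots> \<in> irr_part V act N j"
      unfolding irr_part_def using w(1) D_prev_onto by (intro CollectI exI[of _ "\<lambda>v. D (w v)"]) blast
    then show "\<exists>c A0. finite A0 \<and> A0 \<subseteq> {l\<in>B. \<delta> l = j} \<and>
        n - (\<Sum>l\<in>A0. act (const (c l)) (D (unit_vector l))) \<in> irr_part V act N j"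
      using A0 eq by (intro exI[of _ c] exI[of _ A0]) (auto simp: A0_def)
  qed
next
  show "indep_mod (\<lambda>c. act (const c)) (irr_part V act N j) {l\<in>B. \<delta> l = j} (\<lambda>l. D (unit_vector l))"
    unfolding indep_mod_def
  proof (intro allI impI)
    fix c A0
    assume A0: "finite A0" "A0 \<subseteq> {l\<in>B. \<delta> l = j}"
      and s: "(\<Sum>l\<in>A0. act (const (c l)) (D (unit_vector l))) \<in> irr_part V act N j"
    obtain n where n: "\<forall>v\<in>V. n v \<in> prev N j"
      "(\<Sum>l\<in>A0. act (const (c l)) (D (unit_vector l))) = (\<Sum>v\<in>V. act (indet v) (n v))"
      using s unfolding irr_part_def by blast
    have "\<forall>v\<in>V. \<exists>w. w \<in> prev FC j \<and> n v = D w" using n(1) D_prev_onto by blast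
    from bchoice[OF this] obtain w where w: "\<And>v. v \<in> V \<Longrightarrow> w v \<in> prev FC j" "\<And>v. v \<in> V \<Longrightarrow> n v = D (w v)"
      by blast
    have wF: "w v \<in> free_module V B" if "v \<in> V" for v using w(1) that prev_FC_free by blast
    \<comment> \<open>\<open>z\<close> lies in \<mm>F and has the same image as \<open>y\<close>. So
      \<open>y - z\<close> is in the kernel and has no constant terms, while those of
      \<open>y\<close> are the scalars \<open>c l\<close>.\<close>
    define y where "y = (\<Sum>l\<in>A0. scale (const (c l)) (unit_vector l :: nat \<Rightarrow>\<^sub>0 ('v, 'k) mpoly))"
    define z where "z = (\<Sum>v\<in>V. scale (indet v) (w v))"
    have y: "y \<in> FC j"
      unfolding y_def using A0 unit_vector_in_free_component[of _ B V \<delta>] by (intro F.N_sum F.N_const) auto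
    have z: "z \<in> FC j" unfolding z_def using w(1) by (intro F.N_sum F.indet_prev)
    have "D (y - z) = D y - D z" using y z by (intro D_diff FC_free)
    also have "\<dots> = 0"
      unfolding y_def z_def using A0 n(2) w(2) by (subst D_unit_sum) (auto simp: D_indet_sum[OF wF])
    finally have k: "lookup (lookup (y - z) l) 0 = 0" for l using D_ker F.N_diff[OF y z] by blast
    show "\<forall>l\<in>A0. c l = 0"
    proof
      fix l assume l: "l \<in> A0"
      have "lookup (lookup y l) 0 = (\<Sum>i\<in>A0. if l = i then c i else 0)"
        unfolding y_def
        by (subst lookup_sum, subst lookup_sum)
          (auto simp: lookup_scale lookup_unit_vector const_def intro!: sum.cong)
      also have "\<dots> = c l" using A0 l by simp
      finally have "lookup (lookup y l) 0 = c l" .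
      moreover have "lookup (lookup z l) 0 = 0"
        unfolding z_def
        by (subst lookup_sum, subst lookup_sum) (simp add: lookup_scale lookup_indet_mult)
      ultimately show "c l = 0" using k[of l] by (simp add: lookup_minus)
    qed
  qed
qed

definition kernel :: "nat \<Rightarrow> (nat \<Rightarrow>\<^sub>0 ('v, 'k) mpoly) set" where
  "kernel j = {x \<in> FC j. D x = 0}"

sublocale Z: graded_module "scale :: ('v, 'k) mpoly \<Rightarrow> _" V kernel
proof unfold_locales
  fix j x y c v
  show "finite V" by (rule finite_V)
  show "0 \<in> kernel j" by (simp add: kernel_def F.N_zero D_zero)
  show "x + y \<in> kernel j" if "x \<in> kernel j" "y \<in> kernel j"
    using that F.N_add[of x j y] FC_free[of x j] FC_free[of y j] by (simp add: kernel_def D_add)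
  show "scale (const c) x \<in> kernel j" if "x \<in> kernel j"
    using that by (auto simp: kernel_def F.N_const D_const dest: FC_free)
  show "scale (indet v) x \<in> kernel (Suc j)" if "x \<in> kernel j" "v \<in> V"
    using that by (auto simp: kernel_def F.N_indet D_scale dest: FC_free)
qed

text \<open>
  The connecting map of the Koszul homology sequence: for \<open>z = \<Sum>\<^sub>v x\<^sub>v w\<^sub>v\<close> in the kernel of the cover,
  the images of the \<open>w\<^sub>v\<close> form a cycle with coefficients in the covered module.
\<close>

definition connecting :: "nat \<Rightarrow> (nat \<Rightarrow>\<^sub>0 ('v, 'k) mpoly) \<Rightarrow> ('v \<Rightarrow> 'm) \<Rightarrow> bool" where
  "connecting j z a \<longleftrightarrow> z \<in> kernel (Suc j) \<and>
     (\<exists>w. (\<forall>v\<in>V. w v \<in> FC j \<and> a v = D (w v)) \<and> z = (\<Sum>v\<in>V. scale (indet v) (w v)))"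

lemma connecting_cycle: "connecting j z a \<Longrightarrow> a \<in> koszul_cycles V act N j"
proof -
  assume "connecting j z a"
  then obtain w where w: "\<And>v. v \<in> V \<Longrightarrow> w v \<in> FC j" "\<And>v. v \<in> V \<Longrightarrow> a v = D (w v)"
    "D (\<Sum>v\<in>V. scale (indet v) (w v)) = 0"
    unfolding connecting_def kernel_def by auto
  then show ?thesis
    using D_indet_sum[of w] FC_free[of _ j] D_onto[of j] unfolding koszul_cycles_def by force
qed

text \<open>Lifting all entries independently would destroy the sign rule. The injection
  \<open>e\<close> orders the variables; lifts are chosen on one side of the diagonal and reflected
  with a sign.\<close>

lemma alternating_lift:
  assumes c: "alternating V c" "\<forall>v\<in>V. \<forall>u\<in>V. c v u \<in> prev N j"
  obtains y where "alternating V y" "\<And>v u. v \<in> V \<Longrightarrow> u \<in> V \<Longrightarrow> y v u \<in> prev FC j"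
    "\<And>v u. v \<in> V \<Longrightarrow> u \<in> V \<Longrightarrow> c v u = D (y v u)"
proof -
  obtain e :: "'v \<Rightarrow> nat" where e: "inj_on e V"
    using finite_imp_inj_to_nat_seg[OF finite_V] by blast
  define g where "g v u = (SOME y. y \<in> prev FC j \<and> c v u = D y)" for v u
  have g: "g v u \<in> prev FC j \<and> c v u = D (g v u)" if "v \<in> V" "u \<in> V" for v u
  proof -
    have "\<exists>y. y \<in> prev FC j \<and> c v u = D y" using c(2) that D_prev_onto by blast
    then show ?thesis unfolding g_def by (rule someI_ex)
  qed
  define y where "y v u = (if e v = e u then 0 else if e v < e u then g v u else - g u v)" for v u
  show thesis
  proof (rule that[of y])
    show "alternating V y" by (simp add: alternating_def y_def)
    show "y v u \<in> prev FC j" if "v \<in> V" "u \<in> V" for v u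
      using g that by (simp add: y_def pF.N_zero pF.N_uminus)
    show "c v u = D (y v u)" if vu: "v \<in> V" "u \<in> V" for v u
    proof -
      consider "v = u" | "e v < e u" | "e u < e v" "v \<noteq> u"
        using e vu by (metis inj_onD linorder_neqE_nat)
      then show ?thesis
      proof cases
        case 1
        then show ?thesis using alternating_diag[OF c(1) vu(1)] by (simp add: y_def D_zero)
      next
        case 2
        then show ?thesis using g[OF vu] by (simp add: y_def)
      next
        case 3
        have "D (- g u v) = - D (g u v)" using g[OF vu(2,1)] prev_FC_free by (intro D_uminus) blast
        then show ?thesis using 3 g[OF vu(2,1)] alternating_swap[OF c(1) vu(2,1)] by (simp add: y_def)
      qed
    qed
  qed
qed

text \<open>If \<open>z\<close> is in \<mm> times the kernel, two decompositions of \<open>z\<close>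
  differ by a cycle over a free module, hence by a boundary, which maps to \<open>a\<close>.
  Conversely, subtracting a lifted boundary from \<open>w\<close> leaves \<open>z\<close> unchanged
  and moves the coefficients into the kernel.\<close>

lemma connecting_boundary_iff:
  assumes "connecting j z a"
  shows "z \<in> irr_part V scale kernel (Suc j) \<longleftrightarrow> a \<in> koszul_boundaries V act N j"
proof -
  obtain w where w: "\<And>v. v \<in> V \<Longrightarrow> w v \<in> FC j" "\<And>v. v \<in> V \<Longrightarrow> a v = D (w v)"
    "z = (\<Sum>v\<in>V. scale (indet v) (w v))" "z \<in> kernel (Suc j)"
    using assms unfolding connecting_def by blast
  show ?thesis
  proof
    assume "z \<in> irr_part V scale kernel (Suc j)"
    then obtain u where u: "\<And>v. v \<in> V \<Longrightarrow> u v \<in> kernel j" "z = (\<Sum>v\<in>V. scale (indet v) (u v))"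
      unfolding irr_part_def by auto
    have "(\<Sum>v\<in>V. scale (indet v) (w v - u v)) = 0"
      using u(2) w(3) by (simp add: F.scale_right_diff_distrib sum_subtractf)
    moreover have "w v - u v \<in> FC j" if "v \<in> V" for v
      using w(1)[OF that] u(1)[OF that] by (simp add: kernel_def F.N_diff)
    ultimately obtain c where c: "alternating V c" "\<forall>v\<in>V. \<forall>u\<in>V. c v u \<in> prev FC j"
      "\<forall>v\<in>V. w v - u v = (\<Sum>u\<in>V. scale (indet u) (c v u))"
      using koszul_exact_free[OF finite_V, of "\<lambda>v. w v - u v"] by blast
    have cF: "c v u \<in> free_module V B" if "v \<in> V" "u \<in> V" for v u
      using c(2) that prev_FC_free by blast
    have "alternating V (\<lambda>v u. D (c v u))"
      unfolding alternating_def
    proof (intro conjI ballI)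
      fix v u assume vu: "v \<in> V" "u \<in> V"
      show "D (c v v) = 0" using alternating_diag[OF c(1) vu(1)] by (simp add: D_zero)
      show "D (c u v) = - D (c v u)"
        unfolding alternating_swap[OF c(1) vu] using vu by (intro D_uminus cF)
    qed
    moreover have "\<forall>v\<in>V. \<forall>u\<in>V. D (c v u) \<in> prev N j" using c(2) D_prev_onto by blast
    moreover have "a v = (\<Sum>u\<in>V. act (indet u) (D (c v u)))" if v: "v \<in> V" for v
    proof -
      have "D (w v - u v) = D (w v) - D (u v)"
        using w(1)[OF v] u(1)[OF v] by (intro D_diff FC_free) (auto simp: kernel_def)
      also have "\<dots> = a v" using u(1)[OF v] w(2)[OF v] by (simp add: kernel_def)
      finally have "a v = D (w v - u v)" ..
      also have "w v - u v = (\<Sum>u\<in>V. scale (indet u) (c v u))" using c(3) v by blast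
      finally show ?thesis using D_indet_sum[of "c v"] cF[OF v] by simp
    qed
    ultimately show "a \<in> koszul_boundaries V act N j" unfolding koszul_boundaries_def by blast
  next
    assume "a \<in> koszul_boundaries V act N j"
    then obtain c where c: "alternating V c" "\<forall>v\<in>V. \<forall>u\<in>V. c v u \<in> prev N j"
      "\<forall>v\<in>V. a v = (\<Sum>u\<in>V. act (indet u) (c v u))"
      unfolding koszul_boundaries_def by blast
    obtain y where y: "alternating V y" "\<And>v u. v \<in> V \<Longrightarrow> u \<in> V \<Longrightarrow> y v u \<in> prev FC j"
      "\<And>v u. v \<in> V \<Longrightarrow> u \<in> V \<Longrightarrow> c v u = D (y v u)"
      using alternating_lift[OF c(1,2)] by blast
    define u where "u v = w v - (\<Sum>u\<in>V. scale (indet u) (y v u))" for v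
    have yF: "(\<Sum>u\<in>V. scale (indet u) (y v u)) \<in> FC j" if "v \<in> V" for v
      using y(2)[OF that] by (intro F.N_sum F.indet_prev)
    have "u v \<in> kernel j" if v: "v \<in> V" for v
    proof -
      have "D (u v) = a v - (\<Sum>u\<in>V. act (indet u) (D (y v u)))"
        unfolding u_def using w(2)[OF v] FC_free[OF w(1)[OF v]] FC_free[OF yF[OF v]] prev_FC_free[OF y(2)[OF v]]
        by (simp add: D_diff D_indet_sum)
      also have "(\<Sum>u\<in>V. act (indet u) (D (y v u))) = (\<Sum>u\<in>V. act (indet u) (c v u))"
        using y(3)[OF v] by (intro sum.cong) auto
      also have "a v - \<dots> = 0" using c(3) v by simp
      finally show ?thesis using w(1)[OF v] yF[OF v] by (simp add: kernel_def u_def F.N_diff)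
    qed
    moreover have "z = (\<Sum>v\<in>V. scale (indet v) (u v))"
      unfolding u_def w(3) using F.alternating_sum_zero[OF finite_V y(1), of indet]
      by (simp only: F.scale_right_diff_distrib sum_subtractf diff_zero)
    ultimately show "z \<in> irr_part V scale kernel (Suc j)"
      unfolding irr_part_def by auto
  qed
qed

text \<open>The Koszul homology sequence of kernel, free module and \<open>N\<close>: the first
  homology of a free module vanishes and, by minimality, Z/\<mm>Z -> F/\<mm>F is zero. So the
  connecting map is an isomorphism; the degree drops by one because a variable is split off.\<close>

lemma koszul_cycles_basis:
  assumes bas: "basis_mod (\<lambda>c. scale (const c)) (irr_part V scale kernel (Suc j)) (kernel (Suc j)) A z"
  shows "\<exists>f. basis_mod (\<lambda>c (a :: 'v \<Rightarrow> 'm) v. act (const c) (a v))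
    (koszul_boundaries V act N j) (koszul_cycles V act N j) A f"
proof (rule basis_mod_transfer[OF bas F.vector_space Z.subspace_irr_part, where Rel = "connecting j"])
  show "connecting j 0 0"
    unfolding connecting_def
    by (intro conjI exI[of _ "\<lambda>_. 0"]) (auto simp: Z.N_zero F.N_zero D_zero)
next
  fix x y and a b :: "'v \<Rightarrow> 'm" assume "connecting j x a" "connecting j y b"
  then obtain w w' where w: "x \<in> kernel (Suc j)" "\<And>v. v \<in> V \<Longrightarrow> w v \<in> FC j \<and> a v = D (w v)"
    "x = (\<Sum>v\<in>V. scale (indet v) (w v))"
    and w': "y \<in> kernel (Suc j)" "\<And>v. v \<in> V \<Longrightarrow> w' v \<in> FC j \<and> b v = D (w' v)"
    "y = (\<Sum>v\<in>V. scale (indet v) (w' v))"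
    unfolding connecting_def by blast
  show "connecting j (x + y) (a + b)"
    unfolding connecting_def
  proof (intro conjI exI[of _ "\<lambda>v. w v + w' v"] ballI)
    show "x + y \<in> kernel (Suc j)" by (rule Z.N_add[OF w(1) w'(1)])
    show "x + y = (\<Sum>v\<in>V. scale (indet v) (w v + w' v))"
      by (simp add: w(3) w'(3) F.scale_right_distrib sum.distrib)
    show "w v + w' v \<in> FC j" if "v \<in> V" for v using w(2) w'(2) that F.N_add by blast
    show "(a + b) v = D (w v + w' v)" if "v \<in> V" for v
      using w(2)[OF that] w'(2)[OF that] D_add[OF FC_free FC_free, of "w v" j "w' v" j] by simp
  qed
next
  fix c x and a :: "'v \<Rightarrow> 'm" assume "connecting j x a"
  then obtain w where w: "x \<in> kernel (Suc j)" "\<And>v. v \<in> V \<Longrightarrow> w v \<in> FC j \<and> a v = D (w v)"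
    "x = (\<Sum>v\<in>V. scale (indet v) (w v))"
    unfolding connecting_def by blast
  show "connecting j (scale (const c) x) (\<lambda>v. act (const c) (a v))"
    unfolding connecting_def
  proof (intro conjI exI[of _ "\<lambda>v. scale (const c) (w v)"] ballI)
    show "scale (const c) x \<in> kernel (Suc j)" by (rule Z.N_const[OF w(1)])
    show "scale (const c) x = (\<Sum>v\<in>V. scale (indet v) (scale (const c) (w v)))"
      by (simp add: w(3) F.scale_sum_right mult.commute)
    show "scale (const c) (w v) \<in> FC j" if "v \<in> V" for v using w(2) that F.N_const by blast
    show "act (const c) (a v) = D (scale (const c) (w v))" if "v \<in> V" for v
      using w(2)[OF that] D_const[OF FC_free, of "w v" j c] by simp
  qed
next
  fix x and a :: "'v \<Rightarrow> 'm" assume "connecting j x a"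
  then obtain w where w: "x \<in> kernel (Suc j)" "\<And>v. v \<in> V \<Longrightarrow> w v \<in> FC j \<and> a v = D (w v)"
    "x = (\<Sum>v\<in>V. scale (indet v) (w v))"
    unfolding connecting_def by blast
  show "connecting j (- x) (- a)"
    unfolding connecting_def
  proof (intro conjI exI[of _ "\<lambda>v. - w v"] ballI)
    show "- x \<in> kernel (Suc j)" by (rule Z.N_uminus[OF w(1)])
    show "- x = (\<Sum>v\<in>V. scale (indet v) (- w v))" by (simp add: w(3) sum_negf)
    show "- w v \<in> FC j" if "v \<in> V" for v using w(2) that F.N_uminus by blast
    show "(- a) v = D (- w v)" if "v \<in> V" for v
      using w(2)[OF that] D_uminus[OF FC_free, of "w v" j] by simp
  qed
next
  fix x assume x: "x \<in> kernel (Suc j)"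
  \<comment> \<open>Minimality enters here: without constant coefficients a kernel element can be
    distributed over the variables.\<close>
  then have "x \<in> FC (Suc j)" "\<And>l. lookup (lookup x l) 0 = 0" using D_ker by (auto simp: kernel_def)
  then obtain w where "\<forall>v\<in>V. w v \<in> prev FC (Suc j)" "x = (\<Sum>v\<in>V. scale (indet v) (w v))"
    using free_component_split[OF finite_V] by blast
  then show "\<exists>a. connecting j x a"
    unfolding connecting_def using x by (intro exI[of _ "\<lambda>v. D (w v)"] conjI exI[of _ w]) auto
next
  fix a assume a: "a \<in> koszul_cycles V act N j"
  then have "\<forall>v\<in>V. \<exists>w. w \<in> FC j \<and> a v = D w" using D_onto unfolding koszul_cycles_def by blast
  from bchoice[OF this] obtain w where w: "\<And>v. v \<in> V \<Longrightarrow> w v \<in> FC j \<and> a v = D (w v)" by blast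
  have "D (\<Sum>v\<in>V. scale (indet v) (w v)) = (\<Sum>v\<in>V. act (indet v) (a v))"
    using w by (subst D_indet_sum) (auto intro: FC_free)
  then have "(\<Sum>v\<in>V. scale (indet v) (w v)) \<in> kernel (Suc j)"
    using a w by (auto simp: kernel_def koszul_cycles_def intro!: F.N_sum F.N_indet)
  then show "\<exists>x. connecting j x a" using w unfolding connecting_def by blast
next
  fix x and a :: "'v \<Rightarrow> 'm" assume "connecting j x a"
  then show "x \<in> kernel (Suc j) \<and> a \<in> koszul_cycles V act N j"
    using connecting_cycle unfolding connecting_def by blast
  show "x \<in> irr_part V scale kernel (Suc j) \<longleftrightarrow> a \<in> koszul_boundaries V act N j"
    by (rule connecting_boundary_iff) fact
qed

end

section \<open>Existence of minimal covers\<close>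

lemma basis_mod_reindex:
  assumes "inj_on h A" "basis_mod s U W A f" "\<And>l. l \<in> A \<Longrightarrow> g (h l) = f l"
  shows "basis_mod s U W (h ` A) g"
  unfolding basis_mod_def
proof (intro conjI)
  show "g ` h ` A \<subseteq> W" using assms(2,3) by (auto simp: basis_mod_def)
next
  show "indep_mod s U (h ` A) g"
    unfolding indep_mod_def
  proof (intro allI impI)
    fix c A0 assume A0: "finite A0" "A0 \<subseteq> h ` A" and sU: "(\<Sum>l\<in>A0. s (c l) (g l)) \<in> U"
    obtain A1 where A1: "A1 \<subseteq> A" "A0 = h ` A1" using A0(2) by (auto simp: subset_image_iff)
    have inj: "inj_on h A1" using assms(1) A1(1) by (rule inj_on_subset)
    have "finite A1" using A0(1) A1(2) inj finite_imageD by blast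
    moreover have "(\<Sum>l\<in>A0. s (c l) (g l)) = (\<Sum>l\<in>A1. s (c (h l)) (f l))"
      unfolding A1(2) sum.reindex[OF inj] using A1(1) assms(3) by (auto intro!: sum.cong)
    ultimately have "\<forall>l\<in>A1. c (h l) = 0"
      using assms(2) sU A1(1) indep_modD[of s U A f A1 "\<lambda>l. c (h l)"] by (simp add: basis_mod_def)
    then show "\<forall>l\<in>A0. c l = 0" using A1(2) by blast
  qed
next
  show "spans_mod s U W (h ` A) g"
    unfolding spans_mod_def
  proof
    fix w assume "w \<in> W"
    then obtain c A1 where c: "finite A1" "A1 \<subseteq> A" "w - (\<Sum>l\<in>A1. s (c l) (f l)) \<in> U"
      using assms(2) unfolding basis_mod_def spans_mod_def by blast
    have inj: "inj_on h A1" using assms(1) c(2) by (rule inj_on_subset)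
    have "(\<Sum>l\<in>h ` A1. s (c (the_inv_into A1 h l)) (g l)) = (\<Sum>l\<in>A1. s (c l) (f l))"
      unfolding sum.reindex[OF inj] using c(2) assms(3)
      by (auto intro!: sum.cong simp: the_inv_into_f_f[OF inj])
    then show "\<exists>c A0. finite A0 \<and> A0 \<subseteq> h ` A \<and> w - (\<Sum>l\<in>A0. s (c l) (g l)) \<in> U"
      using c by (intro exI[of _ "\<lambda>l. c (the_inv_into A1 h l)"] exI[of _ "h ` A1"]) auto
  qed
qed

lemma hom_polys_degree_0:
  assumes "f \<in> hom_polys V 0"
  shows "f = const (lookup f 0)"
proof (rule poly_mapping_eqI)
  show "lookup f m = lookup (const (lookup f 0)) m" for m
    using assms by (cases "m = 0") (auto simp: hom_polys_def const_def lookup_single in_keys_iff)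
qed

text \<open>The locale only knows how constants and variables act; a form is reduced to these by
  splitting off one variable at a time.\<close>

lemma (in graded_module) N_hom_polys:
  "f \<in> hom_polys V i \<Longrightarrow> x \<in> N j \<Longrightarrow> act f x \<in> N (i + j)"
proof (induction i arbitrary: f)
  case 0
  then show ?case using hom_polys_degree_0[of f V] N_const by (metis add_0)
next
  case (Suc i)
  have "0 \<notin> keys f" using Suc.prems(1) by (auto simp: hom_polys_def)
  then obtain w where w: "\<forall>v\<in>V. w v \<in> hom_polys V i" "f = (\<Sum>v\<in>V. indet v * w v)"
    using hom_polys_split[OF finite_V Suc.prems(1)] by (auto simp: in_keys_iff)
  have "act f x = (\<Sum>v\<in>V. act (indet v) (act (w v) x))"
    by (simp add: w(2) scale_sum_left)
  also have "\<dots> \<in> N (Suc (i + j))" using w(1) Suc by (intro N_sum N_indet) auto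
  finally show ?case by simp
qed

text \<open>One index type has to serve for all uses: monomials of the ring, and pairs of a
  generator and a monomial for free modules.\<close>

definition finite_dim :: "(('v, 'k::field) mpoly \<Rightarrow> 'm::ab_group_add \<Rightarrow> 'm) \<Rightarrow> 'm set \<Rightarrow> bool" where
  "finite_dim act W \<longleftrightarrow> (\<exists>(A :: (nat \<times> ('v \<Rightarrow>\<^sub>0 nat)) set) f. finite A \<and> spans_mod (\<lambda>c. act (const c)) {0} W A f)"

lemma finite_dim_subset: "finite_dim act W \<Longrightarrow> W' \<subseteq> W \<Longrightarrow> finite_dim act W'"
  unfolding finite_dim_def spans_mod_def by blast

lemma (in graded_module) minimal_generators_exist:
  assumes "finite_dim act (N j)"
  shows "\<exists>n f. basis_mod (\<lambda>c. act (const c)) (irr_part V act N j) (N j) {..<n::nat} f"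
proof -
  obtain A :: "(nat \<times> ('v \<Rightarrow>\<^sub>0 nat)) set" and f
    where A: "finite A" "spans_mod (\<lambda>c. act (const c)) {0} (N j) A f"
    using assms unfolding finite_dim_def by blast
  have "spans_mod (\<lambda>c. act (const c)) (irr_part V act N j) (N j) A f"
    using A(2) irr_part_zero unfolding spans_mod_def by (metis singletonD)
  then show ?thesis
    by (rule vector_space.basis_mod_exists[OF vector_space subspace_irr_part _ A(1)])
qed

text \<open>The generators of degree \<open>j\<close> are indexed by the codes of the pairs \<open>(j, k)\<close>.\<close>

lemma (in graded_module) minimal_cover_exists:
  assumes fd: "\<And>j. finite_dim act (N j)"
  shows "\<exists>B \<delta> D. minimal_cover act V N B \<delta> D \<and> (\<forall>j. finite {l\<in>B. \<delta> l = j})"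
proof -
  have "\<forall>j. \<exists>p. basis_mod (\<lambda>c. act (const c)) (irr_part V act N j) (N j) {..<fst p::nat} (snd p)"
    using minimal_generators_exist[OF fd] by auto
  from choice[OF this] obtain p
    where p': "\<forall>j. basis_mod (\<lambda>c. act (const c)) (irr_part V act N j) (N j) {..<fst (p j) :: nat} (snd (p j))" ..
  note p = p'[rule_format]
  define B where "B = {l. snd (prod_decode l) < fst (p (fst (prod_decode l)))}"
  define \<delta> where "\<delta> l = fst (prod_decode l)" for l
  define g where "g l = snd (p (\<delta> l)) (snd (prod_decode l))" for l
  have Bj: "{l\<in>B. \<delta> l = j} = (\<lambda>k. prod_encode (j, k)) ` {..<fst (p j)}" for j
  proof (intro equalityI subsetI)
    fix l assume "l \<in> {l\<in>B. \<delta> l = j}"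
    then have "snd (prod_decode l) < fst (p j)" "l = prod_encode (j, snd (prod_decode l))"
      by (auto simp: B_def \<delta>_def)
    then show "l \<in> (\<lambda>k. prod_encode (j, k)) ` {..<fst (p j)}" by blast
  qed (auto simp: B_def \<delta>_def)
  have bas: "basis_mod (\<lambda>c. act (const c)) (irr_part V act N j) (N j) {l\<in>B. \<delta> l = j} g" for j
    unfolding Bj by (rule basis_mod_reindex[OF _ p]) (auto simp: inj_on_def g_def \<delta>_def)
  have fin: "finite {l\<in>B. \<delta> l = j}" for j unfolding Bj by simp
  define D where "D x = (\<Sum>l\<in>keys x. act (lookup x l) (g l))" for x
  have D_sup: "D x = (\<Sum>l\<in>L. act (lookup x l) (g l))" if "finite L" "keys x \<subseteq> L" for x L
    unfolding D_def by (rule sum.mono_neutral_left) (use that in \<open>auto simp: in_keys_iff\<close>)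
  have D_add: "D (x + y) = D x + D y" for x y
  proof -
    have "keys (x + y) \<subseteq> keys x \<union> keys y" by (rule Poly_Mapping.keys_add)
    then show ?thesis
      using D_sup[of "keys x \<union> keys y" "x + y"] D_sup[of "keys x \<union> keys y" x] D_sup[of "keys x \<union> keys y" y]
      by (simp add: lookup_add scale_left_distrib sum.distrib)
  qed
  have D_scale: "D (scale s x) = act s (D x)" for s x
  proof -
    have "keys (scale s x) \<subseteq> keys x" by (auto simp: in_keys_iff lookup_scale)
    then have "D (scale s x) = (\<Sum>l\<in>keys x. act (lookup (scale s x) l) (g l))"
      by (intro D_sup) auto
    then show ?thesis by (simp add: D_def lookup_scale scale_sum_right)
  qed
  have D_zero: "D 0 = 0" by (simp add: D_def)
  have D_sum: "D (\<Sum>i\<in>A. f i) = (\<Sum>i\<in>A. D (f i))" for f and A :: "'i set"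
    by (induction A rule: infinite_finite_induct) (auto simp: D_zero D_add)
  have D_unit: "D (unit_vector l) = g l" for l
    by (simp add: D_def unit_vector_def)
  have gN: "g l \<in> N (\<delta> l)" if "l \<in> B" for l
    using bas[of "\<delta> l"] that unfolding basis_mod_def by blast
  have D_in: "D x \<in> N j" if x: "x \<in> free_component V B \<delta> j" for x j
    unfolding D_def
  proof (rule N_sum)
    fix l assume l: "l \<in> keys x"
    then have "l \<in> B" "lookup x l \<in> shift (\<delta> l) (hom_polys V) j" "lookup x l \<noteq> 0"
      using x by (auto simp: free_component_iff in_keys_iff)
    then show "act (lookup x l) (g l) \<in> N j"
      using N_hom_polys[of "lookup x l" "j - \<delta> l" "g l" "\<delta> l"] gN by (auto simp: shift_def split: if_splits)
  qed
  interpret F: graded_module "scale :: ('v, 'k) mpoly \<Rightarrow> _" V "free_component V B \<delta>"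
    by (rule graded_module_free[OF finite_V])
  have D_split: "D ((\<Sum>l\<in>A0. scale (const (c l)) (unit_vector l)) + (\<Sum>v\<in>V. scale (indet v) (w v)))
      = (\<Sum>l\<in>A0. act (const (c l)) (g l)) + (\<Sum>v\<in>V. act (indet v) (D (w v)))" for A0 c w
    by (simp add: D_add D_sum D_scale D_unit)
  have D_prev: "D w \<in> prev N j" if "w \<in> prev (free_component V B \<delta>) j" for w j
    using that D_in by (cases j) (auto simp: shift_def D_zero)
  \<comment> \<open>Modulo the generators of degree \<open>j\<close>, an element of
    \<open>N j\<close> lies in \<mm>N, where surjectivity one degree lower applies.\<close>
  have step: "N j \<subseteq> D ` free_component V B \<delta> j"
    if IH: "prev N j \<subseteq> D ` prev (free_component V B \<delta>) j" for j
  proof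
    fix n assume "n \<in> N j"
    then obtain c A0 where c: "finite A0" "A0 \<subseteq> {l\<in>B. \<delta> l = j}"
      "n - (\<Sum>l\<in>A0. act (const (c l)) (g l)) \<in> irr_part V act N j"
      using bas[of j] unfolding basis_mod_def spans_mod_def by blast
    then obtain u where u: "\<forall>v\<in>V. u v \<in> prev N j"
      "n = (\<Sum>l\<in>A0. act (const (c l)) (g l)) + (\<Sum>v\<in>V. act (indet v) (u v))"
      unfolding irr_part_def by (auto simp: algebra_simps)
    have "\<forall>v\<in>V. \<exists>w. w \<in> prev (free_component V B \<delta>) j \<and> u v = D w" using u(1) IH by blast
    from bchoice[OF this] obtain w where w: "\<And>v. v \<in> V \<Longrightarrow> w v \<in> prev (free_component V B \<delta>) j \<and> u v = D (w v)"
      by blast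
    have "n = D ((\<Sum>l\<in>A0. scale (const (c l)) (unit_vector l)) + (\<Sum>v\<in>V. scale (indet v) (w v)))"
      unfolding D_split using u(2) w by simp
    moreover have "(\<Sum>l\<in>A0. scale (const (c l)) (unit_vector l)) + (\<Sum>v\<in>V. scale (indet v) (w v))
        \<in> free_component V B \<delta> j"
      using c(2) w unit_vector_in_free_component[of _ B V \<delta>]
      by (intro F.N_add F.N_sum F.N_const F.indet_prev) auto
    ultimately show "n \<in> D ` free_component V B \<delta> j" by blast
  qed
  have onto: "N j \<subseteq> D ` free_component V B \<delta> j" for j
  proof (induction j)
    case 0
    show ?case by (rule step) (simp add: shift_def D_zero)
  next
    case (Suc j)
    then show ?case by (intro step) simp
  qed
  have ker: "lookup (lookup x l) 0 = 0" if x: "x \<in> free_component V B \<delta> j" "D x = 0" for x l j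
  proof (cases "l \<in> keys x \<and> \<delta> l = j")
    case False
    show ?thesis
    proof (cases "l \<in> keys x")
      case True
      have "0 \<notin> keys (lookup x l)"
      proof
        assume "0 \<in> keys (lookup x l)"
        then have "total_deg (0 :: 'v \<Rightarrow>\<^sub>0 nat) + \<delta> l = j" using x unfolding free_component_def by blast
        then show False using True False by simp
      qed
      then show ?thesis by (simp add: in_keys_iff)
    qed (simp add: not_in_keys_iff_lookup_eq_zero)
  next
    case True
    \<comment> \<open>A nonzero constant coefficient of a kernel element would make the generators
      of degree \<open>j\<close> dependent modulo \<mm>N.\<close>
    define A0 where "A0 = {l \<in> keys x. \<delta> l = j}"
    define c where "c l = lookup (lookup x l) 0" for l
    obtain w where w: "\<forall>v\<in>V. w v \<in> prev (free_component V B \<delta>) j"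
      "x = (\<Sum>l\<in>A0. scale (const (c l)) (unit_vector l)) + (\<Sum>v\<in>V. scale (indet v) (w v))"
      using free_component_const_split[OF finite_V x(1)] unfolding A0_def c_def by blast
    have "(\<Sum>l\<in>A0. act (const (c l)) (g l)) + (\<Sum>v\<in>V. act (indet v) (D (w v))) = 0"
      using x(2) D_split[of c A0 w] w(2) by simp
    then have "(\<Sum>l\<in>A0. act (const (c l)) (g l)) = (\<Sum>v\<in>V. act (indet v) (- D (w v)))"
      by (simp add: sum_negf eq_neg_iff_add_eq_0)
    also have "\<dots> \<in> irr_part V act N j"
      unfolding irr_part_def using w(1) D_prev graded_module.N_uminus[OF graded_module_shift]
      by (intro CollectI exI[of _ "\<lambda>v. - D (w v)"]) auto
    finally have "c l = 0"
      using bas[of j] True x(1)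
      by (intro indep_modD[of "\<lambda>c. act (const c)" "irr_part V act N j" "{l\<in>B. \<delta> l = j}" g A0 c l])
        (auto simp: basis_mod_def A0_def free_component_iff)
    then show ?thesis by (simp add: c_def)
  qed
  have "minimal_cover act V N B \<delta> D"
  proof unfold_locales
    show "D ` free_component V B \<delta> j = N j" for j using D_in onto by blast
  qed (use D_add D_scale ker in auto)
  then show ?thesis using fin by blast
qed

section \<open>Finite dimension of the graded components\<close>

lemma finite_monomials: "finite V \<Longrightarrow> finite {m :: 'v \<Rightarrow>\<^sub>0 nat. keys m \<subseteq> V \<and> total_deg m \<le> j}"
proof -
  assume V: "finite V"
  have "lookup m v \<le> j" if "total_deg m \<le> j" for m :: "'v \<Rightarrow>\<^sub>0 nat" and v
  proof (cases "v \<in> keys m")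
    case True
    then have "lookup m v \<le> total_deg m" unfolding total_deg_def by (intro member_le_sum) auto
    then show ?thesis using that by simp
  qed (simp add: in_keys_iff)
  then have "lookup ` {m :: 'v \<Rightarrow>\<^sub>0 nat. keys m \<subseteq> V \<and> total_deg m \<le> j}
      \<subseteq> {f. \<forall>v. (v \<in> V \<longrightarrow> f v \<in> {..j}) \<and> (v \<notin> V \<longrightarrow> f v = 0)}"
    by (fastforce simp: in_keys_iff)
  moreover have "finite {f. \<forall>v. (v \<in> V \<longrightarrow> f v \<in> {..j}) \<and> (v \<notin> V \<longrightarrow> f v = (0::nat))}"
    by (rule finite_set_of_finite_funs) (use V in auto)
  ultimately have "finite (lookup ` {m :: 'v \<Rightarrow>\<^sub>0 nat. keys m \<subseteq> V \<and> total_deg m \<le> j})"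
    by (rule finite_subset)
  then show ?thesis
    by (rule finite_imageD) (rule inj_onI, simp only: poly_mapping_eq_iff)
qed

lemma finite_dim_hom_polys:
  assumes "finite V"
  shows "finite_dim ((*) :: ('v, 'k::field) mpoly \<Rightarrow> _) (hom_polys V j)"
  unfolding finite_dim_def
proof (intro exI conjI)
  let ?A = "Pair 0 ` {m :: 'v \<Rightarrow>\<^sub>0 nat. keys m \<subseteq> V \<and> total_deg m \<le> j}"
  show "finite ?A" using finite_monomials[OF assms] by auto
  show "spans_mod (\<lambda>c. (*) (const c :: ('v, 'k) mpoly)) {0} (hom_polys V j) ?A (\<lambda>(_::nat, m). single m 1)"
    unfolding spans_mod_def
  proof
    fix f :: "('v, 'k) mpoly" assume f: "f \<in> hom_polys V j"
    have "(\<Sum>p\<in>Pair 0 ` keys f. const (lookup f (snd p)) * (case p of (_::nat, m) \<Rightarrow> single m 1)) = (\<Sum>m\<in>keys f. single m (lookup f m))"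
      by (subst sum.reindex) (auto simp: inj_on_def const_def mult_single)
    then have "f - (\<Sum>p\<in>Pair 0 ` keys f. const (lookup f (snd p)) * (case p of (_::nat, m) \<Rightarrow> single m 1)) \<in> {0}"
      using poly_mapping_sum_single[of f] by simp
    moreover have "Pair 0 ` keys f \<subseteq> ?A" using f by (auto simp: hom_polys_def polys_in_def)
    ultimately show "\<exists>c A0. finite A0 \<and> A0 \<subseteq> ?A \<and>
        f - (\<Sum>l\<in>A0. const (c l) * (case l of (_::nat, m) \<Rightarrow> single m 1)) \<in> {0}"
      by (intro exI[of _ "\<lambda>p. lookup f (snd p)"] exI[of _ "Pair 0 ` keys f"]) auto
  qed
qed

lemma finite_dim_free_component:
  assumes "finite V" "\<And>j. finite {l\<in>B. \<delta> l = j}"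
  shows "finite_dim (scale :: ('v, 'k::field) mpoly \<Rightarrow> _) (free_component V B \<delta> j)"
  unfolding finite_dim_def
proof (intro exI conjI)
  let ?A = "{l\<in>B. \<delta> l \<le> j} \<times> {m :: 'v \<Rightarrow>\<^sub>0 nat. keys m \<subseteq> V \<and> total_deg m \<le> j}"
  let ?f = "\<lambda>(l, m). single l (single m 1) :: nat \<Rightarrow>\<^sub>0 ('v, 'k) mpoly"
  have "{l\<in>B. \<delta> l \<le> j} = (\<Union>i\<le>j. {l\<in>B. \<delta> l = i})" by auto
  then show "finite ?A" using finite_monomials[OF assms(1)] assms(2) by auto
  show "spans_mod (\<lambda>c. scale (const c :: ('v, 'k) mpoly)) {0} (free_component V B \<delta> j) ?A ?f"
    unfolding spans_mod_def
  proof
    fix x :: "nat \<Rightarrow>\<^sub>0 ('v, 'k) mpoly" assume x: "x \<in> free_component V B \<delta> j"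
    let ?c = "\<lambda>p. lookup (lookup x (fst p)) (snd p)"
    let ?T = "Sigma (keys x) (\<lambda>l. keys (lookup x l))"
    have sc: "scale (const a) (single l (single m 1)) = single l (single m a)"
      for a :: 'k and l and m :: "'v \<Rightarrow>\<^sub>0 nat"
      by (rule poly_mapping_eqI) (simp add: lookup_scale lookup_single when_def const_def mult_single)
    have "(\<Sum>p\<in>?T. scale (const (?c p)) (?f p)) = (\<Sum>p\<in>?T. single (fst p) (single (snd p) (?c p)))"
      by (intro sum.cong) (auto simp: sc)
    also have "\<dots> = (\<Sum>l\<in>keys x. \<Sum>m\<in>keys (lookup x l). single l (single m (lookup (lookup x l) m)))"
      by (subst sum.Sigma) (auto simp: case_prod_unfold)
    also have "\<dots> = (\<Sum>l\<in>keys x. single l (\<Sum>m\<in>keys (lookup x l). single m (lookup (lookup x l) m)))"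
      by (intro sum.cong refl poly_mapping_eqI) (simp add: lookup_sum lookup_single when_def)
    also have "\<dots> = x" by (simp flip: poly_mapping_sum_single)
    finally have "x - (\<Sum>p\<in>?T. scale (const (?c p)) (?f p)) \<in> {0}" by simp
    moreover have "?T \<subseteq> ?A"
    proof
      fix p assume p: "p \<in> ?T"
      have "snd p \<in> keys (lookup x (fst p))" "fst p \<in> keys x" using p by auto
      then have "total_deg (snd p) + \<delta> (fst p) = j" "fst p \<in> B" "keys (snd p) \<subseteq> V"
        using x unfolding free_component_def free_module_def polys_in_def by force+
      then show "p \<in> ?A" by (auto simp: mem_Times_iff)
    qed
    ultimately show "\<exists>c A0. finite A0 \<and> A0 \<subseteq> ?A \<and> x - (\<Sum>p\<in>A0. scale (const (c p)) (?f p)) \<in> {0}"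
      by (intro exI[of _ ?c] exI[of _ ?T]) auto
  qed
qed

text \<open>The projection onto degree \<open>j\<close>. The guard keeps truncated subtraction from
  treating a negative degree as degree 0.\<close>

definition free_part ::
  "(nat \<Rightarrow> nat) \<Rightarrow> nat \<Rightarrow> (nat \<Rightarrow>\<^sub>0 ('v, 'k::comm_ring_1) mpoly) \<Rightarrow> (nat \<Rightarrow>\<^sub>0 ('v, 'k) mpoly)" where
  "free_part \<delta> j x = (\<Sum>l\<in>keys x. single l (if \<delta> l \<le> j then hom_part (j - \<delta> l) (lookup x l) else 0))"

lemma lookup_free_part:
  "lookup (lookup (free_part \<delta> j x) l) m = (if total_deg m + \<delta> l = j then lookup (lookup x l) m else 0)"
  by (auto simp: free_part_def lookup_sum_single lookup_hom_part in_keys_iff)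

lemma free_part_in_free_component:
  assumes "x \<in> free_module V B"
  shows "free_part \<delta> j x \<in> free_component V B \<delta> j"
  unfolding free_component_def free_module_def
proof (intro CollectI conjI allI ballI)
  show "keys (free_part \<delta> j x) \<subseteq> B"
    using assms by (auto simp: free_part_def free_module_def lookup_sum_single in_keys_iff split: if_splits)
  fix l
  have "m \<in> keys (lookup x l)" if "m \<in> keys (lookup (free_part \<delta> j x) l)" for m
    using that by (auto simp: in_keys_iff lookup_free_part split: if_splits)
  then show "lookup (free_part \<delta> j x) l \<in> polys_in V"
    using assms unfolding polys_in_def free_module_def by blast
  show "total_deg m + \<delta> l = j" if "m \<in> keys (lookup (free_part \<delta> j x) l)" for m
    using that by (auto simp: in_keys_iff lookup_free_part split: if_splits)
qed

lemma free_component_lookup: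
  "x \<in> free_component V B \<delta> j \<Longrightarrow> total_deg m + \<delta> l \<noteq> j \<Longrightarrow> lookup (lookup x l) m = 0"
  unfolding free_component_def using not_in_keys_iff_lookup_eq_zero by fastforce

lemma free_part_id: "x \<in> free_component V B \<delta> j \<Longrightarrow> free_part \<delta> j x = x"
  by (intro poly_mapping_eqI) (auto simp: lookup_free_part free_component_lookup)

lemma free_part_other: "x \<in> free_component V B \<delta> i \<Longrightarrow> i \<noteq> j \<Longrightarrow> free_part \<delta> j x = 0"
  by (intro poly_mapping_eqI) (auto simp: lookup_free_part free_component_lookup)

lemma free_part_sum: "free_part \<delta> j (\<Sum>i\<in>A. f i) = (\<Sum>i\<in>A. free_part \<delta> j (f i))"
  by (intro poly_mapping_eqI) (simp add: lookup_free_part lookup_sum)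

lemma free_part_decomposition:
  obtains J where "finite J" "x = (\<Sum>j\<in>J. free_part \<delta> j x)"
proof
  let ?J = "\<Union>l\<in>keys x. (\<lambda>m. total_deg m + \<delta> l) ` keys (lookup x l)"
  show "finite ?J" by simp
  show "x = (\<Sum>j\<in>?J. free_part \<delta> j x)"
  proof (intro poly_mapping_eqI)
    fix l m
    have "lookup (lookup (\<Sum>j\<in>?J. free_part \<delta> j x) l) m
        = (\<Sum>j\<in>?J. if total_deg m + \<delta> l = j then lookup (lookup x l) m else 0)"
      by (simp add: lookup_sum lookup_free_part)
    also have "\<dots> = lookup (lookup x l) m"
    proof (cases "lookup (lookup x l) m = 0")
      case False
      then have "l \<in> keys x" "m \<in> keys (lookup x l)" by (auto simp: in_keys_iff)
      then have "total_deg m + \<delta> l \<in> ?J" by blast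
      then show ?thesis by (simp add: sum.delta')
    qed simp
    finally show "lookup (lookup x l) m = lookup (lookup (\<Sum>j\<in>?J. free_part \<delta> j x) l) m" ..
  qed
qed

text \<open>Resolutions are exact on whole modules, whereas covers work degree by degree.
  Compatibility with projections makes homogeneous components of preimages and of kernel elements
  available.\<close>

lemma graded_map_free_part:
  assumes add: "\<And>x y. x \<in> free_module V B \<Longrightarrow> y \<in> free_module V B \<Longrightarrow> D (x + y) = D x + D y"
    and deg: "\<And>j. D ` free_component V B \<delta> j \<subseteq> free_component V B' \<delta>' j"
    and x: "x \<in> free_module V B"
  shows "D (free_part \<delta> j x) = free_part \<delta>' j (D x)"
proof -
  obtain J where J: "finite J" "x = (\<Sum>j\<in>J. free_part \<delta> j x)"
    by (rule free_part_decomposition)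
  have fp: "free_part \<delta> i x \<in> free_module V B" for i
    using free_part_in_free_component[OF x] free_component_free_module by blast
  have Dfp: "D (free_part \<delta> i x) \<in> free_component V B' \<delta>' i" for i
    using deg free_part_in_free_component[OF x] by blast
  have D0: "D 0 = 0" using add[of 0 0] by (simp add: free_module_zero)
  have "D (\<Sum>j\<in>J'. free_part \<delta> j x) = (\<Sum>j\<in>J'. D (free_part \<delta> j x))" for J'
    by (induction J' rule: infinite_finite_induct) (auto simp: D0 add fp free_module_sum)
  then have "free_part \<delta>' j (D x) = (\<Sum>i\<in>J. free_part \<delta>' j (D (free_part \<delta> i x)))"
    by (subst J(2)) (simp add: free_part_sum)
  also have "\<dots> = (\<Sum>i\<in>J. if i = j then D (free_part \<delta> i x) else 0)"
    by (intro sum.cong) (auto simp: free_part_id[OF Dfp] free_part_other[OF Dfp])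
  also have "\<dots> = (if j \<in> J then D (free_part \<delta> j x) else 0)"
    using J(1) by simp
  also have "\<dots> = D (free_part \<delta> j x)"
  proof (cases "j \<in> J")
    case False
    have "free_part \<delta> j x = (\<Sum>i\<in>J. free_part \<delta> j (free_part \<delta> i x))"
      by (subst J(2)) (simp add: free_part_sum)
    also have "\<dots> = 0"
      using False free_part_other[OF free_part_in_free_component[OF x]] by (intro sum.neutral) metis
    finally show ?thesis using False D0 by simp
  qed simp
  finally show ?thesis ..
qed

section \<open>Betti numbers in homological degrees one and two\<close>

lemma hom_polys_lookup_0: "f \<in> hom_polys V j \<Longrightarrow> j \<noteq> 0 \<Longrightarrow> lookup f 0 = 0"
  unfolding hom_polys_def using not_in_keys_iff_lookup_eq_zero by fastforce

text \<open>A homogeneous ideal given as the kernel of a ring map: \<open>\<phi>_graded\<close> says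
  that the kernel is graded, \<open>\<phi>_const\<close> that it contains no nonzero
  constant.\<close>

locale graded_quotient =
  fixes V :: "'v set" and \<phi> :: "('v, 'k::field) mpoly \<Rightarrow> 'm::comm_ring_1"
  assumes finite_V: "finite V"
    and \<phi>_add: "\<phi> (f + g) = \<phi> f + \<phi> g"
    and \<phi>_mult: "\<phi> (f * g) = \<phi> f * \<phi> g"
    and \<phi>_one: "\<phi> 1 = 1"
    and \<phi>_graded: "f \<in> polys_in V \<Longrightarrow> \<phi> f = 0 \<Longrightarrow> \<phi> (hom_part j f) = 0"
    and \<phi>_const: "\<phi> (const c) = 0 \<Longrightarrow> c = 0"
begin

definition I :: "nat \<Rightarrow> ('v, 'k) mpoly set" where
  "I j = {f \<in> hom_polys V j. \<phi> f = 0}"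

abbreviation "resolution \<equiv> minimal_graded_free_resolution V \<phi> (\<phi> ` polys_in V) (\<lambda>j. \<phi> ` hom_polys V j)"

abbreviation "betti \<equiv> graded_betti V \<phi> (\<phi> ` polys_in V) (\<lambda>j. \<phi> ` hom_polys V j)"

lemma \<phi>_zero: "\<phi> 0 = 0"
  using \<phi>_add[of 0 0] by simp

lemma \<phi>_uminus: "\<phi> (- f) = - \<phi> f"
  using \<phi>_add[of f "- f"] \<phi>_zero by (simp add: eq_neg_iff_add_eq_0 add.commute)

lemma \<phi>_diff: "\<phi> (f - g) = \<phi> f - \<phi> g"
  using \<phi>_add[of f "- g"] \<phi>_uminus by simp

lemma \<phi>_sum: "\<phi> (sum f A) = (\<Sum>i\<in>A. \<phi> (f i))"
  by (induction A rule: infinite_finite_induct) (auto simp: \<phi>_zero \<phi>_add)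

sublocale I: graded_module "(*) :: ('v, 'k) mpoly \<Rightarrow> _" V I
proof -
  interpret H: graded_module "(*) :: ('v, 'k) mpoly \<Rightarrow> _" V "hom_polys V"
    by (rule graded_module_hom_polys[OF finite_V])
  show "graded_module ((*) :: ('v, 'k) mpoly \<Rightarrow> _) V I"
    by unfold_locales
      (auto simp: I_def \<phi>_zero \<phi>_add \<phi>_mult finite_V intro: H.N_add H.N_const H.N_indet)
qed

lemma I_const: "f \<in> I j \<Longrightarrow> lookup f 0 = 0"
proof (cases j)
  case 0
  assume "f \<in> I j"
  then show ?thesis using 0 hom_polys_degree_0[of f V] \<phi>_const[of "lookup f 0"] by (auto simp: I_def)
next
  case (Suc i)
  assume "f \<in> I j"
  then show ?thesis using Suc hom_polys_lookup_0[of f V j] by (simp add: I_def)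
qed

end

locale graded_quotient_resolution = graded_quotient V \<phi>
  for V :: "'v set" and \<phi> :: "('v, 'k::field) mpoly \<Rightarrow> 'm::comm_ring_1" +
  fixes B \<delta> d \<epsilon>
  assumes res: "resolution B \<delta> d \<epsilon>"
begin

lemmas res' = res[unfolded minimal_graded_free_resolution_def Let_def]

lemmas d_add = res'[THEN conjunct1, rule_format]
lemmas d_scale = res'[THEN conjunct2, THEN conjunct1, rule_format]
lemmas d_graded = res'[THEN conjunct2, THEN conjunct2, THEN conjunct1, rule_format]
lemmas \<epsilon>_add = res'[THEN conjunct2, THEN conjunct2, THEN conjunct2, THEN conjunct1, rule_format]
lemmas \<epsilon>_scale = res'[THEN conjunct2, THEN conjunct2, THEN conjunct2, THEN conjunct2, THEN conjunct1, rule_format]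
lemmas \<epsilon>_graded = res'[THEN conjunct2, THEN conjunct2, THEN conjunct2, THEN conjunct2, THEN conjunct2, THEN conjunct1, rule_format]
lemmas \<epsilon>_onto = res'[THEN conjunct2, THEN conjunct2, THEN conjunct2, THEN conjunct2, THEN conjunct2, THEN conjunct2, THEN conjunct1]
lemmas exact_0 = res'[THEN conjunct2, THEN conjunct2, THEN conjunct2, THEN conjunct2, THEN conjunct2, THEN conjunct2, THEN conjunct2, THEN conjunct1]
lemmas exact_Suc = res'[THEN conjunct2, THEN conjunct2, THEN conjunct2, THEN conjunct2, THEN conjunct2, THEN conjunct2, THEN conjunct2, THEN conjunct2, THEN conjunct1, rule_format]
lemmas d_minimal = res'[THEN conjunct2, THEN conjunct2, THEN conjunct2, THEN conjunct2, THEN conjunct2, THEN conjunct2, THEN conjunct2, THEN conjunct2, THEN conjunct2, rule_format]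

lemma \<epsilon>_minimal: "x \<in> free_module V (B 0) \<Longrightarrow> \<epsilon> x = 0 \<Longrightarrow> lookup (lookup x l) 0 = 0"
  using exact_0 d_minimal[of 0] unfolding max_submodule_def by blast

lemma d_kernel_minimal:
  "x \<in> free_module V (B (Suc i)) \<Longrightarrow> d i x = 0 \<Longrightarrow> lookup (lookup x l) 0 = 0"
  using exact_Suc[of i] d_minimal[of "Suc i"] unfolding max_submodule_def by blast

lemma unit_vector_B: "l \<in> B i \<Longrightarrow> unit_vector l \<in> free_module V (B i)"
  by (rule free_component_free_module[OF unit_vector_in_free_component])

text \<open>Otherwise \<open>\<phi> 1\<close> would be the image of a sum of forms of positive
  degree. Then 1 minus that sum is in the kernel of \<open>\<phi>\<close>, and so is its degree 0
  part, which is 1.\<close>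

lemma degree_0_generator: "\<exists>l\<in>B 0. \<delta> 0 l = 0"
proof (rule ccontr)
  assume neg: "\<not> ?thesis"
  have "\<phi> 1 \<in> \<epsilon> ` free_module V (B 0)" unfolding \<epsilon>_onto by simp
  then obtain x where x: "x \<in> free_module V (B 0)" "\<epsilon> x = \<phi> 1" by auto
  obtain J where J: "finite J" "x = (\<Sum>j\<in>J. free_part (\<delta> 0) j x)"
    by (rule free_part_decomposition)
  have fp: "free_part (\<delta> 0) j x \<in> free_component V (B 0) (\<delta> 0) j" for j
    by (rule free_part_in_free_component[OF x(1)])
  then have fp': "free_part (\<delta> 0) j x \<in> free_module V (B 0)" for j
    by (rule free_component_free_module)
  have \<epsilon>0: "\<epsilon> 0 = 0" using \<epsilon>_add[of 0 0] by (simp add: free_module_zero)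
  have "\<epsilon> (\<Sum>j\<in>J'. free_part (\<delta> 0) j x) = (\<Sum>j\<in>J'. \<epsilon> (free_part (\<delta> 0) j x))" for J'
    by (induction J' rule: infinite_finite_induct) (auto simp: \<epsilon>0 \<epsilon>_add fp' free_module_sum)
  then have \<epsilon>x: "\<epsilon> x = (\<Sum>j\<in>J. \<epsilon> (free_part (\<delta> 0) j x))" by (subst J(2))
  have "\<exists>f. f \<in> hom_polys V j \<and> \<epsilon> (free_part (\<delta> 0) j x) = \<phi> f" for j
    using \<epsilon>_graded[of j] fp[of j] by blast
  then obtain f where f: "\<And>j. f j \<in> hom_polys V j" "\<And>j. \<epsilon> (free_part (\<delta> 0) j x) = \<phi> (f j)" by metis
  have "free_part (\<delta> 0) 0 x = 0"
  proof (rule poly_mapping_eqI)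
    fix l
    show "lookup (free_part (\<delta> 0) 0 x) l = lookup 0 l"
    proof (cases "l \<in> B 0")
      case True
      then have "\<delta> 0 l \<noteq> 0" using neg by auto
      then show ?thesis by (intro poly_mapping_eqI) (simp add: lookup_free_part)
    next
      case False
      then have "l \<notin> keys (free_part (\<delta> 0) 0 x)" using fp[of 0] by (auto simp: free_component_iff)
      then show ?thesis by (simp add: in_keys_iff)
    qed
  qed
  then have "\<phi> (f 0) = 0" using f(2)[of 0] \<epsilon>0 by simp
  then have "\<epsilon> x = (\<Sum>j\<in>J. \<phi> (if j = 0 then 0 else f j))"
    unfolding \<epsilon>x f(2) by (intro sum.cong) (auto simp: \<phi>_zero)
  then have "\<phi> (1 - (\<Sum>j\<in>J. if j = 0 then 0 else f j)) = 0"
    using x(2) by (simp add: \<phi>_diff \<phi>_sum)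
  moreover have "1 - (\<Sum>j\<in>J. if j = 0 then 0 else f j) \<in> polys_in V"
    using f(1) hom_polys_polys_in by (intro polys_in_diff polys_in_sum) auto
  ultimately have "\<phi> (hom_part 0 (1 - (\<Sum>j\<in>J. if j = 0 then 0 else f j))) = 0"
    using \<phi>_graded by blast
  moreover have "hom_part 0 (1 - (\<Sum>j\<in>J. if j = 0 then 0 else f j)) = 1"
  proof (rule poly_mapping_eqI)
    fix m
    have "lookup (f j) 0 = 0" if "j \<noteq> 0" for j
      using hom_polys_lookup_0[OF f(1)] that by blast
    then have "(\<Sum>j\<in>J. lookup (if j = 0 then 0 else f j) 0) = 0" by (intro sum.neutral) auto
    then show "lookup (hom_part 0 (1 - (\<Sum>j\<in>J. if j = 0 then 0 else f j))) m = lookup 1 m"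
      by (auto simp: lookup_hom_part lookup_minus lookup_sum lookup_one when_def)
  qed
  ultimately show False using \<phi>_const[of 1] by simp
qed

definition l0 :: nat where "l0 = (SOME l. l \<in> B 0 \<and> \<delta> 0 l = 0)"

lemma l0: "l0 \<in> B 0" "\<delta> 0 l0 = 0"
  using someI_ex[of "\<lambda>l. l \<in> B 0 \<and> \<delta> 0 l = 0"] degree_0_generator unfolding l0_def by blast+

lemma \<epsilon>_l0: obtains c where "c \<noteq> 0" "\<epsilon> (unit_vector l0) = \<phi> (const c)"
proof -
  have u: "unit_vector l0 \<in> free_module V (B 0)" by (rule unit_vector_B[OF l0(1)])
  have "\<epsilon> (unit_vector l0) \<in> \<phi> ` hom_polys V 0"
    using \<epsilon>_graded[of 0] unit_vector_in_free_component[OF l0(1), of V "\<delta> 0"] l0(2) by auto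
  then obtain f where f: "f \<in> hom_polys V 0" "\<epsilon> (unit_vector l0) = \<phi> f" by blast
  have "lookup f 0 \<noteq> 0"
  proof
    assume "lookup f 0 = 0"
    then have "f = 0" using hom_polys_degree_0[OF f(1)] by simp
    then have "lookup (lookup (unit_vector l0 :: nat \<Rightarrow>\<^sub>0 ('v, 'k) mpoly) l0) 0 = 0"
      using f(2) \<phi>_zero by (intro \<epsilon>_minimal u) simp
    then show False by (simp add: lookup_unit_vector)
  qed
  then show thesis using that hom_polys_degree_0[OF f(1)] f(2) by metis
qed

text \<open>The generator \<open>l0\<close> maps to an invertible constant, so the image of any
  other generator is a multiple of it. This gives a kernel element with coefficient 1 at
  \<open>l\<close>, against minimality.\<close>

lemma B_0: "B 0 = {l0}"
proof -
  have "l = l0" if l: "l \<in> B 0" for l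
  proof (rule ccontr)
    assume "l \<noteq> l0"
    obtain c where c: "c \<noteq> 0" "\<epsilon> (unit_vector l0) = \<phi> (const c)" by (rule \<epsilon>_l0)
    have "\<epsilon> (unit_vector l) \<in> \<phi> ` hom_polys V (\<delta> 0 l)"
      using \<epsilon>_graded[of "\<delta> 0 l"] unit_vector_in_free_component[OF l, of V "\<delta> 0"] by auto
    then obtain f where f: "f \<in> hom_polys V (\<delta> 0 l)" "\<epsilon> (unit_vector l) = \<phi> f" by blast
    define y where "y = unit_vector l + scale (- (f * const (inverse c))) (unit_vector l0)"
    have s: "- (f * const (inverse c)) \<in> polys_in V"
      using hom_polys_polys_in[OF f(1)] by (intro polys_in_uminus polys_in_mult) auto
    have F: "(unit_vector l :: nat \<Rightarrow>\<^sub>0 ('v, 'k) mpoly) \<in> free_module V (B 0)"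
      "scale (- (f * const (inverse c))) (unit_vector l0) \<in> free_module V (B 0)"
      using l l0 s by (auto intro: unit_vector_B free_module_scale)
    have "\<epsilon> y = \<phi> f + \<phi> (- (f * const (inverse c))) * \<phi> (const c)"
      unfolding y_def using F s by (simp add: \<epsilon>_add \<epsilon>_scale unit_vector_B l0(1) c(2) f(2))
    also have "\<dots> = 0"
      using c(1) by (simp add: mult.assoc const_mult \<phi>_uminus flip: \<phi>_mult)
    finally have "lookup (lookup y l) 0 = 0"
      by (intro \<epsilon>_minimal) (simp add: y_def free_module_add F)
    then show False
      using \<open>l \<noteq> l0\<close> by (simp add: y_def lookup_add lookup_scale lookup_unit_vector)
  qed
  then show ?thesis using l0(1) by blast
qed

lemma F_0_iff: "x \<in> free_module V (B 0) \<longleftrightarrow> (\<exists>f\<in>polys_in V. x = single l0 f)"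
proof
  assume "x \<in> free_module V (B 0)"
  then have x: "keys x \<subseteq> {l0}" "lookup x l0 \<in> polys_in V" by (auto simp: free_module_def B_0)
  have "x = single l0 (lookup x l0)"
  proof (rule poly_mapping_eqI)
    fix l
    have "l \<notin> keys x" if "l \<noteq> l0" using x(1) that by blast
    then show "lookup x l = lookup (single l0 (lookup x l0)) l"
      by (cases "l = l0") (auto simp: lookup_single when_def in_keys_iff)
  qed
  with x(2) show "\<exists>f\<in>polys_in V. x = single l0 f" by blast
qed (auto simp: free_module_def B_0 lookup_single when_def split: if_splits)

text \<open>On the unique generator the augmentation is \<open>\<phi>\<close> times an invertible
  constant, so both have the same kernel.\<close>

lemma \<epsilon>_single: 
  assumes "f \<in> polys_in V"
  shows "\<epsilon> (single l0 f) = 0 \<longleftrightarrow> \<phi> f = 0"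
proof -
  obtain c where c: "c \<noteq> 0" "\<epsilon> (unit_vector l0) = \<phi> (const c)" by (rule \<epsilon>_l0)
  have "single l0 f = scale f (unit_vector l0)"
    by (rule poly_mapping_eqI) (simp add: lookup_scale lookup_unit_vector lookup_single when_def)
  then have \<epsilon>: "\<epsilon> (single l0 f) = \<phi> f * \<phi> (const c)"
    using assms c(2) by (simp add: \<epsilon>_scale unit_vector_B l0(1))
  have "\<phi> f = \<phi> f * \<phi> (const c) * \<phi> (const (inverse c))"
    using c(1) by (simp add: mult.assoc \<phi>_mult[symmetric] const_mult \<phi>_one)
  then show ?thesis using \<epsilon> by auto
qed

lemma kernel_free_part:
  assumes "x \<in> free_module V (B (Suc i))"
  shows "d i (free_part (\<delta> (Suc i)) j x) = free_part (\<delta> i) j (d i x)"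
  by (rule graded_map_free_part[of V "B (Suc i)" "d i" "\<delta> (Suc i)" "B i" "\<delta> i" x j])
    (use d_add d_graded assms in auto)

text \<open>The free module in homological degree 0 is the ring itself, generated in degree 0;
  reading off the entry at \<open>l0\<close> turns the first differential into a cover of the
  ideal.\<close>

lemma minimal_cover_I: "minimal_cover (*) V I (B (Suc 0)) (\<delta> (Suc 0)) (\<lambda>x. lookup (d 0 x) l0)"
proof unfold_locales
  fix j x y s
  show "lookup (d 0 (x + y)) l0 = lookup (d 0 x) l0 + lookup (d 0 y) l0"
    if "x \<in> free_module V (B (Suc 0))" "y \<in> free_module V (B (Suc 0))"
    using that by (simp add: d_add lookup_add)
  show "lookup (d 0 (scale s x)) l0 = s * lookup (d 0 x) l0"
    if "s \<in> polys_in V" "x \<in> free_module V (B (Suc 0))"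
    using that by (simp add: d_scale lookup_scale)
  have d0: "d 0 x = single l0 (lookup (d 0 x) l0)" "lookup (d 0 x) l0 \<in> polys_in V" "\<phi> (lookup (d 0 x) l0) = 0"
    if "x \<in> free_module V (B (Suc 0))" for x
  proof -
    have x: "d 0 x \<in> free_module V (B 0)" "\<epsilon> (d 0 x) = 0" using exact_0 that by auto
    then obtain f where f: "f \<in> polys_in V" "d 0 x = single l0 f" using F_0_iff by blast
    then show "d 0 x = single l0 (lookup (d 0 x) l0)" "lookup (d 0 x) l0 \<in> polys_in V"
      "\<phi> (lookup (d 0 x) l0) = 0"
      using x(2) \<epsilon>_single by auto
  qed
  show "(\<lambda>x. lookup (d 0 x) l0) ` free_component V (B (Suc 0)) (\<delta> (Suc 0)) j = I j"
  proof (intro equalityI subsetI)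
    fix f assume "f \<in> (\<lambda>x. lookup (d 0 x) l0) ` free_component V (B (Suc 0)) (\<delta> (Suc 0)) j"
    then obtain x where x: "x \<in> free_component V (B (Suc 0)) (\<delta> (Suc 0)) j" "f = lookup (d 0 x) l0" by blast
    have "d 0 x \<in> free_component V (B 0) (\<delta> 0) j" using d_graded[of 0 j] x(1) by auto
    then have "f \<in> hom_polys V j" using x(2) l0(2) by (simp add: free_component_iff) (metis shift_0)
    then show "f \<in> I j" using d0(3)[of x] free_component_free_module[OF x(1)] x(2) by (simp add: I_def)
  next
    fix f assume f: "f \<in> I j"
    then have "f \<in> polys_in V" "\<phi> f = 0" by (auto simp: I_def hom_polys_def)
    then have "single l0 f \<in> d 0 ` free_module V (B (Suc 0))"
      using exact_0 F_0_iff \<epsilon>_single by auto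
    then obtain x where x: "x \<in> free_module V (B (Suc 0))" "single l0 f = d 0 x" by blast
    have "single l0 f \<in> free_component V (B 0) (\<delta> 0) j"
      using f l0 by (intro single_in_free_component) (auto simp: shift_def I_def)
    \<comment> \<open>Exactness yields just some preimage; its component of degree \<open>j\<close>
      is one as well, since the differential respects degrees.\<close>
    then have "d 0 (free_part (\<delta> (Suc 0)) j x) = single l0 f"
      using kernel_free_part[of x 0 j] x free_part_id by simp
    then show "f \<in> (\<lambda>x. lookup (d 0 x) l0) ` free_component V (B (Suc 0)) (\<delta> (Suc 0)) j"
      using free_part_in_free_component[OF x(1)] by (intro image_eqI[of _ _ "free_part (\<delta> (Suc 0)) j x"]) auto
  qed
  show "lookup (lookup x l) 0 = 0"
    if "x \<in> free_component V (B (Suc 0)) (\<delta> (Suc 0)) j" "lookup (d 0 x) l0 = 0" for l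
  proof -
    have x: "x \<in> free_module V (B (Suc 0))" using that(1) by (rule free_component_free_module)
    then have "d 0 x = 0" using d0(1)[OF x] that(2) by simp
    then show ?thesis using d_kernel_minimal[of x 0] x by simp
  qed
qed

sublocale C1: minimal_cover "(*)" V I "B (Suc 0)" "\<delta> (Suc 0)" "\<lambda>x. lookup (d 0 x) l0"
  by (rule minimal_cover_I)

lemma d_0_eq_0_iff:
  assumes "x \<in> free_module V (B (Suc 0))"
  shows "d 0 x = 0 \<longleftrightarrow> lookup (d 0 x) l0 = 0"
proof -
  have "d 0 x \<in> free_module V (B 0)" using exact_0 assms by auto
  then obtain f where "d 0 x = single l0 f" using F_0_iff by blast
  then show ?thesis by (metis lookup_single_eq lookup_zero single_zero)
qed

text \<open>For this cover \<open>unit_vectors_basis\<close> counts the generators in homological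
  degree 2, and the connecting map of the preceding cover converts the count into Koszul homology of
  the ideal.\<close>

lemma minimal_cover_kernel: "minimal_cover scale V C1.kernel (B (Suc (Suc 0))) (\<delta> (Suc (Suc 0))) (d (Suc 0))"
proof unfold_locales
  fix j x y s l
  show "d (Suc 0) (x + y) = d (Suc 0) x + d (Suc 0) y"
    if "x \<in> free_module V (B (Suc (Suc 0)))" "y \<in> free_module V (B (Suc (Suc 0)))"
    using that d_add[of x "Suc 0" y] by simp
  show "d (Suc 0) (scale s x) = scale s (d (Suc 0) x)"
    if "s \<in> polys_in V" "x \<in> free_module V (B (Suc (Suc 0)))"
    using that d_scale[of s x "Suc 0"] by simp
  have ex: "d (Suc 0) ` free_module V (B (Suc (Suc 0))) = {x \<in> free_module V (B (Suc 0)). d 0 x = 0}"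
    using exact_Suc[of 0] by simp
  show "lookup (lookup x l) 0 = 0"
    if "x \<in> free_component V (B (Suc (Suc 0))) (\<delta> (Suc (Suc 0))) j" "d (Suc 0) x = 0"
    using that d_kernel_minimal[of x "Suc 0"] free_component_free_module by simp blast
  show "d (Suc 0) ` free_component V (B (Suc (Suc 0))) (\<delta> (Suc (Suc 0))) j = C1.kernel j"
  proof (intro equalityI subsetI)
    fix z assume "z \<in> d (Suc 0) ` free_component V (B (Suc (Suc 0))) (\<delta> (Suc (Suc 0))) j"
    then obtain x where x: "x \<in> free_component V (B (Suc (Suc 0))) (\<delta> (Suc (Suc 0))) j" "z = d (Suc 0) x" by blast
    have "z \<in> free_component V (B (Suc 0)) (\<delta> (Suc 0)) j" using d_graded[of "Suc 0" j] x by auto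
    moreover have "d 0 z = 0" using ex x free_component_free_module by blast
    ultimately show "z \<in> C1.kernel j" by (simp add: C1.kernel_def)
  next
    fix z assume "z \<in> C1.kernel j"
    then have z: "z \<in> free_component V (B (Suc 0)) (\<delta> (Suc 0)) j" "d 0 z = 0"
      using d_0_eq_0_iff[OF C1.FC_free[of z j]] unfolding C1.kernel_def by blast+
    then obtain x where x: "x \<in> free_module V (B (Suc (Suc 0)))" "z = d (Suc 0) x"
      using ex free_component_free_module by blast
    have "d (Suc 0) (free_part (\<delta> (Suc (Suc 0))) j x) = z"
      using kernel_free_part[of x "Suc 0" j] x free_part_id[OF z(1)] by simp
    then show "z \<in> d (Suc 0) ` free_component V (B (Suc (Suc 0))) (\<delta> (Suc (Suc 0))) j"
      using free_part_in_free_component[OF x(1)] by blast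
  qed
qed

sublocale C2: minimal_cover scale V C1.kernel "B (Suc (Suc 0))" "\<delta> (Suc (Suc 0))" "d (Suc 0)"
  by (rule minimal_cover_kernel)

lemma generators_basis:
  "\<exists>f. basis_mod (\<lambda>c. (*) (const c)) (irr_part V (*) I j) (I j) {l\<in>B (Suc 0). \<delta> (Suc 0) l = j} f"
  using C1.unit_vectors_basis by blast

lemma syzygies_basis:
  "\<exists>f. basis_mod (\<lambda>c a v. const c * a v) (koszul_boundaries V (*) I j) (koszul_cycles V (*) I j)
    {l\<in>B (Suc (Suc 0)). \<delta> (Suc (Suc 0)) l = Suc j} f"
  by (rule C1.koszul_cycles_basis[OF C2.unit_vectors_basis])

text \<open>The degrees in \<open>syzygies_basis\<close> are successors, so degree 0 is treated
  apart: coefficients of a syzygy of degree 0 are constants, and these vanish by minimality.\<close>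

lemma no_syzygies_degree_0: "{l\<in>B (Suc (Suc 0)). \<delta> (Suc (Suc 0)) l = 0} = {}"
proof -
  have "C1.kernel 0 \<subseteq> irr_part V scale C1.kernel 0"
  proof
    fix z assume z: "z \<in> C1.kernel 0"
    have "z = 0"
    proof (intro poly_mapping_eqI)
      fix l m
      show "lookup (lookup z l) m = lookup (lookup 0 l) m"
      proof (cases "m = 0")
        case True
        then show ?thesis using C1.D_ker[of z 0] z by (simp add: C1.kernel_def)
      next
        case False
        then show ?thesis
          using z free_component_lookup[of z V "B (Suc 0)" "\<delta> (Suc 0)" 0 m l] by (simp add: C1.kernel_def)
      qed
    qed
    then show "z \<in> irr_part V scale C1.kernel 0" using C1.Z.irr_part_zero by simp
  qed
  then show ?thesis
    using vector_space.basis_mod_empty_iff[OF C1.Z.vector_space C1.Z.subspace_irr_part C2.unit_vectors_basis[of 0]]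
    by simp
qed

end


text \<open>Passage from exactness in each degree to exactness of modules. The assumption
  \<open>part\<close> says that the kernel of \<open>E\<close> is graded, so that a kernel element
  can be lifted component by component.\<close>

lemma exact_from_degrees:
  fixes D :: "(nat \<Rightarrow>\<^sub>0 ('v, 'k::field) mpoly) \<Rightarrow> (nat \<Rightarrow>\<^sub>0 ('v, 'k) mpoly)" and E :: "(nat \<Rightarrow>\<^sub>0 ('v, 'k) mpoly) \<Rightarrow> 'n::ab_group_add"
  assumes cov: "minimal_cover scale V (\<lambda>j. {y \<in> free_component V B' \<delta>' j. E y = 0}) B \<delta> D"
    and add: "\<And>x y. x \<in> free_module V B' \<Longrightarrow> y \<in> free_module V B' \<Longrightarrow> E (x + y) = E x + E y"
    and part: "\<And>y j. y \<in> free_module V B' \<Longrightarrow> E y = 0 \<Longrightarrow> E (free_part \<delta>' j y) = 0"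
  shows "D ` free_module V B = {y \<in> free_module V B'. E y = 0}"
proof -
  interpret minimal_cover scale V "\<lambda>j. {y \<in> free_component V B' \<delta>' j. E y = 0}" B \<delta> D by (rule cov)
  have E0: "E 0 = 0" using add[of 0 0] by (simp add: free_module_zero)
  show ?thesis
  proof (intro equalityI subsetI)
    fix y assume "y \<in> D ` free_module V B"
    then obtain x where x: "x \<in> free_module V B" "y = D x" by blast
    obtain J where J: "finite J" "x = (\<Sum>j\<in>J. free_part \<delta> j x)" by (rule free_part_decomposition)
    have fp: "free_part \<delta> j x \<in> FC j" for j by (rule free_part_in_free_component[OF x(1)])
    then have Dx: "D (free_part \<delta> j x) \<in> free_module V B' \<and> E (D (free_part \<delta> j x)) = 0" for j
      using D_onto[of j] free_component_free_module by blast
    have "y = (\<Sum>j\<in>J. D (free_part \<delta> j x))"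
      unfolding x(2) by (subst J(2)) (rule D_sum, rule FC_free[OF fp])
    moreover have "(\<Sum>j\<in>J'. D (free_part \<delta> j x)) \<in> {y \<in> free_module V B'. E y = 0}" for J'
      by (induction J' rule: infinite_finite_induct)
        (auto simp: E0 add free_module_zero Dx intro: free_module_add)
    ultimately show "y \<in> {y \<in> free_module V B'. E y = 0}" by simp
  next
    fix y assume "y \<in> {y \<in> free_module V B'. E y = 0}"
    then have y: "y \<in> free_module V B'" "E y = 0" by auto
    obtain J where J: "finite J" "y = (\<Sum>j\<in>J. free_part \<delta>' j y)" by (rule free_part_decomposition)
    have "\<exists>x. x \<in> FC j \<and> D x = free_part \<delta>' j y" for j
    proof -
      have "free_part \<delta>' j y \<in> D ` FC j"
        unfolding D_onto using free_part_in_free_component[OF y(1), of \<delta>' j] part[OF y] by blast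
      then show ?thesis by auto
    qed
    then obtain x where x: "\<And>j. x j \<in> FC j" "\<And>j. D (x j) = free_part \<delta>' j y" by metis
    have "y = D (\<Sum>j\<in>J. x j)"
      using x by (subst J(2)) (subst D_sum, auto intro: FC_free)
    moreover have "(\<Sum>j\<in>J. x j) \<in> free_module V B" using x(1) by (intro free_module_sum FC_free)
    ultimately show "y \<in> D ` free_module V B" by blast
  qed
qed

text \<open>Finiteness of the generators in each degree is carried along because it makes the
  components of the next kernel finite-dimensional.\<close>

lemma minimal_cover_kernel_exists:
  assumes "minimal_cover scale V N B \<delta> (D :: (nat \<Rightarrow>\<^sub>0 ('v, 'k::field) mpoly) \<Rightarrow> (nat \<Rightarrow>\<^sub>0 ('v, 'k) mpoly))"
    and "\<And>j. finite {l\<in>B. \<delta> l = j}"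
  shows "\<exists>B' \<delta>' D'. minimal_cover scale V (\<lambda>j. {y \<in> free_component V B \<delta> j. D y = 0}) B' \<delta>' D' \<and>
    (\<forall>j. finite {l\<in>B'. \<delta>' l = j})"
proof -
  interpret minimal_cover scale V N B \<delta> D by (rule assms(1))
  have k: "kernel = (\<lambda>j. {y \<in> FC j. D y = 0})" by (rule ext) (simp add: kernel_def)
  have "finite_dim scale (kernel j)" for j
    by (rule finite_dim_subset[OF finite_dim_free_component[OF finite_V assms(2)]]) (auto simp: k)
  then show ?thesis using Z.minimal_cover_exists unfolding k by blast
qed

section \<open>Minimal resolutions exist; the first two Betti numbers\<close>

context graded_quotient
begin

text \<open>The ideal is embedded by \<open>single 0\<close> into the free module of rank one, so
  that all covers of the construction have the same type and can be iterated.\<close>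

lemma first_cover_exists:
  "\<exists>B \<delta> (D :: (nat \<Rightarrow>\<^sub>0 ('v, 'k) mpoly) \<Rightarrow> (nat \<Rightarrow>\<^sub>0 ('v, 'k) mpoly)).
    minimal_cover scale V (\<lambda>j. {y \<in> free_component V {0} (\<lambda>_. 0) j. \<phi> (lookup y 0) = 0}) B \<delta> D \<and>
    (\<forall>j. finite {l\<in>B. \<delta> l = j})"
proof -
  have "finite_dim (*) (I j)" for j
    by (rule finite_dim_subset[OF finite_dim_hom_polys[OF finite_V]]) (auto simp: I_def)
  then obtain B \<delta> D where D: "minimal_cover (*) V I B \<delta> D" and fin: "\<forall>j. finite {l\<in>B. \<delta> l = j}"
    using I.minimal_cover_exists by blast
  interpret minimal_cover "(*)" V I B \<delta> D by (rule D)
  have sets: "{y \<in> free_component V {0} (\<lambda>_. 0) j. \<phi> (lookup y 0) = 0} = single 0 ` I j" for j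
  proof (intro equalityI subsetI)
    fix y assume y: "y \<in> {y \<in> free_component V {0} (\<lambda>_. 0) j. \<phi> (lookup y 0) = 0}"
    have "y = single 0 (lookup y 0)"
    proof (rule poly_mapping_eqI)
      fix l
      have "l \<notin> keys y" if "l \<noteq> 0" using y that by (auto simp: free_component_iff)
      then show "lookup y l = lookup (single 0 (lookup y 0)) l"
        by (cases "l = 0") (auto simp: lookup_single when_def in_keys_iff)
    qed
    moreover have "lookup y 0 \<in> I j" using y by (simp add: free_component_iff I_def)
    ultimately show "y \<in> single 0 ` I j" by blast
  next
    fix y :: "nat \<Rightarrow>\<^sub>0 ('v, 'k) mpoly" assume "y \<in> single 0 ` I j"
    then show "y \<in> {y \<in> free_component V {0} (\<lambda>_. 0) j. \<phi> (lookup y 0) = 0}"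
      by (auto simp: I_def intro!: single_in_free_component)
  qed
  have sc: "scale s (single 0 f) = single 0 (s * f)" for s f :: "('v, 'k) mpoly"
    by (rule poly_mapping_eqI) (simp add: lookup_scale lookup_single when_def)
  have "minimal_cover scale V (\<lambda>j. single 0 ` I j) B \<delta> (\<lambda>x. single (0::nat) (D x))"
  proof (intro minimal_cover.intro graded_module.intro module_scale graded_module_axioms.intro minimal_cover_axioms.intro)
    show "finite V" by (rule finite_V)
    fix j c v s l and x y :: "nat \<Rightarrow>\<^sub>0 ('v, 'k) mpoly"
    show "0 \<in> single 0 ` I j" using I.N_zero[of j] by (metis image_eqI single_zero)
    show "x + y \<in> single 0 ` I j" if "x \<in> single 0 ` I j" "y \<in> single 0 ` I j"
      using that I.N_add by (auto simp flip: single_add)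
    show "scale (const c) x \<in> single 0 ` I j" if "x \<in> single 0 ` I j"
      using that I.N_const by (auto simp: sc)
    show "scale (indet v) x \<in> single 0 ` I (Suc j)" if "x \<in> single 0 ` I j" "v \<in> V"
      using that I.N_indet by (auto simp: sc)
    show "single 0 (D (x + y)) = single 0 (D x) + single 0 (D y)"
      if "x \<in> free_module V B" "y \<in> free_module V B"
      using that by (simp add: D_add single_add)
    show "single 0 (D (scale s x)) = scale s (single 0 (D x))"
      if "s \<in> polys_in V" "x \<in> free_module V B"
      using that by (simp add: D_scale sc)
    show "(\<lambda>x. single 0 (D x)) ` FC j = single 0 ` I j"
      unfolding D_onto[symmetric] by (simp add: image_image)
    show "lookup (lookup x l) 0 = 0" if "x \<in> FC j" "single 0 (D x) = 0"
      using that D_ker by (metis lookup_single_eq lookup_zero)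
  qed
  then show ?thesis unfolding sets using fin by blast
qed

lemma resolution_exists:
  "\<exists>B \<delta> d \<epsilon>. resolution B \<delta> d \<epsilon> \<and> (\<forall>i j. finite {l\<in>B (Suc i). \<delta> (Suc i) l = j})"
proof -
  obtain B1 \<delta>1 and D1 :: "(nat \<Rightarrow>\<^sub>0 ('v, 'k) mpoly) \<Rightarrow> (nat \<Rightarrow>\<^sub>0 ('v, 'k) mpoly)"
    where start: "minimal_cover scale V (\<lambda>j. {y \<in> free_component V {0} (\<lambda>_. 0) j. \<phi> (lookup y 0) = 0}) B1 \<delta>1 D1"
      "\<forall>j. finite {l\<in>B1. \<delta>1 l = j}"
    using first_cover_exists by blast
  \<comment> \<open>A state is a cover together with the finiteness that the next one requires. The
    covered module is hidden by a quantifier, because \<open>Q\<close> determines it as the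
    preceding kernel.\<close>
  define P where "P n st \<longleftrightarrow> (case st of (B, \<delta>, D) \<Rightarrow>
    (\<exists>N. minimal_cover scale V N B \<delta> (D :: (nat \<Rightarrow>\<^sub>0 ('v, 'k) mpoly) \<Rightarrow> (nat \<Rightarrow>\<^sub>0 ('v, 'k) mpoly))) \<and>
    (\<forall>j. finite {l\<in>B. \<delta> l = j}) \<and> (n = 0 \<longrightarrow> st = (B1, \<delta>1, D1)))" for n :: nat and st
  define Q where "Q st st' \<longleftrightarrow> (case (st, st') of ((B, \<delta>, D), (B', \<delta>', D')) \<Rightarrow>
    minimal_cover scale V (\<lambda>j. {y \<in> free_component V B \<delta> j. D y = 0}) B' \<delta>'
      (D' :: (nat \<Rightarrow>\<^sub>0 ('v, 'k) mpoly) \<Rightarrow> (nat \<Rightarrow>\<^sub>0 ('v, 'k) mpoly)))"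
    for st st' :: "nat set \<times> (nat \<Rightarrow> nat) \<times> ((nat \<Rightarrow>\<^sub>0 ('v, 'k) mpoly) \<Rightarrow> (nat \<Rightarrow>\<^sub>0 ('v, 'k) mpoly))"
  have "\<exists>st. P 0 st" unfolding P_def using start by (intro exI[of _ "(B1, \<delta>1, D1)"]) auto
  moreover have "\<exists>st'. P (Suc n) st' \<and> Q st st'" if Pst: "P n st" for n st
  proof -
    obtain B \<delta> D where st: "st = (B, \<delta>, D)" by (cases st)
    then obtain N where "minimal_cover scale V N B \<delta> D" "\<And>j. finite {l\<in>B. \<delta> l = j}"
      using Pst unfolding P_def by auto
    then obtain B' \<delta>' D' where "minimal_cover scale V (\<lambda>j. {y \<in> free_component V B \<delta> j. D y = 0}) B' \<delta>' D'"
      "\<forall>j. finite {l\<in>B'. \<delta>' l = j}"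
      using minimal_cover_kernel_exists by blast
    then show ?thesis unfolding P_def Q_def st by (intro exI[of _ "(B', \<delta>', D')"]) auto
  qed
  ultimately obtain st where st: "\<And>n. P n (st n)" "\<And>n. Q (st n) (st (Suc n))"
    using dependent_nat_choice[of P "\<lambda>_. Q"] by blast
  \<comment> \<open>Index shift: state \<open>i\<close> describes the free module in homological
    degree \<open>i + 1\<close>, while degree 0 is the ring itself.\<close>
  define B where "B i = (case i of 0 \<Rightarrow> {0} | Suc i \<Rightarrow> fst (st i))" for i
  define \<delta> where "\<delta> i = (case i of 0 \<Rightarrow> \<lambda>_. 0 | Suc i \<Rightarrow> fst (snd (st i)))" for i
  define d where "d i = snd (snd (st i))" for i
  define \<epsilon> where "\<epsilon> y = \<phi> (lookup y 0)" for y :: "nat \<Rightarrow>\<^sub>0 ('v, 'k) mpoly"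
  have st0: "st 0 = (B1, \<delta>1, D1)" using st(1)[of 0] by (simp add: P_def case_prod_unfold)
  have B0: "B 0 = {0}" "\<delta> 0 = (\<lambda>_. 0)" by (simp_all add: B_def \<delta>_def)
  have cov0: "minimal_cover scale V (\<lambda>j. {y \<in> free_component V (B 0) (\<delta> 0) j. \<epsilon> y = 0}) (B (Suc 0)) (\<delta> (Suc 0)) (d 0)"
    using start(1) by (simp add: B_def \<delta>_def d_def st0 \<epsilon>_def)
  have covS: "minimal_cover scale V (\<lambda>j. {y \<in> free_component V (B (Suc i)) (\<delta> (Suc i)) j. d i y = 0})
    (B (Suc (Suc i))) (\<delta> (Suc (Suc i))) (d (Suc i))" for i
    using st(2)[of i] by (simp add: Q_def case_prod_unfold B_def \<delta>_def d_def)
  have cov: "\<exists>N. minimal_cover scale V N (B (Suc i)) (\<delta> (Suc i)) (d i) \<and> (\<forall>j. N j \<subseteq> free_component V (B i) (\<delta> i) j)" for i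
  proof (cases i)
    case 0
    then show ?thesis using cov0 by blast
  next
    case (Suc n)
    then show ?thesis using covS[of n] by blast
  qed
  have d_add: "d i (x + y) = d i x + d i y"
    if "x \<in> free_module V (B (Suc i))" "y \<in> free_module V (B (Suc i))" for i x y
    using cov[of i] that minimal_cover.D_add by blast
  have d_scale: "d i (scale s x) = scale s (d i x)"
    if "s \<in> polys_in V" "x \<in> free_module V (B (Suc i))" for i s x
    using cov[of i] that minimal_cover.D_scale by blast
  have d_deg: "d i ` free_component V (B (Suc i)) (\<delta> (Suc i)) j \<subseteq> free_component V (B i) (\<delta> i) j" for i j
    using cov[of i] minimal_cover.D_onto by blast
  have \<epsilon>_part: "\<epsilon> (free_part (\<delta> 0) j y) = 0" if "y \<in> free_module V (B 0)" "\<epsilon> y = 0" for j y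
  proof -
    have "lookup (free_part (\<delta> 0) j y) 0 = hom_part j (lookup y 0)"
      by (rule poly_mapping_eqI) (simp add: lookup_free_part lookup_hom_part B0)
    then show ?thesis using that \<phi>_graded[of "lookup y 0" j] by (simp add: \<epsilon>_def free_module_def)
  qed
  have ex0: "d 0 ` free_module V (B (Suc 0)) = {y \<in> free_module V (B 0). \<epsilon> y = 0}"
    by (rule exact_from_degrees[OF cov0]) (auto simp: \<epsilon>_def lookup_add \<phi>_add, auto intro: \<epsilon>_part simp flip: \<epsilon>_def)
  have d_part: "d i (free_part (\<delta> (Suc i)) j y) = 0"
    if "y \<in> free_module V (B (Suc i))" "d i y = 0" for i j y
  proof -
    have "d i (free_part (\<delta> (Suc i)) j y) = free_part (\<delta> i) j (d i y)"
      by (rule graded_map_free_part[of V "B (Suc i)" "d i" "\<delta> (Suc i)" "B i" "\<delta> i" y j])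
        (use d_add d_deg that in auto)
    then show ?thesis by (simp add: that(2) free_part_def)
  qed
  have exS: "d (Suc i) ` free_module V (B (Suc (Suc i))) = {y \<in> free_module V (B (Suc i)). d i y = 0}" for i
    by (rule exact_from_degrees[OF covS]) (use d_add d_part in auto)
  have min: "d i ` free_module V (B (Suc i)) \<subseteq> max_submodule V (B i)" for i
  proof
    fix y assume y: "y \<in> d i ` free_module V (B (Suc i))"
    have yF: "y \<in> free_module V (B i)" using y ex0 exS by (cases i) auto
    have "lookup (lookup y l) 0 = 0" for l
    proof (cases i)
      case 0
      then have "\<epsilon> y = 0" "y \<in> free_module V (B 0)" using y ex0 by auto
      then have "hom_part 0 (lookup y 0) \<in> I 0"
        using \<phi>_graded[of "lookup y 0" 0] hom_part_in_hom_polys[of "lookup y 0" V 0]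
        by (simp add: I_def \<epsilon>_def free_module_def)
      then have "lookup (hom_part 0 (lookup y 0)) 0 = 0" by (rule I_const)
      moreover have "lookup y l = 0" if "l \<noteq> 0"
        using that yF 0 by (auto simp: free_module_def B0 in_keys_iff)
      ultimately show ?thesis by (cases "l = 0") (simp_all add: lookup_hom_part)
    next
      case (Suc n)
      \<comment> \<open>The constant term of entry \<open>l\<close> lives in degree
        \<open>\<delta> i l\<close>, so minimality of the cover is applied to that
        component.\<close>
      then have "d n (free_part (\<delta> i) (\<delta> i l) y) = 0" using d_part[of y n] y exS[of n] by auto
      then have "lookup (lookup (free_part (\<delta> i) (\<delta> i l) y) l) 0 = 0"
        using minimal_cover.D_ker cov[of n] free_part_in_free_component[OF yF] Suc by blast
      then show ?thesis by (simp add: lookup_free_part)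
    qed
    then show "y \<in> max_submodule V (B i)" using yF by (simp add: max_submodule_def)
  qed
  have "resolution B \<delta> d \<epsilon>"
    unfolding minimal_graded_free_resolution_def Let_def
  proof (intro conjI allI ballI)
    show "\<epsilon> (x + y) = \<epsilon> x + \<epsilon> y" for x y by (simp add: \<epsilon>_def lookup_add \<phi>_add)
    show "\<epsilon> (scale s x) = \<phi> s * \<epsilon> x" for s x by (simp add: \<epsilon>_def lookup_scale \<phi>_mult)
    show "\<epsilon> ` free_component V (B 0) (\<delta> 0) j \<subseteq> \<phi> ` hom_polys V j" for j
      by (auto simp: \<epsilon>_def free_component_iff B0)
    show "\<epsilon> ` free_module V (B 0) = \<phi> ` polys_in V"
    proof (intro equalityI subsetI)
      fix a assume "a \<in> \<phi> ` polys_in V"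
      then obtain f where f: "f \<in> polys_in V" "a = \<epsilon> (single 0 f)" by (auto simp: \<epsilon>_def)
      moreover have "single 0 f \<in> free_module V (B 0)"
        using f(1) by (auto simp: free_module_def B0 lookup_single when_def split: if_splits)
      ultimately show "a \<in> \<epsilon> ` free_module V (B 0)" by blast
    qed (auto simp: \<epsilon>_def free_module_def)
  qed (rule d_add d_scale d_deg ex0 exS min; assumption)+
  moreover have "finite {l\<in>B (Suc i). \<delta> (Suc i) l = j}" for i j
    using st(1)[of i] by (simp add: P_def case_prod_unfold B_def \<delta>_def)
  ultimately show ?thesis by blast
qed

lemma betti_unique:
  assumes res: "resolution B \<delta> d \<epsilon>"
    and uniq: "\<And>B' \<delta>' d' \<epsilon>'. resolution B' \<delta>' d' \<epsilon>' \<Longrightarrow> card {l\<in>B' i. \<delta>' i l = j} = card {l\<in>B i. \<delta> i l = j}"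
  shows "betti i j = card {l\<in>B i. \<delta> i l = j}"
  unfolding graded_betti_def by (rule the_equality) (use res uniq in blast)+

text \<open>All resolutions give bases of the same quotient, which settles uniqueness. Finiteness
  matters: \<open>card\<close> is 0 on infinite sets, and only with \<open>fin\<close> does the
  value 0 mean that there are no generators.\<close>

lemma betti_1_eq_0_iff: "betti (Suc 0) j = 0 \<longleftrightarrow> I j \<subseteq> irr_part V (*) I j"
proof -
  obtain B \<delta> d \<epsilon> where r: "resolution B \<delta> d \<epsilon>" and fin: "finite {l\<in>B (Suc 0). \<delta> (Suc 0) l = j}"
    using resolution_exists by blast
  have R: "graded_quotient_resolution V \<phi> B' \<delta>' d' \<epsilon>'" if "resolution B' \<delta>' d' \<epsilon>'" for B' \<delta>' d' \<epsilon>'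
    by unfold_locales (rule that)
  note vs = I.vector_space I.subspace_irr_part
  obtain f where f: "basis_mod (\<lambda>c. (*) (const c)) (irr_part V (*) I j) (I j) {l\<in>B (Suc 0). \<delta> (Suc 0) l = j} f"
    using graded_quotient_resolution.generators_basis[OF R[OF r]] by blast
  have "betti (Suc 0) j = card {l\<in>B (Suc 0). \<delta> (Suc 0) l = j}"
  proof (rule betti_unique[OF r])
    fix B' \<delta>' d' \<epsilon>' assume "resolution B' \<delta>' d' \<epsilon>'"
    then obtain f' where "basis_mod (\<lambda>c. (*) (const c)) (irr_part V (*) I j) (I j) {l\<in>B' (Suc 0). \<delta>' (Suc 0) l = j} f'"
      using graded_quotient_resolution.generators_basis[OF R] by blast
    then show "card {l\<in>B' (Suc 0). \<delta>' (Suc 0) l = j} = card {l\<in>B (Suc 0). \<delta> (Suc 0) l = j}"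
      using vector_space.basis_mod_card_unique[OF vs _ f fin] by blast
  qed
  then show ?thesis
    using fin vector_space.basis_mod_empty_iff[OF vs f] by simp
qed

text \<open>A syzygy of degree \<open>Suc j\<close> corresponds to a Koszul cycle with coefficients
  of degree \<open>j\<close>; the argument is then that for generators.\<close>

lemma betti_2_Suc_eq_0_iff:
  "betti (Suc (Suc 0)) (Suc j) = 0 \<longleftrightarrow> koszul_cycles V (*) I j \<subseteq> koszul_boundaries V (*) I j"
proof -
  let ?A = "\<lambda>B \<delta>. {l\<in>B (Suc (Suc 0)). \<delta> (Suc (Suc 0)) l = Suc j} :: nat set"
  obtain B \<delta> d \<epsilon> where r: "resolution B \<delta> d \<epsilon>" and fin: "finite (?A B \<delta>)"
    using resolution_exists by blast
  have R: "graded_quotient_resolution V \<phi> B' \<delta>' d' \<epsilon>'" if "resolution B' \<delta>' d' \<epsilon>'" for B' \<delta>' d' \<epsilon>'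
    by unfold_locales (rule that)
  note vs = I.vector_space_pointwise I.subspace_koszul_boundaries
  obtain f where f: "basis_mod (\<lambda>c a v. const c * a v) (koszul_boundaries V (*) I j) (koszul_cycles V (*) I j) (?A B \<delta>) f"
    using graded_quotient_resolution.syzygies_basis[OF R[OF r]] by blast
  have "betti (Suc (Suc 0)) (Suc j) = card (?A B \<delta>)"
  proof (rule betti_unique[OF r])
    fix B' \<delta>' d' \<epsilon>' assume "resolution B' \<delta>' d' \<epsilon>'"
    then obtain f' where "basis_mod (\<lambda>c a v. const c * a v) (koszul_boundaries V (*) I j) (koszul_cycles V (*) I j) (?A B' \<delta>') f'"
      using graded_quotient_resolution.syzygies_basis[OF R] by blast
    then show "card (?A B' \<delta>') = card (?A B \<delta>)"
      using vector_space.basis_mod_card_unique[OF vs _ f fin] by blast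
  qed
  then show ?thesis
    using fin vector_space.basis_mod_empty_iff[OF vs f] by simp
qed

lemma betti_2_degree_0: "betti (Suc (Suc 0)) 0 = 0"
proof -
  obtain B \<delta> d \<epsilon> where r: "resolution B \<delta> d \<epsilon>"
    using resolution_exists by blast
  have R: "graded_quotient_resolution V \<phi> B' \<delta>' d' \<epsilon>'" if "resolution B' \<delta>' d' \<epsilon>'" for B' \<delta>' d' \<epsilon>'
    by unfold_locales (rule that)
  have c0: "{l\<in>B' (Suc (Suc 0)). \<delta>' (Suc (Suc 0)) l = 0} = {}" if "resolution B' \<delta>' d' \<epsilon>'" for B' \<delta>' d' \<epsilon>'
    by (rule graded_quotient_resolution.no_syzygies_degree_0[OF R[OF that]])
  have "betti (Suc (Suc 0)) 0 = card {l\<in>B (Suc (Suc 0)). \<delta> (Suc (Suc 0)) l = 0}"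
    by (rule betti_unique[OF r]) (simp only: c0[OF r] c0)
  then show ?thesis by (simp only: c0[OF r] card.empty)
qed

end

section \<open>Substitution homomorphisms\<close>

definition eval_monomial :: "('v \<Rightarrow> 'm::comm_monoid_mult) \<Rightarrow> ('v \<Rightarrow>\<^sub>0 nat) \<Rightarrow> 'm" where
  "eval_monomial u m = (\<Prod>v\<in>keys m. u v ^ lookup m v)"

lemma eval_monomial_superset:
  "finite A \<Longrightarrow> keys m \<subseteq> A \<Longrightarrow> eval_monomial u m = (\<Prod>v\<in>A. u v ^ lookup m v)"
  unfolding eval_monomial_def by (rule prod.mono_neutral_left) (auto simp: in_keys_iff)

lemma eval_monomial_add: "eval_monomial u (m + n) = eval_monomial u m * eval_monomial u n"
proof -
  have "keys (m + n) \<subseteq> keys m \<union> keys n" by (rule Poly_Mapping.keys_add)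
  then show ?thesis
    using eval_monomial_superset[of "keys m \<union> keys n" m u] eval_monomial_superset[of "keys m \<union> keys n" n u]
      eval_monomial_superset[of "keys m \<union> keys n" "m + n" u]
    by (simp add: lookup_add power_add prod.distrib)
qed

lemma eval_monomial_0 [simp]: "eval_monomial u 0 = 1"
  by (simp add: eval_monomial_def)

lemma eval_monomial_single: "eval_monomial u (single v k) = u v ^ k"
  by (cases "k = 0") (simp_all add: eval_monomial_def)

lemma eval_monomial_cong: "(\<And>v. v \<in> keys m \<Longrightarrow> u v = w v) \<Longrightarrow> eval_monomial u m = eval_monomial w m"
  unfolding eval_monomial_def by (rule prod.cong) auto

lemma subst_eval: "subst u f = (\<Sum>m\<in>keys f. const (lookup f m) * eval_monomial u m)"
  by (simp add: subst_def eval_monomial_def)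

lemma subst_superset:
  "finite A \<Longrightarrow> keys f \<subseteq> A \<Longrightarrow> subst u f = (\<Sum>m\<in>A. const (lookup f m) * eval_monomial u m)"
  unfolding subst_eval by (rule sum.mono_neutral_left) (auto simp: in_keys_iff)

lemma subst_add: "subst u (f + g) = subst u f + subst u g"
proof -
  have "keys (f + g) \<subseteq> keys f \<union> keys g" by (rule Poly_Mapping.keys_add)
  then show ?thesis
    using subst_superset[of "keys f \<union> keys g" f u] subst_superset[of "keys f \<union> keys g" g u]
      subst_superset[of "keys f \<union> keys g" "f + g" u]
    by (simp add: lookup_add const_add[symmetric] distrib_right sum.distrib)
qed

lemma subst_zero [simp]: "subst u 0 = 0"
  by (simp add: subst_def)

lemma subst_sum: "subst u (sum f A) = (\<Sum>i\<in>A. subst u (f i))"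
  by (induction A rule: infinite_finite_induct) (auto simp: subst_add)

lemma subst_single: "subst u (single m c) = const c * eval_monomial u m"
  by (cases "c = 0") (simp_all add: subst_eval)

lemma subst_const [simp]: "subst u (const c) = const c"
  by (simp add: const_def subst_single)

lemma subst_one [simp]: "subst u 1 = 1"
  using subst_const[of u 1] by simp

lemma subst_indet [simp]: "subst u (indet v) = u v"
  by (simp add: indet_def subst_single eval_monomial_single)

lemma subst_mult: "subst u (f * g) = subst u f * subst u g"
proof -
  have "f * g = (\<Sum>m\<in>keys f. \<Sum>n\<in>keys g. single (m + n) (lookup f m * lookup g n))"
    by (subst (1) poly_mapping_sum_single[of f], subst (1) poly_mapping_sum_single[of g])
      (simp add: sum_product mult_single)
  then have "subst u (f * g) = (\<Sum>m\<in>keys f. \<Sum>n\<in>keys g.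
      const (lookup f m * lookup g n) * (eval_monomial u m * eval_monomial u n))"
    by (simp add: subst_sum subst_single eval_monomial_add)
  also have "\<dots> = subst u f * subst u g"
    unfolding subst_eval sum_product
    by (intro sum.cong refl) (simp add: const_mult[symmetric] mult_ac)
  finally show ?thesis .
qed

lemma subst_uminus: "subst u (- f) = - subst u f"
  using subst_add[of u f "- f"] by (simp add: eq_neg_iff_add_eq_0 add.commute)

lemma subst_diff: "subst u (f - g) = subst u f - subst u g"
  using subst_add[of u f "- g"] by (simp add: subst_uminus)

lemma subst_power: "subst u (f ^ n) = subst u f ^ n"
  by (induction n) (simp_all add: subst_mult)

lemma subst_eval_monomial: "subst w (eval_monomial u m) = eval_monomial (\<lambda>v. subst w (u v)) m"
proof -
  have "subst w (\<Prod>v\<in>A. u v ^ lookup m v) = (\<Prod>v\<in>A. subst w (u v) ^ lookup m v)" for A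
    by (induction A rule: infinite_finite_induct) (auto simp: subst_mult subst_power)
  then show ?thesis by (simp add: eval_monomial_def)
qed

lemma subst_subst: "subst w (subst u f) = subst (\<lambda>v. subst w (u v)) f"
  by (simp add: subst_eval[of u] subst_eval[of "\<lambda>v. subst w (u v)"] subst_sum subst_mult subst_eval_monomial)

lemma subst_cong:
  "f \<in> polys_in V \<Longrightarrow> (\<And>v. v \<in> V \<Longrightarrow> u v = w v) \<Longrightarrow> subst u f = subst w f"
  unfolding subst_eval
  by (intro sum.cong refl arg_cong2[of _ _ _ _ "(*)"] eval_monomial_cong) (auto simp: polys_in_def)

lemma eval_monomial_hom:
  fixes u :: "'v \<Rightarrow> ('w, 'k::comm_ring_1) mpoly"
  assumes "\<And>v. v \<in> keys m \<Longrightarrow> u v \<in> hom_polys W 1"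
  shows "eval_monomial u m \<in> hom_polys W (total_deg m)"
proof -
  have one: "(1 :: ('w, 'k) mpoly) \<in> hom_polys W 0"
    by (simp add: hom_polys_const flip: const_1)
  have pow: "u v ^ k \<in> hom_polys W k" if "v \<in> keys m" for v k
    by (induction k) (use one hom_polys_mult[OF assms[OF that]] in auto)
  have "(\<Prod>v\<in>A. u v ^ lookup m v) \<in> hom_polys W (\<Sum>v\<in>A. lookup m v)" if "A \<subseteq> keys m" for A
    using that by (induction A rule: infinite_finite_induct) (auto intro: one hom_polys_mult pow)
  then show ?thesis by (simp add: eval_monomial_def total_deg_def)
qed

lemma subst_hom_polys:
  fixes u :: "'v \<Rightarrow> ('w, 'k::comm_ring_1) mpoly"
  assumes "\<And>v. v \<in> V \<Longrightarrow> u v \<in> hom_polys W 1" "f \<in> hom_polys V j"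
  shows "subst u f \<in> hom_polys W j"
  unfolding subst_eval
proof (intro hom_polys_sum hom_polys_const_mult)
  fix m assume m: "m \<in> keys f"
  then have "total_deg m = j" "keys m \<subseteq> V" using assms(2) by (auto simp: hom_polys_def polys_in_def)
  then show "eval_monomial u m \<in> hom_polys W j"
    using eval_monomial_hom[of m u W] assms(1) by blast
qed

lemma subst_indets_id: "subst indet f = (f :: ('v, 'k::comm_ring_1) mpoly)"
proof -
  have pw: "indet v ^ k = (single (single v k) 1 :: ('v, 'k) mpoly)" for v k
    by (induction k) (simp_all add: indet_def mult_single single_add[symmetric])
  have "eval_monomial indet m = (single m 1 :: ('v, 'k) mpoly)" for m
  proof -
    have "(\<Prod>v\<in>A. indet v ^ lookup m v) = (single (\<Sum>v\<in>A. single v (lookup m v)) 1 :: ('v, 'k) mpoly)" for A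
      by (induction A rule: infinite_finite_induct) (simp_all add: pw mult_single)
    then show ?thesis by (simp add: eval_monomial_def flip: poly_mapping_sum_single)
  qed
  then show ?thesis using poly_mapping_sum_single[of f] by (simp add: subst_eval const_def mult_single)
qed

section \<open>Retracts\<close>

text \<open>The assumptions make the second quotient an algebra retract of the first.\<close>

locale graded_retract = A: graded_quotient V \<phi> + A': graded_quotient V' \<phi>'
  for V :: "'v set" and \<phi> :: "('v, 'k::field) mpoly \<Rightarrow> 'm::comm_ring_1"
  and V' :: "'w set" and \<phi>' :: "('w, 'k) mpoly \<Rightarrow> 'n::comm_ring_1" +
  fixes \<sigma> :: "'w \<Rightarrow> 'v" and \<tau> :: "'v \<Rightarrow> 'w"
  assumes \<sigma>: "v' \<in> V' \<Longrightarrow> \<sigma> v' \<in> V" and \<tau>: "v \<in> V \<Longrightarrow> \<tau> v \<in> V'" and \<tau>\<sigma>: "v' \<in> V' \<Longrightarrow> \<tau> (\<sigma> v') = v'"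
    and \<iota>_ker: "f' \<in> polys_in V' \<Longrightarrow> \<phi>' f' = 0 \<Longrightarrow> \<phi> (subst (\<lambda>v. indet (\<sigma> v)) f') = 0"
    and \<rho>_ker: "f \<in> polys_in V \<Longrightarrow> \<phi> f = 0 \<Longrightarrow> \<phi>' (subst (\<lambda>v. indet (\<tau> v)) f) = 0"
begin

definition \<iota> :: "('w, 'k) mpoly \<Rightarrow> ('v, 'k) mpoly" where "\<iota> = subst (\<lambda>v. indet (\<sigma> v))"

definition \<rho> :: "('v, 'k) mpoly \<Rightarrow> ('w, 'k) mpoly" where "\<rho> = subst (\<lambda>v. indet (\<tau> v))"

lemma \<iota>_I: "f \<in> A'.I j \<Longrightarrow> \<iota> f \<in> A.I j"
  unfolding A.I_def A'.I_def \<iota>_def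
  using subst_hom_polys[of V' "\<lambda>v. indet (\<sigma> v)" V f j] hom_polys_indet[OF \<sigma>] \<iota>_ker hom_polys_polys_in[of f V' j] by auto

lemma \<rho>_I: "f \<in> A.I j \<Longrightarrow> \<rho> f \<in> A'.I j"
  unfolding A.I_def A'.I_def \<rho>_def
  using subst_hom_polys[of V "\<lambda>v. indet (\<tau> v)" V' f j] hom_polys_indet[OF \<tau>] \<rho>_ker hom_polys_polys_in[of f V j] by auto

lemma \<rho>_prev_I: "f \<in> prev A.I j \<Longrightarrow> \<rho> f \<in> prev A'.I j"
  using \<rho>_I by (cases j) (auto simp: shift_def \<rho>_def)

lemma \<rho>\<iota>: "f \<in> polys_in V' \<Longrightarrow> \<rho> (\<iota> f) = f"
proof -
  assume "f \<in> polys_in V'"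
  then have "subst (\<lambda>v. subst (\<lambda>v. indet (\<tau> v)) (indet (\<sigma> v))) f = subst indet f"
    by (rule subst_cong) (simp add: \<tau>\<sigma>)
  then show ?thesis by (simp add: \<rho>_def \<iota>_def subst_subst subst_indets_id)
qed

lemma I_polys: "f \<in> A'.I j \<Longrightarrow> f \<in> polys_in V'"
  using hom_polys_polys_in[of f V' j] by (simp add: A'.I_def)

text \<open>\<open>\<tau>\<close> may identify variables, so the coefficients of all variables with
  the same image are collected.\<close>

lemma sum_fibers:
  "(\<Sum>v\<in>V. indet (\<tau> v) * n v) = (\<Sum>v'\<in>V'. indet v' * (\<Sum>v\<in>{v\<in>V. \<tau> v = v'}. (n v :: ('w, 'k) mpoly)))"
proof -
  have "(\<Sum>v'\<in>V'. indet v' * (\<Sum>v\<in>{v\<in>V. \<tau> v = v'}. n v)) = (\<Sum>v'\<in>V'. \<Sum>v\<in>{v\<in>V. \<tau> v = v'}. indet (\<tau> v) * n v)"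
    unfolding sum_distrib_left by (intro sum.cong) auto
  also have "\<dots> = (\<Sum>v\<in>V. indet (\<tau> v) * n v)"
    by (rule sum.group) (use A.finite_V A'.finite_V \<tau> in auto)
  finally show ?thesis ..
qed

text \<open>A decomposition of \<open>\<iota> f\<close> over the larger ring is mapped back by
  \<open>\<rho>\<close>, and \<open>\<rho> (\<iota> f)\<close> is \<open>f\<close>.\<close>

lemma irr_part_retract:
  assumes "A.I j \<subseteq> irr_part V (*) A.I j"
  shows "A'.I j \<subseteq> irr_part V' (*) A'.I j"
proof
  fix f assume f: "f \<in> A'.I j"
  interpret P': graded_module "(*)" V' "prev A'.I" by (rule A'.I.graded_module_shift)
  obtain n where n: "\<And>v. v \<in> V \<Longrightarrow> n v \<in> prev A.I j" "\<iota> f = (\<Sum>v\<in>V. indet v * n v)"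
    using assms \<iota>_I[OF f] unfolding irr_part_def by blast
  have "f = \<rho> (\<Sum>v\<in>V. indet v * n v)" using \<rho>\<iota>[OF I_polys[OF f]] n(2) by simp
  also have "\<dots> = (\<Sum>v\<in>V. indet (\<tau> v) * \<rho> (n v))" by (simp add: \<rho>_def subst_sum subst_mult)
  also have "\<dots> = (\<Sum>v'\<in>V'. indet v' * (\<Sum>v\<in>{v\<in>V. \<tau> v = v'}. \<rho> (n v)))" by (rule sum_fibers)
  finally show "f \<in> irr_part V' (*) A'.I j"
    unfolding irr_part_def using n(1)
    by (intro CollectI exI[of _ "\<lambda>v'. \<Sum>v\<in>{v\<in>V. \<tau> v = v'}. \<rho> (n v)"] conjI) (auto intro!: P'.N_sum \<rho>_prev_I)
qed

text \<open>Functoriality of Koszul homology: a cycle is transported along \<open>\<sigma>\<close>,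
  filled over the larger ring, and the filling is pushed forward along
  \<open>\<tau>\<close>.\<close>

lemma koszul_retract:
  assumes "koszul_cycles V (*) A.I j \<subseteq> koszul_boundaries V (*) A.I j"
  shows "koszul_cycles V' (*) A'.I j \<subseteq> koszul_boundaries V' (*) A'.I j"
proof
  fix a' assume a': "a' \<in> koszul_cycles V' (*) A'.I j"
  interpret P': graded_module "(*)" V' "prev A'.I" by (rule A'.I.graded_module_shift)
  have a'I: "a' v' \<in> A'.I j" if "v' \<in> V'" for v' using a' that by (simp add: koszul_cycles_def)
  \<comment> \<open>Only variables in the image of \<open>\<sigma>\<close> carry a coefficient; all
    others get 0.\<close>
  define a where "a v = (if v \<in> \<sigma> ` V' then \<iota> (a' (\<tau> v)) else 0)" for v
  have inj: "inj_on \<sigma> V'" using \<tau>\<sigma> by (metis inj_onI)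
  have "(\<Sum>v\<in>V. indet v * a v) = (\<Sum>v\<in>\<sigma> ` V'. indet v * \<iota> (a' (\<tau> v)))"
    by (rule sum.mono_neutral_cong_right) (use A.finite_V \<sigma> in \<open>auto simp: a_def\<close>)
  also have "\<dots> = \<iota> (\<Sum>v'\<in>V'. indet v' * a' v')"
    unfolding sum.reindex[OF inj] by (auto simp: \<iota>_def subst_sum subst_mult \<tau>\<sigma> intro!: sum.cong)
  also have "\<dots> = 0" using a' by (simp add: koszul_cycles_def \<iota>_def)
  finally have "(\<Sum>v\<in>V. indet v * a v) = 0" .
  moreover have "a v \<in> A.I j" if "v \<in> V" for v
    using that \<tau> a'I \<iota>_I by (auto simp: a_def A.I.N_zero)
  ultimately have "a \<in> koszul_boundaries V (*) A.I j"
    using assms unfolding koszul_cycles_def by blast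
  then obtain c where c: "alternating V c" "\<And>v w. v \<in> V \<Longrightarrow> w \<in> V \<Longrightarrow> c v w \<in> prev A.I j"
    "\<And>v. v \<in> V \<Longrightarrow> a v = (\<Sum>w\<in>V. indet w * c v w)"
    unfolding koszul_boundaries_def by blast
  define F where "F v' = {v\<in>V. \<tau> v = v'}" for v'
  define c' where "c' v' w' = (\<Sum>v\<in>F v'. \<Sum>w\<in>F w'. \<rho> (c v w))" for v' w'
  have "alternating V' c'"
    unfolding alternating_def
  proof (intro conjI ballI)
    fix v' w'
    have alt: "alternating (F v') (\<lambda>v w. \<rho> (c v w))"
      unfolding alternating_def
    proof (intro conjI ballI)
      fix v w assume vw: "v \<in> F v'" "w \<in> F v'"
      show "\<rho> (c v v) = 0" using alternating_diag[OF c(1), of v] vw by (simp add: F_def \<rho>_def)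
      have "c w v = - c v w" using vw by (intro alternating_swap[OF c(1)]) (auto simp: F_def)
      then show "\<rho> (c w v) = - \<rho> (c v w)" by (simp add: \<rho>_def subst_uminus)
    qed
    have fin: "finite (F v')" using A.finite_V by (simp add: F_def)
    \<comment> \<open>The sign rule alone would only show that twice this sum vanishes; the identity
      for alternating families with all weights 1 gives the claim in every characteristic.\<close>
    show "c' v' v' = 0" unfolding c'_def using A'.I.alternating_sum_zero[OF fin alt, of "\<lambda>_. 1"] by simp
    have "\<rho> (c w v) = - \<rho> (c v w)" if "v \<in> F v'" "w \<in> F w'" for v w
    proof -
      have "c w v = - c v w" using that by (intro alternating_swap[OF c(1)]) (auto simp: F_def)
      then show ?thesis by (simp add: \<rho>_def subst_uminus)
    qed
    then show "c' w' v' = - c' v' w'"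
      unfolding c'_def sum_negf[symmetric] by (subst sum.swap) (auto intro!: sum.cong simp: sum_negf)
  qed
  moreover have "c' v' w' \<in> prev A'.I j" if "v' \<in> V'" "w' \<in> V'" for v' w'
    unfolding c'_def using c(2) by (intro P'.N_sum \<rho>_prev_I) (auto simp: F_def)
  moreover have "a' v' = (\<Sum>w'\<in>V'. indet w' * c' v' w')" if v': "v' \<in> V'" for v'
  proof -
    \<comment> \<open>In the fibre over \<open>v'\<close> only the chosen point
      \<open>\<sigma> v'\<close> carries a coefficient of the transported cycle.\<close>
    have "(\<Sum>v\<in>F v'. \<rho> (a v)) = (\<Sum>v\<in>{\<sigma> v'}. \<rho> (a v))"
    proof (rule sum.mono_neutral_right)
      show "finite (F v')" using A.finite_V by (simp add: F_def)
      show "{\<sigma> v'} \<subseteq> F v'" using v' \<sigma> \<tau>\<sigma> by (simp add: F_def)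
      show "\<forall>v\<in>F v' - {\<sigma> v'}. \<rho> (a v) = 0"
        using \<tau>\<sigma> by (auto simp: F_def a_def \<rho>_def)
    qed
    also have "\<dots> = a' v'" using v' \<rho>\<iota>[OF I_polys[OF a'I[OF v']]] by (simp add: a_def \<tau>\<sigma>)
    finally have "a' v' = (\<Sum>v\<in>F v'. \<rho> (a v))" ..
    also have "\<dots> = (\<Sum>v\<in>F v'. \<Sum>w\<in>V. indet (\<tau> w) * \<rho> (c v w))"
      by (intro sum.cong) (auto simp: F_def c(3) \<rho>_def subst_sum subst_mult)
    also have "\<dots> = (\<Sum>v\<in>F v'. \<Sum>w'\<in>V'. indet w' * (\<Sum>w\<in>F w'. \<rho> (c v w)))"
      unfolding F_def by (simp only: sum_fibers)
    also have "\<dots> = (\<Sum>w'\<in>V'. indet w' * c' v' w')"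
      unfolding c'_def sum_distrib_left by (rule sum.swap)
    finally show ?thesis .
  qed
  ultimately show "a' \<in> koszul_boundaries V' (*) A'.I j" unfolding koszul_boundaries_def by blast
qed

end

section \<open>Hibi rings as graded quotients\<close>

definition hibi_exponent :: "'a set \<Rightarrow> 'a option \<Rightarrow>\<^sub>0 nat" where
  "hibi_exponent \<alpha> = single None 1 + (\<Sum>p\<in>\<alpha>. single (Some p) 1)"

lemma hibi_monomial_single: "hibi_monomial \<alpha> = single (hibi_exponent \<alpha>) 1"
  by (simp add: hibi_monomial_def hibi_exponent_def)

lemma lookup_hibi_exponent_None [simp]: "lookup (hibi_exponent \<alpha>) None = 1"
  by (simp add: hibi_exponent_def lookup_add lookup_sum lookup_single)

lemma lookup_hibi_exponent_Some:
  "finite \<alpha> \<Longrightarrow> lookup (hibi_exponent \<alpha>) (Some p) = (if p \<in> \<alpha> then 1 else 0)"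
  by (simp add: hibi_exponent_def lookup_add lookup_sum lookup_single when_def)

abbreviation hibi_map :: "('a set, 'k::field) mpoly \<Rightarrow> ('a option, 'k) mpoly" where
  "hibi_map \<equiv> subst hibi_monomial"

text \<open>The presentation is a monomial map, and this is its effect on exponents. The inner sum
  is an integer multiple, written as a repeated sum.\<close>

definition exponent_map :: "('a set \<Rightarrow>\<^sub>0 nat) \<Rightarrow> 'a option \<Rightarrow>\<^sub>0 nat" where
  "exponent_map m = (\<Sum>\<alpha>\<in>keys m. \<Sum>i<lookup m \<alpha>. hibi_exponent \<alpha>)"

lemma eval_monomial_hibi: "eval_monomial hibi_monomial m = (single (exponent_map m) 1 :: ('a option, 'k::field) mpoly)"
proof -
  have pw: "hibi_monomial \<alpha> ^ n = (single (\<Sum>i<n. hibi_exponent \<alpha>) 1 :: ('a option, 'k) mpoly)" for \<alpha> n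
    by (induction n) (simp_all add: hibi_monomial_single mult_single add.commute)
  have "(\<Prod>\<alpha>\<in>A. hibi_monomial \<alpha> ^ lookup m \<alpha>)
      = (single (\<Sum>\<alpha>\<in>A. \<Sum>i<lookup m \<alpha>. hibi_exponent \<alpha>) 1 :: ('a option, 'k) mpoly)" for A
    by (induction A rule: infinite_finite_induct) (simp_all add: pw mult_single)
  then show ?thesis by (simp add: eval_monomial_def exponent_map_def)
qed

lemma exponent_map_add: "exponent_map (m + n) = exponent_map m + exponent_map n"
proof -
  \<comment> \<open>Additivity is read off from multiplicativity of evaluation; the rationals merely
    supply some coefficient field.\<close>
  have "single (exponent_map (m + n)) (1::rat) = single (exponent_map m + exponent_map n) 1"
    using eval_monomial_add[of hibi_monomial m n] unfolding eval_monomial_hibi mult_single by simp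
  then show ?thesis by (metis lookup_single_eq lookup_single_not_eq zero_neq_one)
qed

lemma exponent_map_single: "exponent_map (single \<alpha> 1) = hibi_exponent \<alpha>"
  by (simp add: exponent_map_def)

lemma exponent_map_None: "lookup (exponent_map m) None = total_deg m"
  by (simp add: exponent_map_def lookup_sum total_deg_def)

text \<open>Hence a polynomial is in the ideal iff its coefficients sum to zero over every fibre of
  \<open>exponent_map\<close>.\<close>

lemma lookup_hibi_map:
  "lookup (hibi_map f) e = (\<Sum>m\<in>{m \<in> keys f. exponent_map m = e}. lookup f m)"
proof -
  have "lookup (hibi_map f) e = (\<Sum>m\<in>keys f. if exponent_map m = e then lookup f m else 0)"
    unfolding subst_eval eval_monomial_hibi const_def mult_single
    by (simp add: lookup_sum lookup_single when_def)
  also have "\<dots> = (\<Sum>m\<in>{m \<in> keys f. exponent_map m = e}. lookup f m)"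
    by (rule sum.inter_filter[symmetric]) simp
  finally show ?thesis .
qed

text \<open>The exponent of \<open>t\<close> in an image monomial is the total degree of its source,
  so selecting a degree means selecting a power of \<open>t\<close>. This is why the kernel is
  graded.\<close>

lemma lookup_hibi_map_hom_part:
  "lookup (hibi_map (hom_part j f)) e = (if lookup e None = j then lookup (hibi_map f) e else 0)"
proof (cases "lookup e None = j")
  case True
  then have "{m \<in> keys (hom_part j f). exponent_map m = e} = {m \<in> keys f. exponent_map m = e}"
    by (auto simp: in_keys_iff lookup_hom_part exponent_map_None)
  then show ?thesis
    using True by (auto simp: lookup_hibi_map lookup_hom_part exponent_map_None intro!: sum.cong)
next
  case False
  then have "{m \<in> keys (hom_part j f). exponent_map m = e} = {}"
    by (auto simp: in_keys_iff lookup_hom_part exponent_map_None)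
  then show ?thesis using False by (simp only: lookup_hibi_map sum.empty if_False)
qed

lemma finite_order_ideals: "finite P \<Longrightarrow> finite (order_ideals P r)"
  by (rule finite_subset[of _ "Pow P"]) (auto simp: order_ideals_def)

lemma graded_quotient_hibi:
  "finite P \<Longrightarrow> graded_quotient (order_ideals P r) (hibi_map :: ('a set, 'k::field) mpoly \<Rightarrow> _)"
proof (unfold_locales, goal_cases)
  case (5 f j)
  show ?case
    by (rule poly_mapping_eqI) (simp add: lookup_hibi_map_hom_part 5(3))
next
  case (6 c)
  then have "(const c :: ('a option, 'k) mpoly) = 0" by simp
  then show ?case unfolding const_def by (metis lookup_single_eq lookup_zero)
qed (auto simp: finite_order_ideals subst_add subst_mult)

section \<open>The Hibi ring as an image of the polynomial ring\<close>

lemma ring_of_type_algebra_simps: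
  "carrier ring_of_type_algebra = UNIV" "a \<otimes>\<^bsub>ring_of_type_algebra\<^esub> b = a * b"
  "a \<oplus>\<^bsub>ring_of_type_algebra\<^esub> b = a + b" "\<one>\<^bsub>ring_of_type_algebra\<^esub> = 1" "\<zero>\<^bsub>ring_of_type_algebra\<^esub> = 0"
  by (simp_all add: ring_of_type_algebra_def)

lemma a_inv_ring_of_type_algebra: "\<ominus>\<^bsub>ring_of_type_algebra\<^esub> a = - (a :: 'a::comm_ring_1)"
proof -
  interpret cring "ring_of_type_algebra :: 'a ring" by (rule cring_from_type_algebra)
  show ?thesis by (rule minus_equality) (simp_all add: ring_of_type_algebra_simps)
qed

text \<open>Replaces the generated subring by the image of a substitution, the form required by
  \<open>graded_quotient\<close>.\<close>

lemma carrier_hibi_ring: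
  "carrier (hibi_ring P r :: ('a option, 'k::field) mpoly ring) = hibi_map ` polys_in (order_ideals P r)"
proof -
  let ?R = "ring_of_type_algebra :: ('a option, 'k) mpoly ring"
  let ?H = "{const c | c. True} \<union> hibi_monomial ` order_ideals P r :: ('a option, 'k) mpoly set"
  let ?V = "order_ideals P r"
  have "generate_ring ?R ?H = hibi_map ` polys_in ?V"
  proof (intro equalityI subsetI)
    fix h assume "h \<in> generate_ring ?R ?H"
    then show "h \<in> hibi_map ` polys_in ?V"
    proof (induction h)
      case one
      show ?case by (rule image_eqI[of _ _ 1]) (simp_all add: ring_of_type_algebra_simps)
    next
      case (incl h)
      then consider c where "h = const c" | \<alpha> where "\<alpha> \<in> ?V" "h = hibi_monomial \<alpha>" by blast
      then show ?case
      proof cases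
        case 1
        then show ?thesis by (intro image_eqI[of _ _ "const c"]) simp_all
      next
        case 2
        then show ?thesis by (intro image_eqI[of _ _ "indet \<alpha>"]) simp_all
      qed
    next
      case (a_inv h)
      then obtain f where "f \<in> polys_in ?V" "h = hibi_map f" by blast
      then show ?case
        unfolding a_inv_ring_of_type_algebra by (intro image_eqI[of _ _ "- f"]) (simp_all add: subst_uminus polys_in_uminus)
    next
      case (eng_add h1 h2)
      then obtain f g where "f \<in> polys_in ?V" "h1 = hibi_map f" "g \<in> polys_in ?V" "h2 = hibi_map g" by blast
      then show ?case
        by (intro image_eqI[of _ _ "f + g"]) (simp_all add: ring_of_type_algebra_simps subst_add polys_in_add)
    next
      case (eng_mult h1 h2)
      then obtain f g where "f \<in> polys_in ?V" "h1 = hibi_map f" "g \<in> polys_in ?V" "h2 = hibi_map g" by blast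
      then show ?case
        by (intro image_eqI[of _ _ "f * g"]) (simp_all add: ring_of_type_algebra_simps subst_mult polys_in_mult)
    qed
  next
    fix h :: "('a option, 'k) mpoly" assume "h \<in> hibi_map ` polys_in ?V"
    then obtain f where f: "f \<in> polys_in ?V" "h = hibi_map f" by blast
    define G where "G = generate_ring ?R ?H"
    have add: "x + y \<in> G" if "x \<in> G" "y \<in> G" for x y
      using generate_ring.eng_add[OF that[unfolded G_def]] by (simp add: ring_of_type_algebra_simps G_def)
    have mult: "x * y \<in> G" if "x \<in> G" "y \<in> G" for x y
      using generate_ring.eng_mult[OF that[unfolded G_def]] by (simp add: ring_of_type_algebra_simps G_def)
    have con: "const c \<in> G" for c
      unfolding G_def by (rule generate_ring.incl) auto
    have pow: "hibi_monomial \<alpha> ^ n \<in> G" if "\<alpha> \<in> ?V" for \<alpha> n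
    proof (induction n)
      case 0
      show ?case using con[of 1] by simp
    next
      case (Suc n)
      have "hibi_monomial \<alpha> \<in> G" using that unfolding G_def by (intro generate_ring.incl) auto
      then show ?case using Suc mult by simp
    qed
    have "eval_monomial hibi_monomial m \<in> G" if "m \<in> keys f" for m
    proof -
      have "(\<Prod>\<alpha>\<in>A. hibi_monomial \<alpha> ^ lookup m \<alpha>) \<in> G" if "A \<subseteq> ?V" for A
        using that by (induction A rule: infinite_finite_induct) (use con[of 1] in \<open>auto intro: mult pow\<close>)
      then show ?thesis using that f(1) unfolding eval_monomial_def polys_in_def by blast
    qed
    then have "(\<Sum>m\<in>A. const (lookup f m) * eval_monomial hibi_monomial m) \<in> G" if "A \<subseteq> keys f" for A
      using that by (induction A rule: infinite_finite_induct) (use con[of 0] in \<open>auto intro!: add mult con\<close>)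
    then show "h \<in> generate_ring ?R ?H" unfolding f(2) subst_eval G_def by blast
  qed
  then show ?thesis by (simp add: hibi_ring_def)
qed

lemma hibi_component_eq:
  "(hibi_component P r j :: ('a option, 'k::field) mpoly set) = hibi_map ` hom_polys (order_ideals P r) j"
proof (intro equalityI subsetI)
  fix h :: "('a option, 'k) mpoly" assume h: "h \<in> hibi_component P r j"
  then obtain f where f: "f \<in> polys_in (order_ideals P r)" "h = hibi_map f"
    by (auto simp: hibi_component_def carrier_hibi_ring)
  have "h = hibi_map (hom_part j f)"
  proof (rule poly_mapping_eqI)
    fix e
    have "lookup h e = 0" if "lookup e None \<noteq> j" using h that by (auto simp: hibi_component_def in_keys_iff)
    then show "lookup h e = lookup (hibi_map (hom_part j f)) e"
      by (simp add: lookup_hibi_map_hom_part f(2))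
  qed
  then show "h \<in> hibi_map ` hom_polys (order_ideals P r) j"
    using hom_part_in_hom_polys[OF f(1)] by blast
next
  fix h :: "('a option, 'k) mpoly" assume "h \<in> hibi_map ` hom_polys (order_ideals P r) j"
  then obtain f where f: "f \<in> hom_polys (order_ideals P r) j" "h = hibi_map f" by blast
  have "lookup e None = j" if "e \<in> keys h" for e
  proof -
    have "lookup (hibi_map (hom_part j f)) e \<noteq> 0" using that f by (simp add: hom_part_id in_keys_iff)
    then show ?thesis by (simp add: lookup_hibi_map_hom_part split: if_splits)
  qed
  then show "h \<in> hibi_component P r j"
    using f hom_polys_polys_in[OF f(1)] by (auto simp: hibi_component_def carrier_hibi_ring)
qed

abbreviation hibi_ideal :: "'k::field itself \<Rightarrow> 'a set \<Rightarrow> 'a rel \<Rightarrow> nat \<Rightarrow> ('a set, 'k) mpoly set" where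
  "hibi_ideal K P r \<equiv> graded_quotient.I (order_ideals P r) (hibi_map :: ('a set, 'k) mpoly \<Rightarrow> ('a option, 'k) mpoly)"

text \<open>The exceptional index is 2 in both conditions: quadratic generators, and linear syzygies
  of degree 3 whose Koszul coefficients have degree 2.\<close>

lemma hibi_property_N_2_iff:
  assumes "finite P"
  shows "hibi_property_N TYPE('k::field) 2 P r \<longleftrightarrow>
    normal_domain (hibi_ring P r :: ('a option, 'k) mpoly ring) \<and>
    (\<forall>j. j \<noteq> 2 \<longrightarrow> hibi_ideal TYPE('k) P r j \<subseteq> irr_part (order_ideals P r) (*) (hibi_ideal TYPE('k) P r) j) \<and>
    (\<forall>j. j \<noteq> 2 \<longrightarrow> koszul_cycles (order_ideals P r) (*) (hibi_ideal TYPE('k) P r) j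
      \<subseteq> koszul_boundaries (order_ideals P r) (*) (hibi_ideal TYPE('k) P r) j)"
proof -
  interpret graded_quotient "order_ideals P r" "hibi_map :: ('a set, 'k) mpoly \<Rightarrow> _"
    by (rule graded_quotient_hibi[OF assms])
  have b: "hibi_betti TYPE('k) P r i j = betti i j" for i j
    unfolding hibi_betti_def carrier_hibi_ring hibi_component_eq[abs_def] ..
  have "(\<forall>i j. 1 \<le> i \<and> i \<le> 2 \<and> j \<noteq> i + 1 \<longrightarrow> betti i j = 0) \<longleftrightarrow>
    (\<forall>j. j \<noteq> 2 \<longrightarrow> betti (Suc 0) j = 0) \<and> (\<forall>j. j \<noteq> 3 \<longrightarrow> betti (Suc (Suc 0)) j = 0)"
  proof -
    have "1 \<le> i \<and> i \<le> 2 \<longleftrightarrow> i = Suc 0 \<or> i = Suc (Suc 0)" for i :: nat by auto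
    note i = this
    show ?thesis
    proof (intro iffI conjI allI impI)
      fix i j :: nat assume h: "(\<forall>j. j \<noteq> 2 \<longrightarrow> betti (Suc 0) j = 0) \<and> (\<forall>j. j \<noteq> 3 \<longrightarrow> betti (Suc (Suc 0)) j = 0)"
        "1 \<le> i \<and> i \<le> 2 \<and> j \<noteq> i + 1"
      then consider "i = Suc 0" | "i = Suc (Suc 0)" using i by blast
      then show "betti i j = 0" using h by cases auto
    qed auto
  qed
  also have "(\<forall>j. j \<noteq> 3 \<longrightarrow> betti (Suc (Suc 0)) j = 0) \<longleftrightarrow> (\<forall>j. j \<noteq> 2 \<longrightarrow> betti (Suc (Suc 0)) (Suc j) = 0)"
  proof (intro iffI allI impI)
    fix j :: nat
    assume "\<forall>j. j \<noteq> 2 \<longrightarrow> betti (Suc (Suc 0)) (Suc j) = 0" "j \<noteq> 3"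
    then show "betti (Suc (Suc 0)) j = 0" using betti_2_degree_0 by (cases j) auto
  qed auto
  finally have eq: "(\<forall>i j. 1 \<le> i \<and> i \<le> 2 \<and> j \<noteq> i + 1 \<longrightarrow> betti i j = 0) \<longleftrightarrow>
    (\<forall>j. j \<noteq> 2 \<longrightarrow> betti (Suc 0) j = 0) \<and> (\<forall>j. j \<noteq> 2 \<longrightarrow> betti (Suc (Suc 0)) (Suc j) = 0)" .
  show ?thesis
    unfolding hibi_property_N_def b eq betti_1_eq_0_iff betti_2_Suc_eq_0_iff by (rule refl)
qed

section \<open>A syzygy of degree four\<close>

lemma total_deg_2:
  assumes "total_deg m = 2"
  obtains x y where "m = single x 1 + single y 1"
proof -
  have "m \<noteq> 0" using assms by auto
  then obtain x where x: "x \<in> keys m" by (metis keys_eq_empty all_not_in_conv)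
  have m: "m = single x 1 + (m - single x 1)"
    using x by (auto simp: poly_mapping_eq_iff fun_eq_iff lookup_add lookup_minus lookup_single when_def in_keys_iff)
  have "total_deg m = total_deg (single x (1::nat)) + total_deg (m - single x 1)"
    by (subst m) (rule total_deg_add)
  then have 1: "total_deg (m - single x 1) = 1" using assms by simp
  then have "m - single x 1 \<noteq> 0" by auto
  then obtain y where y: "y \<in> keys (m - single x 1)" by (metis keys_eq_empty all_not_in_conv)
  have m': "m - single x 1 = single y 1 + (m - single x 1 - single y 1)"
    using y by (auto simp: poly_mapping_eq_iff fun_eq_iff lookup_add lookup_minus lookup_single when_def in_keys_iff)
  have "total_deg (m - single x 1) = total_deg (single y (1::nat)) + total_deg (m - single x 1 - single y 1)"
    by (subst m') (rule total_deg_add)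
  then have "m - single x 1 - single y 1 = 0" using 1 by simp
  then have "m = single x 1 + single y 1" using m m' by simp
  then show thesis by (rule that)
qed

text \<open>The identity behind the cycle built below, isolated in an arbitrary commutative ring.
  With \<open>f\<close> and \<open>g\<close> equal to the two brackets, the right-hand side is a
  commutator.\<close>

lemma koszul_pair_identity:
  "x1 * (x2 * g) + x3 * (- (x4 * g)) + x5 * (- (x6 * f)) + x7 * (x8 * f)
    = (x1 * x2 - x3 * x4) * g - (x5 * x6 - x7 * x8) * (f :: 'b::comm_ring_1)"
  by (simp add: algebra_simps)

context
  fixes P :: "'a set" and r :: "'a rel"
  assumes fin: "finite P"
begin

lemma finite_ideal: "\<alpha> \<in> order_ideals P r \<Longrightarrow> finite \<alpha>"
  using fin by (auto simp: order_ideals_def intro: finite_subset)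

text \<open>
  The monomial \<open>x\<^sub>\<alpha> x\<^sub>\<beta>\<close> is alone in its fibre when \<open>\<beta> - \<alpha>\<close> has a least element \<open>a\<close>: if
  \<open>{\<alpha>', \<beta>'}\<close> has the same union and intersection, then the one of the two that omits \<open>a\<close> equals \<open>\<alpha>\<close>.
\<close>

lemma hibi_ideal_lookup_zero:
  fixes f :: "('a set, 'k::field) mpoly"
  assumes f: "f \<in> hibi_ideal TYPE('k) P r j"
    and XY: "\<alpha> \<in> order_ideals P r" "\<beta> \<in> order_ideals P r" "\<alpha> \<subseteq> \<beta>"
    and a: "a \<in> \<beta> - \<alpha>" "\<And>p. p \<in> \<beta> - \<alpha> \<Longrightarrow> (a, p) \<in> r"
  shows "lookup f (single \<alpha> 1 + single \<beta> 1) = 0"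
proof -
  interpret graded_quotient "order_ideals P r" "hibi_map :: ('a set, 'k) mpoly \<Rightarrow> _"
    by (rule graded_quotient_hibi[OF fin])
  let ?n = "single \<alpha> 1 + single \<beta> (1::nat)"
  have uniq: "m = ?n" if m: "m \<in> keys f" "exponent_map m = exponent_map ?n" for m
  proof -
    have "total_deg m = total_deg ?n" using m(2) exponent_map_None by metis
    then have "total_deg m = 2" by (simp add: total_deg_add)
    then obtain \<alpha>' \<beta>' where m': "m = single \<alpha>' 1 + single \<beta>' 1" by (rule total_deg_2)
    have "keys m \<subseteq> order_ideals P r" using f m(1) by (auto simp: I_def hom_polys_def polys_in_def)
    then have XY': "\<alpha>' \<in> order_ideals P r" "\<beta>' \<in> order_ideals P r" by (auto simp: m' keys_add_nat)
    have "hibi_exponent \<alpha>' + hibi_exponent \<beta>' = hibi_exponent \<alpha> + hibi_exponent \<beta>"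
      using m(2) unfolding m' exponent_map_add exponent_map_single .
    then have "lookup (hibi_exponent \<alpha>' + hibi_exponent \<beta>') (Some p) = lookup (hibi_exponent \<alpha> + hibi_exponent \<beta>) (Some p)" for p
      by simp
    then have e: "(if p \<in> \<alpha>' then 1 else 0) + (if p \<in> \<beta>' then 1 else (0::nat))
        = (if p \<in> \<alpha> then 1 else 0) + (if p \<in> \<beta> then 1 else 0)" for p
      using XY XY' finite_ideal by (simp add: lookup_add lookup_hibi_exponent_Some)
    \<comment> \<open>Exactly one of the two ideals contains \<open>a\<close>; calling it
      \<open>\<alpha>1\<close> treats both orders at once. An element of the other one outside
      \<open>\<alpha>\<close> would lie above \<open>a\<close> and force \<open>a\<close> into that
      ideal.\<close>
    have step: "\<beta>1 = \<alpha> \<and> \<alpha>1 = \<beta>"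
      if e1: "\<And>p. (if p \<in> \<alpha>1 then 1 else 0) + (if p \<in> \<beta>1 then 1 else (0::nat))
          = (if p \<in> \<alpha> then 1 else 0) + (if p \<in> \<beta> then 1 else 0)"
        and a1: "a \<in> \<alpha>1" and \<beta>1: "\<beta>1 \<in> order_ideals P r" for \<alpha>1 \<beta>1
    proof -
      have "a \<notin> \<beta>1" using e1[of a] a(1) a1 by (auto split: if_splits)
      have "a \<in> P" using a(1) XY(2) by (auto simp: order_ideals_def)
      have sub: "p \<in> \<alpha>" if "p \<in> \<beta>1" for p
      proof (rule ccontr)
        assume "p \<notin> \<alpha>"
        then have "p \<in> \<beta>" using e1[of p] that by (auto split: if_splits)
        then have "(a, p) \<in> r" using a(2) \<open>p \<notin> \<alpha>\<close> by blast
        then have "a \<in> \<beta>1" using \<beta>1 that \<open>a \<in> P\<close> by (auto simp: order_ideals_def)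
        with \<open>a \<notin> \<beta>1\<close> show False ..
      qed
      have sup: "p \<in> \<beta>1 \<and> p \<in> \<alpha>1" if "p \<in> \<alpha>" for p
        using e1[of p] that XY(3) by (auto split: if_splits)
      have "p \<in> \<alpha>1 \<longleftrightarrow> p \<in> \<beta>" for p
        using e1[of p] sub[of p] sup[of p] XY(3) by (auto split: if_splits)
      then show ?thesis using sub sup by blast
    qed
    show ?thesis
    proof (cases "a \<in> \<alpha>'")
      case True
      then have "\<beta>' = \<alpha> \<and> \<alpha>' = \<beta>" using step[of \<alpha>' \<beta>'] e XY' by blast
      then show ?thesis by (simp add: m' add.commute)
    next
      case False
      have "\<alpha>' = \<alpha> \<and> \<beta>' = \<beta>"
      proof (rule step)
        show "(if p \<in> \<beta>' then 1 else 0) + (if p \<in> \<alpha>' then 1 else (0::nat))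
          = (if p \<in> \<alpha> then 1 else 0) + (if p \<in> \<beta> then 1 else 0)" for p
          using e[of p] by simp
        show "a \<in> \<beta>'" using e[of a] a(1) False by (auto split: if_splits)
      qed (rule XY')
      then show ?thesis by (simp add: m')
    qed
  qed
  have "lookup (hibi_map f) (exponent_map ?n) = 0" using f by (simp add: I_def)
  moreover have "lookup (hibi_map f) (exponent_map ?n) = lookup f ?n"
  proof (cases "?n \<in> keys f")
    case True
    then have "{m \<in> keys f. exponent_map m = exponent_map ?n} = {?n}" using uniq by blast
    then show ?thesis by (simp only: lookup_hibi_map) simp
  next
    case False
    then have "{m \<in> keys f. exponent_map m = exponent_map ?n} = {}" using uniq by blast
    then have "lookup (hibi_map f) (exponent_map ?n) = 0" by (simp only: lookup_hibi_map sum.empty)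
    then show ?thesis using False by (simp only: in_keys_iff not_not)
  qed
  ultimately show ?thesis by simp
qed

text \<open>Every element of \<open>P\<close> belongs to as many of \<open>\<alpha>\<close> and
  \<open>\<beta>\<close> as of their intersection and union, so the two monomials have the same
  image.\<close>

lemma hibi_relation:
  fixes \<alpha> \<beta> :: "'a set"
  assumes "\<alpha> \<in> order_ideals P r" "\<beta> \<in> order_ideals P r"
  shows "indet \<alpha> * indet \<beta> - indet (\<alpha> \<inter> \<beta>) * indet (\<alpha> \<union> \<beta>) \<in> hibi_ideal TYPE('k::field) P r 2"
proof -
  interpret graded_quotient "order_ideals P r" "hibi_map :: ('a set, 'k) mpoly \<Rightarrow> _"
    by (rule graded_quotient_hibi[OF fin])
  interpret H: graded_module "(*) :: ('a set, 'k) mpoly \<Rightarrow> _" "order_ideals P r" "hom_polys (order_ideals P r)"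
    by (rule graded_module_hom_polys[OF finite_V])
  have IU: "\<alpha> \<inter> \<beta> \<in> order_ideals P r" "\<alpha> \<union> \<beta> \<in> order_ideals P r"
    using assms by (auto simp: order_ideals_def)
  have "lookup (hibi_exponent \<alpha> + hibi_exponent \<beta>) q = lookup (hibi_exponent (\<alpha> \<inter> \<beta>) + hibi_exponent (\<alpha> \<union> \<beta>)) q" for q
  proof (cases q)
    case None
    then show ?thesis by (simp add: lookup_add)
  next
    case (Some p)
    then show ?thesis using finite_ideal assms IU by (auto simp: lookup_add lookup_hibi_exponent_Some)
  qed
  then have "hibi_exponent \<alpha> + hibi_exponent \<beta> = hibi_exponent (\<alpha> \<inter> \<beta>) + hibi_exponent (\<alpha> \<union> \<beta>)"
    by (rule poly_mapping_eqI)
  then have "hibi_map (indet \<alpha> * indet \<beta> - indet (\<alpha> \<inter> \<beta>) * indet (\<alpha> \<union> \<beta>)) = (0 :: ('a option, 'k) mpoly)"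
    by (simp add: subst_diff subst_mult hibi_monomial_single mult_single)
  moreover have "indet \<alpha> * indet \<beta> - indet (\<alpha> \<inter> \<beta>) * indet (\<alpha> \<union> \<beta>) \<in> (hom_polys (order_ideals P r) 2 :: ('a set, 'k) mpoly set)"
    unfolding numeral_2_eq_2
    using assms IU hom_polys_indet[of _ "order_ideals P r"] by (intro H.N_diff H.N_indet) auto
  ultimately show ?thesis by (simp add: I_def)
qed

text \<open>Only the three variables dividing a squarefree cubic monomial can contribute to its
  coefficient.\<close>

lemma lookup_indet_sum:
  fixes c :: "'a set \<Rightarrow> ('a set, 'k::field) mpoly"
  assumes "distinct [x, y, z]" "{x, y, z} \<subseteq> order_ideals P r"
  shows "lookup (\<Sum>w\<in>order_ideals P r. indet w * c w) (single x 1 + single y 1 + single z 1) =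
    lookup (c x) (single y 1 + single z 1) + lookup (c y) (single x 1 + single z 1)
    + lookup (c z) (single x 1 + single y 1)"
proof -
  let ?N = "single x 1 + single y 1 + single z (1::nat)"
  have "lookup (\<Sum>w\<in>order_ideals P r. indet w * c w) ?N = (\<Sum>w\<in>order_ideals P r. lookup (indet w * c w) ?N)"
    by (rule lookup_sum)
  also have "\<dots> = (\<Sum>w\<in>{x, y, z}. lookup (indet w * c w) ?N)"
    by (rule sum.mono_neutral_right)
      (use assms finite_order_ideals[OF fin] in \<open>auto simp: lookup_indet_mult keys_add_nat\<close>)
  also have "\<dots> = lookup (indet x * c x) ?N + lookup (indet y * c y) ?N + lookup (indet z * c z) ?N"
    using assms(1) by (simp add: add.assoc)
  also have "lookup (indet x * c x) ?N = lookup (c x) (single y 1 + single z 1)"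
    using lookup_indet_mult_add[of x "c x" "single y 1 + single z 1"] by (simp only: add.assoc)
  also have "lookup (indet y * c y) ?N = lookup (c y) (single x 1 + single z 1)"
    using lookup_indet_mult_add[of y "c y" "single x 1 + single z 1"] by (simp only: add.assoc add.left_commute)
  also have "lookup (indet z * c z) ?N = lookup (c z) (single x 1 + single y 1)"
    using lookup_indet_mult_add[of z "c z" "single x 1 + single y 1"] by (simp only: add.assoc add.commute[of "single z 1"])
  finally show ?thesis .
qed

text \<open>
  The Koszul syzygy between the relations of two incomparable pairs \<open>A, B\<close> and \<open>C, D\<close> of ideals with
  \<open>A \<union> B \<subseteq> C \<inter> D\<close>. The functional that adds the coefficient of \<open>x\<^sub>B x\<^sub>C x\<^sub>D\<close> at \<open>A\<close> and that of
  \<open>x\<^sub>A x\<^sub>C x\<^sub>D\<close> at \<open>B\<close> vanishes on boundaries and takes the value 1 on it.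
\<close>

lemma koszul_pair_not_boundary:
  fixes K :: "'k::field itself"
  assumes po: "partial_order_on P r" and in_P: "a \<in> P" "b \<in> P" "c \<in> P" "d \<in> P"
    and ab: "incomparable r a b" and cd: "incomparable r c d"
    and le: "(a, c) \<in> r" "(a, d) \<in> r" "(b, c) \<in> r" "(b, d) \<in> r"
  shows "\<not> koszul_cycles (order_ideals P r) (*) (hibi_ideal TYPE('k) P r) 3
    \<subseteq> koszul_boundaries (order_ideals P r) (*) (hibi_ideal TYPE('k) P r) 3"
proof
  let ?V = "order_ideals P r"
  let ?I = "hibi_ideal TYPE('k) P r"
  assume sub: "koszul_cycles ?V (*) ?I 3 \<subseteq> koszul_boundaries ?V (*) ?I 3"
  interpret graded_quotient ?V "hibi_map :: ('a set, 'k) mpoly \<Rightarrow> _"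
    by (rule graded_quotient_hibi[OF fin])
  have tr: "\<And>x y z. (x, y) \<in> r \<Longrightarrow> (y, z) \<in> r \<Longrightarrow> (x, z) \<in> r" and rf: "\<And>x. x \<in> P \<Longrightarrow> (x, x) \<in> r"
    using po unfolding partial_order_on_def preorder_on_def by (auto dest: transD refl_onD)
  have nab: "(a, b) \<notin> r" "(b, a) \<notin> r" "(c, d) \<notin> r" "(d, c) \<notin> r"
    using ab cd by (auto simp: incomparable_def)
  \<comment> \<open>\<open>A\<close> and \<open>B\<close> are the largest ideals omitting
    \<open>b\<close> and \<open>a\<close>. Hence everything outside \<open>B\<close> lies above
    \<open>a\<close> and everything outside \<open>A\<close> above \<open>b\<close>, which provides
    the least elements of the differences below; \<open>C\<close> and \<open>D\<close> are enlarged
    just enough to contain \<open>c\<close> and \<open>d\<close>.\<close>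
  define A where "A = {p\<in>P. (b, p) \<notin> r}"
  define B where "B = {p\<in>P. (a, p) \<notin> r}"
  define C where "C = A \<union> B \<union> {p\<in>P. (p, c) \<in> r}"
  define D where "D = A \<union> B \<union> {p\<in>P. (p, d) \<in> r}"
  have Un: "\<alpha> \<union> \<beta> \<in> ?V" and Int: "\<alpha> \<inter> \<beta> \<in> ?V" if "\<alpha> \<in> ?V" "\<beta> \<in> ?V" for \<alpha> \<beta>
    using that by (auto simp: order_ideals_def)
  have up: "{p\<in>P. (x, p) \<notin> r} \<in> ?V" and down: "{p\<in>P. (p, x) \<in> r} \<in> ?V" for x
    using tr unfolding order_ideals_def by blast+
  have V: "A \<in> ?V" "B \<in> ?V" "C \<in> ?V" "D \<in> ?V" "A \<inter> B \<in> ?V" "A \<union> B \<in> ?V" "C \<inter> D \<in> ?V" "C \<union> D \<in> ?V"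
    unfolding A_def B_def C_def D_def by (intro Un Int up down)+
  have mem: "a \<in> A" "a \<notin> B" "b \<in> B" "b \<notin> A" "c \<in> C" "c \<notin> D" "d \<in> D" "d \<notin> C"
    using in_P rf nab le by (auto simp: A_def B_def C_def D_def)
  have subs: "A \<subseteq> C" "A \<subseteq> D" "B \<subseteq> C" "B \<subseteq> D" by (auto simp: C_def D_def)
  have ne: "A \<noteq> B" "A \<noteq> C" "A \<noteq> D" "B \<noteq> C" "B \<noteq> D" "C \<noteq> D" "A \<noteq> A \<inter> B" "A \<noteq> C \<inter> D"
    "B \<noteq> A \<inter> B" "B \<noteq> C \<inter> D" "C \<noteq> C \<inter> D" "D \<noteq> C \<inter> D"
    using mem subs by blast+
  define F :: "('a set, 'k) mpoly" where "F = indet A * indet B - indet (A \<inter> B) * indet (A \<union> B)"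
  define G :: "('a set, 'k) mpoly" where "G = indet C * indet D - indet (C \<inter> D) * indet (C \<union> D)"
  have FG: "F \<in> I 2" "G \<in> I 2" unfolding F_def G_def using V by (auto intro: hibi_relation)
  \<comment> \<open>This represents the product of \<open>F\<close> and \<open>G\<close> in two
    ways: in the terms with \<open>G\<close> the first factor of each monomial of \<open>F\<close>
    becomes the Koszul index, in the others that of \<open>G\<close>. Writing a sum of four pieces
    makes the cycle condition independent of which indices coincide.\<close>
  define z where "z v = (if v = A then indet B * G else 0) + (if v = A \<inter> B then - (indet (A \<union> B) * G) else 0)
    + (if v = C then - (indet D * F) else 0) + (if v = C \<inter> D then indet (C \<union> D) * F else 0)" for v
  have I3: "indet v * f \<in> I 3" if "v \<in> ?V" "f \<in> I 2" for v f
    using I.N_indet[OF that(2,1)] by (simp add: numeral_3_eq_3 numeral_2_eq_2)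
  have ite: "(if v = w then f else 0) \<in> I 3" if "f \<in> I 3" for v w :: "'a set" and f
    using that by (simp add: I.N_zero)
  have zI: "z v \<in> I 3" for v
    unfolding z_def by (intro I.N_add ite I.N_uminus I3 V FG)
  have pt: "(\<Sum>v\<in>?V. indet v * (if v = w then f else 0)) = indet w * f"
    if "w \<in> ?V" for w and f :: "('a set, 'k) mpoly"
  proof -
    have "(\<Sum>v\<in>?V. indet v * (if v = w then f else 0)) = (\<Sum>v\<in>?V. if v = w then indet w * f else 0)"
      by (intro sum.cong) auto
    then show ?thesis using that finite_V by simp
  qed
  have "(\<Sum>v\<in>?V. indet v * z v) = 0"
  proof -
    have "(\<Sum>v\<in>?V. indet v * z v) = indet A * (indet B * G) + indet (A \<inter> B) * (- (indet (A \<union> B) * G))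
        + indet C * (- (indet D * F)) + indet (C \<inter> D) * (indet (C \<union> D) * F)"
      unfolding z_def distrib_left sum.distrib
      by (simp only: pt V)
    also have "\<dots> = F * G - G * F"
      unfolding koszul_pair_identity F_def[symmetric] G_def[symmetric] ..
    also have "\<dots> = 0" unfolding mult.commute[of F G] by (rule diff_self)
    finally show ?thesis .
  qed
  with zI have "z \<in> koszul_boundaries ?V (*) I 3" using sub unfolding koszul_cycles_def by blast
  then obtain k where k: "alternating ?V k" "\<And>v w. v \<in> ?V \<Longrightarrow> w \<in> ?V \<Longrightarrow> k v w \<in> prev I 3"
    "\<And>v. v \<in> ?V \<Longrightarrow> z v = (\<Sum>w\<in>?V. indet w * k v w)"
    unfolding koszul_boundaries_def by blast
  have kI: "k v w \<in> I 2" if "v \<in> ?V" "w \<in> ?V" for v w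
    using k(2)[OF that] by (simp add: numeral_3_eq_3 numeral_2_eq_2)
  \<comment> \<open>By construction the complement of \<open>B\<close> in \<open>P\<close> is the
    set of elements above \<open>a\<close>; likewise for \<open>A\<close> and
    \<open>b\<close>.\<close>
  have least: "(a, p) \<in> r" if "p \<in> C - B \<or> p \<in> D - B" for p
    using that unfolding A_def B_def C_def D_def by blast
  have least': "(b, p) \<in> r" if "p \<in> C - A \<or> p \<in> D - A" for p
    using that unfolding A_def B_def C_def D_def by blast
  have zero: "lookup f (single B 1 + single C 1) = 0" "lookup f (single B 1 + single D 1) = 0"
    "lookup f (single A 1 + single C 1) = 0" "lookup f (single A 1 + single D 1) = 0" if "f \<in> I 2" for f
  proof -
    have "a \<in> C - B" "a \<in> D - B" "b \<in> C - A" "b \<in> D - A" using mem subs by blast+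
    then show "lookup f (single B 1 + single C 1) = 0" "lookup f (single B 1 + single D 1) = 0"
      "lookup f (single A 1 + single C 1) = 0" "lookup f (single A 1 + single D 1) = 0"
      using hibi_ideal_lookup_zero[OF that V(2,3) subs(3), of a] hibi_ideal_lookup_zero[OF that V(2,4) subs(4), of a]
        hibi_ideal_lookup_zero[OF that V(1,3) subs(1), of b] hibi_ideal_lookup_zero[OF that V(1,4) subs(2), of b]
        least least' by blast+
  qed
  \<comment> \<open>The entries \<open>k A C\<close> and \<open>k A D\<close> are tested at
    monomials listed in \<open>zero\<close>, so only \<open>k A B\<close> survives.\<close>
  have zA: "lookup (z A) (single B 1 + single C 1 + single D 1) = lookup (k A B) (single C 1 + single D 1)"
    unfolding k(3)[OF V(1)]
    using lookup_indet_sum[of B C D "k A"] V ne zero kI by simp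
  have zB: "lookup (z B) (single A 1 + single C 1 + single D 1) = lookup (k B A) (single C 1 + single D 1)"
    unfolding k(3)[OF V(2)]
    using lookup_indet_sum[of A C D "k B"] V ne zero kI by simp
  \<comment> \<open>On a boundary the two tested coefficients are opposite. For \<open>z\<close>
    they are the coefficient of \<open>G\<close> at the product of the variables \<open>C\<close>
    and \<open>D\<close>, which is 1, and 0.\<close>
  have "z B = 0" using ne by (simp add: z_def)
  moreover have "z A = indet B * G" using ne by (simp add: z_def)
  moreover have "k B A = - k A B" by (rule alternating_swap[OF k(1) V(1,2)])
  ultimately have "lookup (indet B * G) (single B 1 + (single C 1 + single D 1)) = 0"
    using zA zB by (simp add: add.assoc)
  then have "lookup G (single C 1 + single D 1) = 0" unfolding lookup_indet_mult_add .
  moreover have "lookup G (single C 1 + single D 1) = 1"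
  proof -
    have "single (C \<inter> D) (1::nat) + single (C \<union> D) 1 \<noteq> single C 1 + single D 1"
    proof
      assume eq: "single (C \<inter> D) (1::nat) + single (C \<union> D) 1 = single C 1 + single D 1"
      have "C \<in> keys (single C (1::nat) + single D 1)" by (simp add: keys_add_nat)
      then have "C = C \<inter> D \<or> C = C \<union> D" unfolding eq[symmetric] by (auto simp: keys_add_nat)
      then show False using mem by blast
    qed
    then show ?thesis by (simp add: G_def indet_def mult_single lookup_minus lookup_single when_def)
  qed
  ultimately show False by simp
qed

end

section \<open>Normality of retracts\<close>

text \<open>Collapses the unions over representatives in \<open>fraction_field\<close> once
  independence of the representatives is shown.\<close>

lemma UN_pair_const:
  assumes "\<And>x y x' y'. (x, y) \<in> A \<Longrightarrow> (x', y') \<in> B \<Longrightarrow> g x x' y y' = M" "(a, b) \<in> A" "(c, d) \<in> B"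
  shows "(\<Union>(x, y)\<in>A. \<Union>(x', y')\<in>B. g x x' y y') = M"
  using assms by fastforce

text \<open>A domain carried by a subset of a commutative ring type, so that equations between
  numerators and denominators can be simplified with ordinary arithmetic.\<close>

locale concrete_domain =
  fixes C :: "'b::comm_ring_1 set"
  assumes zero: "0 \<in> C" and one: "1 \<in> C" and add: "a \<in> C \<Longrightarrow> b \<in> C \<Longrightarrow> a + b \<in> C"
    and uminus: "a \<in> C \<Longrightarrow> - a \<in> C" and mult: "a \<in> C \<Longrightarrow> b \<in> C \<Longrightarrow> a * b \<in> C"
    and no_zero_divisors: "a \<in> C \<Longrightarrow> b \<in> C \<Longrightarrow> a * b = 0 \<Longrightarrow> a = 0 \<or> b = 0"
begin

definition R :: "'b ring" where "R = ring_of_type_algebra \<lparr>carrier := C\<rparr>"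

lemma R_simps [simp]:
  "carrier R = C" "a \<otimes>\<^bsub>R\<^esub> b = a * b" "a \<oplus>\<^bsub>R\<^esub> b = a + b" "\<one>\<^bsub>R\<^esub> = 1" "\<zero>\<^bsub>R\<^esub> = 0"
  by (simp_all add: R_def ring_of_type_algebra_simps)

lemma domain_R: "domain R"
proof (intro domain.intro cringI domain_axioms.intro abelian_groupI Group.comm_monoidI)
  fix x assume "x \<in> carrier R"
  then show "\<exists>y\<in>carrier R. y \<oplus>\<^bsub>R\<^esub> x = \<zero>\<^bsub>R\<^esub>" by (auto intro!: bexI[of _ "- x"] uminus)
qed (auto simp: zero one add mult algebra_simps no_zero_divisors)

lemma cancel: "a \<in> C \<Longrightarrow> b \<in> C \<Longrightarrow> d \<in> C \<Longrightarrow> d \<noteq> 0 \<Longrightarrow> a * d = b * d \<Longrightarrow> a = b"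
  using no_zero_divisors[of "a - b" d] add[of a "- b"] uminus[of b] by (auto simp: algebra_simps)

definition D :: "'b set" where "D = C - {0}"

lemma D_C: "d \<in> D \<Longrightarrow> d \<in> C" and D1: "1 \<in> D"
  and mult_D: "d \<in> D \<Longrightarrow> d' \<in> D \<Longrightarrow> d * d' \<in> D"
  using no_zero_divisors mult one by (auto simp: D_def)

abbreviation "fr \<equiv> fraction R"

lemma mem_fraction: "(c, d) \<in> fr a b \<longleftrightarrow> a \<in> C \<and> b \<in> D \<and> c \<in> C \<and> d \<in> D \<and> a * d = c * b"
  by (auto simp: fraction_def frac_rel_def D_def)

lemma fraction_eq_iff:
  assumes "a \<in> C" "b \<in> D" "c \<in> C" "d \<in> D"
  shows "fr a b = fr c d \<longleftrightarrow> a * d = c * b"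
proof
  assume "fr a b = fr c d"
  then have "(a, b) \<in> fr c d" using assms mem_fraction[of a b a b] by auto
  then show "a * d = c * b" by (simp add: mem_fraction mult.commute)
next
  have sub: "fr a b \<subseteq> fr c d" if a: "a \<in> C" "b \<in> D" "c \<in> C" "d \<in> D" and eq: "a * d = c * b" for a b c d
  proof
    fix p assume "p \<in> fr a b"
    then obtain x y where p: "p = (x, y)" "x \<in> C" "y \<in> D" "a * y = x * b"
      by (cases p) (auto simp: mem_fraction)
    have "(c * y) * b = (x * d) * b"
    proof -
      have "(c * y) * b = (c * b) * y" by (simp add: mult_ac)
      also have "\<dots> = (a * d) * y" by (simp only: eq)
      also have "\<dots> = (a * y) * d" by (simp add: mult_ac)
      also have "\<dots> = (x * b) * d" by (simp only: p(4))
      also have "\<dots> = (x * d) * b" by (simp add: mult_ac)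
      finally show ?thesis .
    qed
    moreover have "b \<noteq> 0" using a(2) by (simp add: D_def)
    ultimately have "c * y = x * d"
      using cancel[OF mult[OF a(3) D_C[OF p(3)]] mult[OF p(2) D_C[OF a(4)]] D_C[OF a(2)]] by blast
    then show "p \<in> fr c d" using a p by (simp add: mem_fraction)
  qed
  assume eq: "a * d = c * b"
  show "fr a b = fr c d"
    by (rule equalityI[OF sub[OF assms eq] sub[OF assms(3,4,1,2) eq[symmetric]]])
qed

abbreviation "Q \<equiv> fraction_field R"

lemma carrier_Q: "carrier Q = {fr a b | a b. a \<in> C \<and> b \<in> D}"
  by (simp add: fraction_field_def D_def)

lemma Q_mult:
  assumes "a \<in> C" "b \<in> D" "c \<in> C" "d \<in> D"
  shows "fr a b \<otimes>\<^bsub>Q\<^esub> fr c d = fr (a * c) (b * d)"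
proof -
  have "fr (x * x') (y * y') = fr (a * c) (b * d)" if "(x, y) \<in> fr a b" "(x', y') \<in> fr c d" for x y x' y'
  proof -
    have h: "x \<in> C" "y \<in> D" "a * y = x * b" "x' \<in> C" "y' \<in> D" "c * y' = x' * d"
      using that by (auto simp: mem_fraction)
    have "(x * x') * (b * d) = (x * b) * (x' * d)" by (simp add: mult_ac)
    also have "\<dots> = (a * c) * (y * y')" unfolding h(3)[symmetric] h(6)[symmetric] by (simp add: mult_ac)
    finally show ?thesis using assms h by (subst fraction_eq_iff) (auto intro: mult mult_D)
  qed
  moreover have "(a, b) \<in> fr a b" "(c, d) \<in> fr c d" using assms by (auto simp: mem_fraction)
  ultimately have "(\<Union>(x, y)\<in>fr a b. \<Union>(x', y')\<in>fr c d. fr (x * x') (y * y')) = fr (a * c) (b * d)"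
    by (rule UN_pair_const)
  then show ?thesis by (simp add: fraction_field_def)
qed

lemma Q_add:
  assumes "a \<in> C" "b \<in> D" "c \<in> C" "d \<in> D"
  shows "fr a b \<oplus>\<^bsub>Q\<^esub> fr c d = fr (a * d + c * b) (b * d)"
proof -
  have "fr (x * y' + x' * y) (y * y') = fr (a * d + c * b) (b * d)"
    if "(x, y) \<in> fr a b" "(x', y') \<in> fr c d" for x y x' y'
  proof -
    have h: "x \<in> C" "y \<in> D" "a * y = x * b" "x' \<in> C" "y' \<in> D" "c * y' = x' * d"
      using that by (auto simp: mem_fraction)
    have "(x * y' + x' * y) * (b * d) = (x * b) * (y' * d) + (x' * d) * (y * b)" by (simp add: algebra_simps)
    also have "\<dots> = (a * d + c * b) * (y * y')"
      unfolding h(3)[symmetric] h(6)[symmetric] by (simp add: algebra_simps)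
    finally show ?thesis using assms h D_C by (subst fraction_eq_iff) (auto intro: mult mult_D add)
  qed
  moreover have "(a, b) \<in> fr a b" "(c, d) \<in> fr c d" using assms by (auto simp: mem_fraction)
  ultimately have "(\<Union>(x, y)\<in>fr a b. \<Union>(x', y')\<in>fr c d. fr (x * y' + x' * y) (y * y')) = fr (a * d + c * b) (b * d)"
    by (rule UN_pair_const)
  then show ?thesis by (simp add: fraction_field_def)
qed

lemma Q_one: "\<one>\<^bsub>Q\<^esub> = fr 1 1" and Q_zero: "\<zero>\<^bsub>Q\<^esub> = fr 0 1"
  by (simp_all add: fraction_field_def)

lemma Q_closed: "a \<in> C \<Longrightarrow> b \<in> D \<Longrightarrow> fr a b \<in> carrier Q"
  by (auto simp: carrier_Q)

text \<open>The ring laws make powers and finite sums in the fraction field, as they occur in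
  \<open>integral_over\<close>, computable.\<close>

lemma cring_Q: "cring Q"
proof (intro cringI abelian_groupI Group.comm_monoidI)
  fix x y z assume "x \<in> carrier Q" "y \<in> carrier Q" "z \<in> carrier Q"
  then obtain a b c d e f where x: "x = fr a b" "a \<in> C" "b \<in> D" and y: "y = fr c d" "c \<in> C" "d \<in> D"
    and z: "z = fr e f" "e \<in> C" "f \<in> D" unfolding carrier_Q by blast
  note CD = x(2,3) y(2,3) z(2,3) D_C[OF x(3)] D_C[OF y(3)] D_C[OF z(3)]
  show "x \<oplus>\<^bsub>Q\<^esub> y \<oplus>\<^bsub>Q\<^esub> z = x \<oplus>\<^bsub>Q\<^esub> (y \<oplus>\<^bsub>Q\<^esub> z)"
    unfolding x(1) y(1) z(1) using CD
    by (simp add: Q_add mult add mult_D fraction_eq_iff algebra_simps)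
  show "x \<otimes>\<^bsub>Q\<^esub> y \<otimes>\<^bsub>Q\<^esub> z = x \<otimes>\<^bsub>Q\<^esub> (y \<otimes>\<^bsub>Q\<^esub> z)"
    unfolding x(1) y(1) z(1) using CD
    by (simp add: Q_mult mult add mult_D fraction_eq_iff algebra_simps)
  show "(x \<oplus>\<^bsub>Q\<^esub> y) \<otimes>\<^bsub>Q\<^esub> z = x \<otimes>\<^bsub>Q\<^esub> z \<oplus>\<^bsub>Q\<^esub> y \<otimes>\<^bsub>Q\<^esub> z"
    unfolding x(1) y(1) z(1) using CD
    by (simp add: Q_mult Q_add mult add mult_D fraction_eq_iff algebra_simps)
next
  fix x y assume "x \<in> carrier Q" "y \<in> carrier Q"
  then obtain a b c d where x: "x = fr a b" "a \<in> C" "b \<in> D" and y: "y = fr c d" "c \<in> C" "d \<in> D"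
    unfolding carrier_Q by blast
  note CD = x(2,3) y(2,3) D_C[OF x(3)] D_C[OF y(3)]
  show "x \<oplus>\<^bsub>Q\<^esub> y \<in> carrier Q" "x \<otimes>\<^bsub>Q\<^esub> y \<in> carrier Q"
    unfolding x(1) y(1) using CD by (simp_all add: Q_add Q_mult Q_closed mult add mult_D)
  show "x \<oplus>\<^bsub>Q\<^esub> y = y \<oplus>\<^bsub>Q\<^esub> x" "x \<otimes>\<^bsub>Q\<^esub> y = y \<otimes>\<^bsub>Q\<^esub> x"
    unfolding x(1) y(1) using CD
    by (simp_all add: Q_add Q_mult mult add mult_D fraction_eq_iff algebra_simps)
next
  fix x assume "x \<in> carrier Q"
  then obtain a b where x: "x = fr a b" "a \<in> C" "b \<in> D" unfolding carrier_Q by blast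
  note CD = x(2,3) D_C[OF x(3)] D1 zero one
  show "\<zero>\<^bsub>Q\<^esub> \<oplus>\<^bsub>Q\<^esub> x = x" unfolding x(1) Q_zero using CD by (simp add: Q_add)
  show "\<one>\<^bsub>Q\<^esub> \<otimes>\<^bsub>Q\<^esub> x = x" unfolding x(1) Q_one using CD by (simp add: Q_mult)
  have "fr (- a) b \<oplus>\<^bsub>Q\<^esub> x = \<zero>\<^bsub>Q\<^esub>"
    unfolding x(1) Q_zero using CD by (simp add: Q_add uminus mult mult_D fraction_eq_iff)
  then show "\<exists>y\<in>carrier Q. y \<oplus>\<^bsub>Q\<^esub> x = \<zero>\<^bsub>Q\<^esub>" using CD Q_closed uminus by blast
qed (use zero one D1 in \<open>auto simp: Q_zero Q_one Q_closed\<close>)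

lemma power_C: "a \<in> C \<Longrightarrow> a ^ n \<in> C"
  by (induction n) (auto simp: one mult)

lemma power_D: "b \<in> D \<Longrightarrow> b ^ n \<in> D"
  by (induction n) (auto simp: D1 mult_D)

lemma Q_power:
  assumes "a \<in> C" "b \<in> D"
  shows "fr a b [^]\<^bsub>Q\<^esub> (n::nat) = fr (a ^ n) (b ^ n)"
proof -
  interpret Q: cring Q by (rule cring_Q)
  show ?thesis
  proof (induction n)
    case 0
    show ?case by (simp add: Q_one)
  next
    case (Suc n)
    then show ?case using assms by (simp add: Q_mult power_C power_D mult.commute)
  qed
qed

lemma sum_C: "(\<And>i. i \<in> A \<Longrightarrow> f i \<in> C) \<Longrightarrow> sum f A \<in> C"
  by (induction A rule: infinite_finite_induct) (auto simp: zero add)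

lemma Q_sum:
  assumes "finite A" "\<And>i. i \<in> A \<Longrightarrow> f i \<in> C" "d \<in> D"
  shows "(\<Oplus>\<^bsub>Q\<^esub>i\<in>A. fr (f i) d) = fr (\<Sum>i\<in>A. f i) d"
proof -
  interpret Q: cring Q by (rule cring_Q)
  show ?thesis
    using assms(1,2)
  proof (induction A rule: finite_induct)
    case empty
    then show ?case using assms(3) D_C D1 zero one by (simp add: Q_zero fraction_eq_iff)
  next
    case (insert x A)
    have "(\<Oplus>\<^bsub>Q\<^esub>i\<in>insert x A. fr (f i) d) = fr (f x) d \<oplus>\<^bsub>Q\<^esub> (\<Oplus>\<^bsub>Q\<^esub>i\<in>A. fr (f i) d)"
      using insert assms(3) by (intro Q.finsum_insert) (auto simp: Q_closed)
    also have "\<dots> = fr (f x) d \<oplus>\<^bsub>Q\<^esub> fr (\<Sum>i\<in>A. f i) d" using insert by simp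
    also have "\<dots> = fr (\<Sum>i\<in>insert x A. f i) d"
    proof -
      have "f x \<in> C" "sum f A \<in> C" using insert.prems by (auto intro: sum_C)
      then show ?thesis
        using insert.hyps assms(3) D_C[OF assms(3)]
        by (simp add: Q_add add mult mult_D fraction_eq_iff algebra_simps)
    qed
    finally show ?case .
  qed
qed

text \<open>Clearing denominators turns the integral equation of a/b into a homogenised equation
  inside \<open>C\<close>, which ring homomorphisms preserve without being extended to
  fractions.\<close>

lemma integral_over_iff:
  assumes "a \<in> C" "b \<in> D"
  shows "integral_over R (fr a b) \<longleftrightarrow>
    (\<exists>n c. (\<forall>i<n. c i \<in> C) \<and> a ^ n + (\<Sum>i<n. c i * a ^ i * b ^ (n - i)) = 0)"
proof -
  interpret Q: cring Q by (rule cring_Q)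
  have "fr a b [^]\<^bsub>Q\<^esub> n \<oplus>\<^bsub>Q\<^esub> (\<Oplus>\<^bsub>Q\<^esub>i\<in>{..<n}. fr (c i) 1 \<otimes>\<^bsub>Q\<^esub> fr a b [^]\<^bsub>Q\<^esub> i) = \<zero>\<^bsub>Q\<^esub> \<longleftrightarrow>
      a ^ n + (\<Sum>i<n. c i * a ^ i * b ^ (n - i)) = 0"
    if c: "\<forall>i<n. c i \<in> C" for n :: nat and c
  proof -
    have summand: "fr (c i) 1 \<otimes>\<^bsub>Q\<^esub> fr a b [^]\<^bsub>Q\<^esub> i = fr (c i * a ^ i * b ^ (n - i)) (b ^ n)" if "i < n" for i
    proof -
      \<comment> \<open>All summands are brought to the common denominator
        \<open>b ^ n\<close>.\<close>
      have "b ^ n = b ^ i * b ^ (n - i)" using that by (simp flip: power_add)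
      then show ?thesis
        using that c assms D_C power_C power_D D1
        by (simp add: Q_power Q_mult fraction_eq_iff mult mult_D mult_ac)
    qed
    have closed: "c i * a ^ i * b ^ (n - i) \<in> C" if "i < n" for i
      using that c assms D_C by (auto intro!: mult power_C)
    have "(\<Oplus>\<^bsub>Q\<^esub>i\<in>{..<n}. fr (c i) 1 \<otimes>\<^bsub>Q\<^esub> fr a b [^]\<^bsub>Q\<^esub> i)
        = (\<Oplus>\<^bsub>Q\<^esub>i\<in>{..<n}. fr (c i * a ^ i * b ^ (n - i)) (b ^ n))"
      using closed assms power_D by (intro Q.finsum_cong') (auto simp: summand Q_closed)
    also have "\<dots> = fr (\<Sum>i<n. c i * a ^ i * b ^ (n - i)) (b ^ n)"
      using closed assms power_D by (intro Q_sum) auto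
    finally have sum: "(\<Oplus>\<^bsub>Q\<^esub>i\<in>{..<n}. fr (c i) 1 \<otimes>\<^bsub>Q\<^esub> fr a b [^]\<^bsub>Q\<^esub> i)
        = fr (\<Sum>i<n. c i * a ^ i * b ^ (n - i)) (b ^ n)" .
    define s where "s = (\<Sum>i<n. c i * a ^ i * b ^ (n - i))"
    have s: "s \<in> C" unfolding s_def using closed by (intro sum_C) auto
    note ab = power_C[OF assms(1), of n] power_D[OF assms(2), of n] D_C[OF power_D[OF assms(2), of n]]
    have "fr (a ^ n) (b ^ n) \<oplus>\<^bsub>Q\<^esub> fr s (b ^ n) = fr (a ^ n * b ^ n + s * b ^ n) (b ^ n * b ^ n)"
      by (rule Q_add[OF ab(1,2) s ab(2)])
    also have "\<dots> = fr (a ^ n + s) (b ^ n)"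
      using ab s by (subst fraction_eq_iff) (auto intro: add mult mult_D simp: algebra_simps)
    finally show ?thesis
      unfolding sum unfolding s_def[symmetric] Q_power[OF assms] Q_zero
      using ab s D1 zero add by (simp add: fraction_eq_iff)
  qed
  then show ?thesis unfolding integral_over_def Let_def R_simps by blast
qed

end

text \<open>\<open>i\<close> carries the integral equation to the larger ring, where normality gives
  \<open>i a = h * i b\<close>, and \<open>p\<close> carries that equation back. Thus
  \<open>p\<close> is applied to ring elements only and may kill denominators; \<open>i\<close>
  preserves nonzero elements because \<open>p\<close> undoes it.\<close>

lemma normal_domain_retract:
  fixes C :: "'b::comm_ring_1 set" and C' :: "'c::comm_ring_1 set"
  assumes norm: "normal_domain (ring_of_type_algebra \<lparr>carrier := C\<rparr>)"
    and C: "1 \<in> C'" "0 \<in> C'" "\<And>a b. a \<in> C' \<Longrightarrow> b \<in> C' \<Longrightarrow> a + b \<in> C'" "\<And>a. a \<in> C' \<Longrightarrow> - a \<in> C'"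
      "\<And>a b. a \<in> C' \<Longrightarrow> b \<in> C' \<Longrightarrow> a * b \<in> C'"
    and uminus_C: "\<And>a. a \<in> C \<Longrightarrow> - a \<in> C"
    and i: "\<And>a b. i (a + b) = i a + i b" "\<And>a b. i (a * b) = i a * i b" "i 1 = 1" "\<And>a. a \<in> C' \<Longrightarrow> i a \<in> C"
    and p: "\<And>a b. p (a + b) = p a + p b" "\<And>a b. p (a * b) = p a * p b" "p 1 = 1" "\<And>a. a \<in> C \<Longrightarrow> p a \<in> C'"
    and pi: "\<And>a. a \<in> C' \<Longrightarrow> p (i a) = (a::'c)"
  shows "normal_domain (ring_of_type_algebra \<lparr>carrier := C'\<rparr>)"
proof -
  let ?R = "ring_of_type_algebra \<lparr>carrier := C\<rparr> :: 'b ring"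
  interpret dom: domain ?R using norm by (simp add: normal_domain_def)
  have i0: "i 0 = 0" using i(1)[of 0 0] by simp
  have p0: "p 0 = 0" using p(1)[of 0 0] by simp
  interpret A: concrete_domain C
  proof
    show "0 \<in> C" "1 \<in> C" using dom.zero_closed dom.one_closed by (simp_all add: ring_of_type_algebra_simps)
    show "a + b \<in> C" "a * b \<in> C" if "a \<in> C" "b \<in> C" for a b
      using that dom.a_closed[of a b] dom.m_closed[of a b] by (simp_all add: ring_of_type_algebra_simps)
    show "- a \<in> C" if "a \<in> C" for a using uminus_C that .
    show "a = 0 \<or> b = 0" if "a \<in> C" "b \<in> C" "a * b = 0" for a b
      using that dom.integral[of a b] by (simp add: ring_of_type_algebra_simps)
  qed
  interpret A': concrete_domain C'
  proof
    show "a = 0 \<or> b = 0" if "a \<in> C'" "b \<in> C'" "a * b = 0" for a b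
    proof -
      have "i a * i b = 0" using that(3) i(2)[of a b] i0 by simp
      then have "i a = 0 \<or> i b = 0" using that i(4) A.no_zero_divisors by blast
      then show ?thesis using pi that p0 by metis
    qed
  qed (use C in auto)
  have isum: "i (sum f F) = (\<Sum>j\<in>F. i (f j))" for f and F :: "nat set"
    by (induction F rule: infinite_finite_induct) (auto simp: i0 i(1))
  have ipow: "i (a ^ n) = i a ^ n" for a n by (induction n) (auto simp: i)
  have iD: "i b \<in> A.D" if "b \<in> A'.D" for b
    using that i(4) pi p0 by (auto simp: A.D_def A'.D_def) metis
  have R: "A.R = ?R" "A'.R = ring_of_type_algebra \<lparr>carrier := C'\<rparr>" by (simp_all add: A.R_def A'.R_def)
  show ?thesis
    unfolding normal_domain_def R(2)[symmetric]
  proof (intro conjI ballI impI A'.domain_R)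
    fix x assume x: "x \<in> carrier A'.Q" "integral_over A'.R x"
    then obtain a b where ab: "x = A'.fr a b" "a \<in> C'" "b \<in> A'.D" unfolding A'.carrier_Q by blast
    obtain n c where c: "\<forall>j<n. c j \<in> C'" "a ^ n + (\<Sum>j<n. c j * a ^ j * b ^ (n - j)) = 0"
      using x(2) A'.integral_over_iff[OF ab(2,3)] ab(1) by blast
    have "i (a ^ n + (\<Sum>j<n. c j * a ^ j * b ^ (n - j))) = 0" using c(2) i0 by simp
    then have "i a ^ n + (\<Sum>j<n. i (c j) * i a ^ j * i b ^ (n - j)) = 0"
      by (simp add: i isum ipow)
    then have "integral_over A.R (A.fr (i a) (i b))"
      using A.integral_over_iff[OF i(4)[OF ab(2)] iD[OF ab(3)]] c(1) i(4)
      by (meson exI[of _ "\<lambda>j. i (c j)"])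
    moreover have "A.fr (i a) (i b) \<in> carrier A.Q" using i(4)[OF ab(2)] iD[OF ab(3)] by (rule A.Q_closed)
    ultimately obtain h where h: "h \<in> C" "A.fr (i a) (i b) = A.fr h 1"
      using norm unfolding normal_domain_def R(1)[symmetric] by auto
    then have "i a * 1 = h * i b"
      using A.fraction_eq_iff[OF i(4)[OF ab(2)] iD[OF ab(3)] h(1) A.D1] by blast
    then have "p (i a) = p h * p (i b)" by (simp flip: p(2))
    then have "a * 1 = p h * b" using pi ab A'.D_C by simp
    then have "x = A'.fr (p h) 1" unfolding ab(1) using A'.fraction_eq_iff ab A'.D1 p(4) h(1) by blast
    then show "\<exists>h\<in>carrier A'.R. x = A'.fr h \<one>\<^bsub>A'.R\<^esub>" using p(4) h(1) by auto
  qed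
qed

section \<open>Retracts of Hibi rings\<close>

lemma hibi_ring_eq:
  "(hibi_ring P r :: ('a option, 'k::field) mpoly ring)
    = ring_of_type_algebra \<lparr>carrier := hibi_map ` polys_in (order_ideals P r)\<rparr>"
  unfolding carrier_hibi_ring[symmetric] by (simp add: hibi_ring_def)

lemma eval_monomial_sum: "eval_monomial u (\<Sum>i\<in>A. f i) = (\<Prod>i\<in>A. eval_monomial u (f i))"
  by (induction A rule: infinite_finite_induct) (simp_all add: eval_monomial_add)

lemma subst_hibi_monomial:
  "subst u (hibi_monomial \<alpha>) = u None * (\<Prod>p\<in>\<alpha>. u (Some p))"
  unfolding hibi_monomial_single subst_single hibi_exponent_def eval_monomial_add eval_monomial_sum
  by (simp add: eval_monomial_single)

lemma subst_polys_in:
  fixes u :: "'v \<Rightarrow> ('w, 'k::comm_ring_1) mpoly"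
  assumes "\<And>v. v \<in> V \<Longrightarrow> u v \<in> polys_in W" "f \<in> polys_in V"
  shows "subst u f \<in> polys_in W"
proof -
  have pow: "u v ^ n \<in> polys_in W" if "v \<in> V" for v n
    by (induction n) (auto intro: polys_in_mult assms(1)[OF that])
  have "(\<Prod>v\<in>A. u v ^ lookup m v) \<in> polys_in W" if "A \<subseteq> V" for A m
    using that by (induction A rule: infinite_finite_induct) (auto intro: polys_in_mult pow)
  then show ?thesis
    unfolding subst_def using assms(2) by (intro polys_in_sum polys_in_mult) (auto simp: polys_in_def[of V])
qed

lemma prod_single: "(\<Prod>i\<in>A. single (f i) (1::'k::field)) = single (\<Sum>i\<in>A. f i) 1"
  by (induction A rule: infinite_finite_induct) (simp_all add: mult_single)

lemma order_ideals_Restr: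
  "\<alpha> \<in> order_ideals P r \<Longrightarrow> S \<subseteq> P \<Longrightarrow> \<alpha> \<inter> S \<in> order_ideals S (Restr r S)"
  by (auto simp: order_ideals_def)

text \<open>
  \<open>Z\<close> and the sets \<open>fib p\<close> are the fibres, over the added least element and over \<open>p\<close>, of a monotone
  retraction of \<open>P\<close> onto \<open>S\<close> with a least and a greatest element added.
\<close>

lemma hibi_property_N_2_retract:
  fixes P S :: "'a set" and fib :: "'a \<Rightarrow> 'a set"
  assumes fin: "finite P" and SP: "S \<subseteq> P" and ZS: "Z \<inter> S = {}" and ZP: "Z \<subseteq> P"
    and fibP: "\<And>p. p \<in> S \<Longrightarrow> fib p \<subseteq> P" and fibS: "\<And>p. p \<in> S \<Longrightarrow> fib p \<inter> S = {p}"
    and fibZ: "\<And>p. p \<in> S \<Longrightarrow> fib p \<inter> Z = {}"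
    and fib_disjoint: "\<And>p q. p \<in> S \<Longrightarrow> q \<in> S \<Longrightarrow> p \<noteq> q \<Longrightarrow> fib p \<inter> fib q = {}"
    and ideal: "\<And>\<alpha>. \<alpha> \<in> order_ideals S (Restr r S) \<Longrightarrow> Z \<union> \<Union> (fib ` \<alpha>) \<in> order_ideals P r"
    and N: "hibi_property_N TYPE('k::field) 2 P r"
  shows "hibi_property_N TYPE('k) 2 S (Restr r S)"
proof -
  define V where "V = order_ideals P r"
  define V' where "V' = order_ideals S (Restr r S)"
  define \<sigma> where "\<sigma> \<alpha> = Z \<union> \<Union> (fib ` \<alpha>)" for \<alpha>
  define \<tau> where "\<tau> \<alpha> = \<alpha> \<inter> S" for \<alpha>
  have finS: "finite S" using fin SP by (rule finite_subset[rotated])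
  have finfib: "finite (fib p)" if "p \<in> S" for p using fibP[OF that] fin by (rule finite_subset)
  have V'S: "\<alpha> \<subseteq> S" "finite \<alpha>" if "\<alpha> \<in> V'" for \<alpha>
    using that finS by (auto simp: V'_def order_ideals_def intro: finite_subset)
  have VP: "finite \<alpha>" if "\<alpha> \<in> V" for \<alpha>
    using that fin by (auto simp: V_def order_ideals_def intro: finite_subset)
  \<comment> \<open>\<open>h\<close> multiplies \<open>t\<close> by the variables of
    \<open>Z\<close> and replaces the variable of \<open>p\<close> by the product over its fibre;
    \<open>g\<close> sets the variables outside \<open>S\<close> to 1. They realise
    \<open>\<sigma>\<close> and \<open>\<tau>\<close> on the Hibi rings.\<close>
  define h :: "'a option \<Rightarrow> ('a option, 'k) mpoly" where "h x = (case x of None \<Rightarrow> hibi_monomial Z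
    | Some p \<Rightarrow> single (\<Sum>q\<in>fib p. single (Some q) 1) 1)" for x
  define g :: "'a option \<Rightarrow> ('a option, 'k) mpoly" where "g x = (case x of None \<Rightarrow> indet None
    | Some p \<Rightarrow> if p \<in> S then indet (Some p) else 1)" for x
  have h: "subst h (hibi_monomial \<alpha>) = hibi_monomial (\<sigma> \<alpha>)" if "\<alpha> \<in> V'" for \<alpha>
  proof -
    have "(\<Sum>p\<in>\<alpha>. \<Sum>q\<in>fib p. single (Some q) (1::nat)) = (\<Sum>q\<in>\<Union> (fib ` \<alpha>). single (Some q) 1)"
      using V'S[OF that] finfib fib_disjoint by (intro sum.UNION_disjoint[symmetric]) blast+
    moreover have "(\<Sum>q\<in>Z. single (Some q) (1::nat)) + (\<Sum>q\<in>\<Union> (fib ` \<alpha>). single (Some q) 1)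
        = (\<Sum>q\<in>\<sigma> \<alpha>. single (Some q) 1)"
      unfolding \<sigma>_def using V'S[OF that] finfib fibZ finite_subset[OF ZP fin]
      by (intro sum.union_disjoint[symmetric]) blast+
    ultimately have "hibi_exponent Z + (\<Sum>p\<in>\<alpha>. \<Sum>q\<in>fib p. single (Some q) 1) = hibi_exponent (\<sigma> \<alpha>)"
      by (simp add: hibi_exponent_def add.assoc)
    then show ?thesis
      unfolding subst_hibi_monomial unfolding h_def option.case hibi_monomial_single prod_single mult_single
      by simp
  qed
  have g: "subst g (hibi_monomial \<alpha>) = hibi_monomial (\<tau> \<alpha>)" if "\<alpha> \<in> V" for \<alpha>
  proof -
    have "(\<Prod>p\<in>\<alpha>. g (Some p)) = (\<Prod>p\<in>\<alpha> \<inter> S. single (single (Some p) 1) 1)"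
      using VP[OF that] by (intro prod.mono_neutral_cong_right) (auto simp: g_def indet_def)
    then have "subst g (hibi_monomial \<alpha>) = indet None * single (\<Sum>p\<in>\<alpha> \<inter> S. single (Some p) 1) 1"
      by (simp add: subst_hibi_monomial prod_single) (simp add: g_def)
    then show ?thesis by (simp add: indet_def mult_single \<tau>_def hibi_monomial_single hibi_exponent_def)
  qed
  have \<sigma>: "\<sigma> \<alpha> \<in> V" if "\<alpha> \<in> V'" for \<alpha> using ideal that by (simp add: V_def V'_def \<sigma>_def)
  have \<tau>: "\<tau> \<alpha> \<in> V'" if "\<alpha> \<in> V" for \<alpha> using order_ideals_Restr[OF _ SP] that by (simp add: V_def V'_def \<tau>_def)
  have \<tau>\<sigma>: "\<tau> (\<sigma> \<alpha>) = \<alpha>" if "\<alpha> \<in> V'" for \<alpha>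
  proof -
    have "\<tau> (\<sigma> \<alpha>) = (Z \<inter> S) \<union> (\<Union>p\<in>\<alpha>. fib p \<inter> S)" unfolding \<sigma>_def \<tau>_def by blast
    also have "(\<Union>p\<in>\<alpha>. fib p \<inter> S) = (\<Union>p\<in>\<alpha>. {p})"
      using V'S(1)[OF that] fibS by (intro SUP_cong refl) blast
    finally show ?thesis by (simp add: ZS)
  qed
  \<comment> \<open>These commuting squares show that both substitutions of variables respect the
    defining ideals, as \<open>graded_retract\<close> demands.\<close>
  have h_map: "hibi_map (subst (\<lambda>v. indet (\<sigma> v)) f) = subst h (hibi_map f)" if "f \<in> polys_in V'" for f
    unfolding subst_subst by (rule subst_cong[OF that]) (simp add: h)
  have g_map: "hibi_map (subst (\<lambda>v. indet (\<tau> v)) f) = subst g (hibi_map f)" if "f \<in> polys_in V" for f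
    unfolding subst_subst by (rule subst_cong[OF that]) (simp add: g)
  interpret A: graded_quotient V "hibi_map :: ('a set, 'k) mpoly \<Rightarrow> _"
    unfolding V_def by (rule graded_quotient_hibi[OF fin])
  interpret A': graded_quotient V' "hibi_map :: ('a set, 'k) mpoly \<Rightarrow> _"
    unfolding V'_def by (rule graded_quotient_hibi[OF finS])
  interpret graded_retract V "hibi_map :: ('a set, 'k) mpoly \<Rightarrow> _" V' "hibi_map :: ('a set, 'k) mpoly \<Rightarrow> _" \<sigma> \<tau>
    by unfold_locales (use \<sigma> \<tau> \<tau>\<sigma> h_map g_map in auto)
  have C: "hibi_ring P r = ring_of_type_algebra \<lparr>carrier := hibi_map ` polys_in V :: ('a option, 'k) mpoly set\<rparr>"
    and C': "hibi_ring S (Restr r S) = ring_of_type_algebra \<lparr>carrier := hibi_map ` polys_in V' :: ('a option, 'k) mpoly set\<rparr>"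
    by (simp_all add: hibi_ring_eq V_def V'_def)
  have "normal_domain (hibi_ring S (Restr r S) :: ('a option, 'k) mpoly ring)"
    unfolding C'
  proof (rule normal_domain_retract[where i = "subst h" and p = "subst g"])
    show "normal_domain (ring_of_type_algebra \<lparr>carrier := hibi_map ` polys_in V :: ('a option, 'k) mpoly set\<rparr>)"
      using N unfolding hibi_property_N_def C by blast
    show "subst h a \<in> hibi_map ` polys_in V" if a: "a \<in> hibi_map ` polys_in V'" for a
    proof -
      obtain f where f: "f \<in> polys_in V'" "a = hibi_map f" using a by blast
      have "\<iota> f \<in> polys_in V" using f(1) \<sigma> unfolding \<iota>_def by (intro subst_polys_in) auto
      then show ?thesis using h_map[OF f(1)] f(2) unfolding \<iota>_def by (metis image_eqI)
    qed
    show "subst g a \<in> hibi_map ` polys_in V'" if a: "a \<in> hibi_map ` polys_in V" for a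
    proof -
      obtain f where f: "f \<in> polys_in V" "a = hibi_map f" using a by blast
      have "\<rho> f \<in> polys_in V'" using f(1) \<tau> unfolding \<rho>_def by (intro subst_polys_in) auto
      then show ?thesis using g_map[OF f(1)] f(2) unfolding \<rho>_def by (metis image_eqI)
    qed
    show "subst g (subst h a) = a" if a: "a \<in> hibi_map ` polys_in V'" for a
    proof -
      obtain f where f: "f \<in> polys_in V'" "a = hibi_map f" using a by blast
      have "\<iota> f \<in> polys_in V" using f(1) \<sigma> unfolding \<iota>_def by (intro subst_polys_in) auto
      then have "subst g (subst h a) = hibi_map (\<rho> (\<iota> f))"
        unfolding f(2) h_map[OF f(1), symmetric] \<iota>_def[symmetric] \<rho>_def by (rule g_map[symmetric])
      then show ?thesis using \<rho>\<iota>[OF f(1)] f(2) by simp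
    qed
    show "1 \<in> hibi_map ` polys_in V'" by (rule image_eqI[of _ _ 1]) simp_all
    show "0 \<in> hibi_map ` polys_in V'" by (rule image_eqI[of _ _ 0]) simp_all
    show "a + b \<in> hibi_map ` polys_in V'" if "a \<in> hibi_map ` polys_in V'" "b \<in> hibi_map ` polys_in V'" for a b
      using that by (auto simp flip: subst_add intro: polys_in_add)
    show "- a \<in> hibi_map ` polys_in V'" if "a \<in> hibi_map ` polys_in V'" for a
      using that by (auto simp flip: subst_uminus intro: polys_in_uminus)
    show "a * b \<in> hibi_map ` polys_in V'" if "a \<in> hibi_map ` polys_in V'" "b \<in> hibi_map ` polys_in V'" for a b
      using that by (auto simp flip: subst_mult intro: polys_in_mult)
    show "- a \<in> hibi_map ` polys_in V" if "a \<in> hibi_map ` polys_in V" for a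
      using that by (auto simp flip: subst_uminus intro: polys_in_uminus)
  qed (simp_all add: subst_add subst_mult)
  then show ?thesis
    using N irr_part_retract koszul_retract
    unfolding hibi_property_N_2_iff[OF fin] hibi_property_N_2_iff[OF finS] V_def[symmetric] V'_def[symmetric]
    by blast
qed

section \<open>Two chains\<close>

text \<open>Assumes only transitivity and comparability, so that it also yields greatest elements
  when applied to the converse relation.\<close>

lemma finite_chain_Least:
  assumes "finite A" "A \<noteq> {}" "trans r" "\<And>x y. x \<in> A \<Longrightarrow> y \<in> A \<Longrightarrow> (x, y) \<in> r \<or> (y, x) \<in> r"
  shows "\<exists>x\<in>A. \<forall>y\<in>A. (x, y) \<in> r"
  using assms(1,2,4)
proof (induction A rule: finite_ne_induct)
  case (singleton x)
  then show ?case by auto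
next
  case (insert x A)
  then obtain m where m: "m \<in> A" "\<forall>y\<in>A. (m, y) \<in> r" by auto
  have "(x, x) \<in> r" using insert.prems[of x x] by simp
  consider "(x, m) \<in> r" | "(m, x) \<in> r" using insert.prems[of x m] m(1) by blast
  then show ?case
  proof cases
    case 1
    then have "\<forall>y\<in>insert x A. (x, y) \<in> r" using m(2) \<open>(x, x) \<in> r\<close> assms(3) by (auto dest: transD)
    then show ?thesis by blast
  next
    case 2
    then show ?thesis using m by blast
  qed
qed

text \<open>
  The retraction sends an element above \<open>x0\<close> to the least element of \<open>X1\<close> above it, and any other element
  to the greatest element of \<open>Y1\<close> below it.
\<close>

lemma hibi_property_N_2_two_chains:
  fixes P X1 Y1 :: "'a set"
  assumes fin: "finite P" and po: "partial_order_on P r" and sub: "X1 \<subseteq> P" "Y1 \<subseteq> P"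
    and x0: "x0 \<in> X1" "\<And>x. x \<in> X1 \<Longrightarrow> (x0, x) \<in> r"
    and X_chain: "\<And>x y. x \<in> X1 \<Longrightarrow> y \<in> X1 \<Longrightarrow> (x, y) \<in> r \<or> (y, x) \<in> r"
    and Y_chain: "\<And>x y. x \<in> Y1 \<Longrightarrow> y \<in> Y1 \<Longrightarrow> (x, y) \<in> r \<or> (y, x) \<in> r"
    and not_below: "\<And>y. y \<in> Y1 \<Longrightarrow> (x0, y) \<notin> r"
    and N: "hibi_property_N TYPE('k::field) 2 P r"
  shows "hibi_property_N TYPE('k) 2 (X1 \<union> Y1) (Restr r (X1 \<union> Y1))"
proof -
  have trans: "trans r" and tr: "\<And>x y z. (x, y) \<in> r \<Longrightarrow> (y, z) \<in> r \<Longrightarrow> (x, z) \<in> r"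
    and rf: "\<And>x. x \<in> P \<Longrightarrow> (x, x) \<in> r"
    and asym: "\<And>x y. (x, y) \<in> r \<Longrightarrow> (y, x) \<in> r \<Longrightarrow> x = y"
    using po unfolding partial_order_on_def preorder_on_def by (auto dest: transD refl_onD antisymD)
  have disj: "X1 \<inter> Y1 = {}" using x0 not_below by blast
  \<comment> \<open>An element above \<open>x0\<close> with no element of \<open>X1\<close> above it
    belongs to no fibre: it is sent to the added greatest element.\<close>
  define fibX where "fibX x = {q\<in>P. (x0, q) \<in> r \<and> (q, x) \<in> r \<and> (\<forall>x'\<in>X1. (q, x') \<in> r \<longrightarrow> (x, x') \<in> r)}" for x
  define fibY where "fibY y = {q\<in>P. (x0, q) \<notin> r \<and> (y, q) \<in> r \<and> (\<forall>y'\<in>Y1. (y', q) \<in> r \<longrightarrow> (y', y) \<in> r)}" for y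
  define fib where "fib p = (if p \<in> X1 then fibX p else fibY p)" for p
  define Z where "Z = {q\<in>P. (x0, q) \<notin> r \<and> (\<forall>y\<in>Y1. (y, q) \<notin> r)}"
  have least: "\<exists>x\<in>X1. q \<in> fibX x" if "q \<in> P" "(x0, q) \<in> r" "x' \<in> X1" "(q, x') \<in> r" for q x'
  proof -
    have "\<exists>x\<in>{x\<in>X1. (q, x) \<in> r}. \<forall>y\<in>{x\<in>X1. (q, x) \<in> r}. (x, y) \<in> r"
      using finite_subset[OF sub(1) fin] that(3,4) X_chain
      by (intro finite_chain_Least[OF _ _ trans]) auto
    then show ?thesis using that(1,2) unfolding fibX_def by blast
  qed
  have greatest: "\<exists>y\<in>Y1. q \<in> fibY y" if "q \<in> P" "(x0, q) \<notin> r" "y' \<in> Y1" "(y', q) \<in> r" for q y'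
  proof -
    have "\<exists>y\<in>{y\<in>Y1. (y, q) \<in> r}. \<forall>x\<in>{y\<in>Y1. (y, q) \<in> r}. (y, x) \<in> r\<inverse>"
      using finite_subset[OF sub(2) fin] that(3,4) Y_chain trans
      by (intro finite_chain_Least) auto
    then show ?thesis using that(1,2) unfolding fibY_def by blast
  qed
  show ?thesis
  proof (rule hibi_property_N_2_retract[where Z = Z and fib = fib, OF fin _ _ _ _ _ _ _ _ N])
    show "X1 \<union> Y1 \<subseteq> P" using sub by blast
    show "Z \<subseteq> P" by (auto simp: Z_def)
    show "Z \<inter> (X1 \<union> Y1) = {}" using x0 rf sub by (auto simp: Z_def)
    fix p assume p: "p \<in> X1 \<union> Y1"
    show "fib p \<subseteq> P" by (auto simp: fib_def fibX_def fibY_def)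
    show "fib p \<inter> Z = {}" using p by (auto simp: fib_def fibX_def fibY_def Z_def)
    show "fib p \<inter> (X1 \<union> Y1) = {p}"
    proof (cases "p \<in> X1")
      case True
      have "p \<in> fibX p" using True x0 sub rf by (auto simp: fibX_def)
      moreover have "q = p" if "q \<in> fibX p" "q \<in> X1 \<union> Y1" for q
        using that True not_below asym rf sub by (fastforce simp: fibX_def)
      ultimately show ?thesis using True by (auto simp: fib_def)
    next
      case False
      then have pY: "p \<in> Y1" using p by blast
      have "p \<in> fibY p" using pY not_below sub rf by (auto simp: fibY_def)
      moreover have "q = p" if "q \<in> fibY p" "q \<in> X1 \<union> Y1" for q
        using that pY x0 asym rf sub by (fastforce simp: fibY_def)
      ultimately show ?thesis using False pY by (auto simp: fib_def)
    qed
  next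
    fix p q assume p: "p \<in> X1 \<union> Y1" "q \<in> X1 \<union> Y1" "p \<noteq> q"
    show "fib p \<inter> fib q = {}"
    proof (rule ccontr)
      assume "fib p \<inter> fib q \<noteq> {}"
      then obtain s where "s \<in> fib p" "s \<in> fib q" by blast
      \<comment> \<open>The position relative to \<open>x0\<close> forces both fibres to be of the
        same kind; then \<open>p\<close> and \<open>q\<close> are both least, or both greatest, for
        the same element.\<close>
      then have "(p, q) \<in> r \<and> (q, p) \<in> r"
        using p by (auto simp: fib_def fibX_def fibY_def split: if_splits)
      then show False using asym p(3) by blast
    qed
  next
    fix \<alpha> assume \<alpha>: "\<alpha> \<in> order_ideals (X1 \<union> Y1) (Restr r (X1 \<union> Y1))"
    then have \<alpha>S: "\<alpha> \<subseteq> X1 \<union> Y1" and down: "\<And>s s'. s \<in> \<alpha> \<Longrightarrow> s' \<in> X1 \<union> Y1 \<Longrightarrow> (s', s) \<in> r \<Longrightarrow> s' \<in> \<alpha>"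
      by (auto simp: order_ideals_def)
    show "Z \<union> \<Union> (fib ` \<alpha>) \<in> order_ideals P r"
      unfolding order_ideals_def
    proof (intro CollectI conjI ballI impI)
      show "Z \<union> \<Union> (fib ` \<alpha>) \<subseteq> P" by (auto simp: Z_def fib_def fibX_def fibY_def)
      fix q q' assume q: "q \<in> Z \<union> \<Union> (fib ` \<alpha>)" "q' \<in> P" "(q', q) \<in> r"
      \<comment> \<open>Elements not above \<open>x0\<close> are treated uniformly: they lie in
        \<open>Z\<close> or in the fibre of the greatest element of \<open>Y1\<close> below
        them.\<close>
      have low: "q' \<in> Z \<union> \<Union> (fib ` \<alpha>)"
        if nU: "(x0, q') \<notin> r" and Y: "\<And>y'. y' \<in> Y1 \<Longrightarrow> (y', q') \<in> r \<Longrightarrow> y' \<in> \<alpha>"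
      proof (cases "\<exists>y'\<in>Y1. (y', q') \<in> r")
        case False
        then show ?thesis using nU q(2) by (auto simp: Z_def)
      next
        case True
        then obtain y where y: "y \<in> Y1" "q' \<in> fibY y" using greatest[OF q(2) nU] by blast
        then have "y \<in> \<alpha>" using Y by (auto simp: fibY_def)
        moreover have "y \<notin> X1" using y(1) disj by blast
        ultimately show ?thesis using y(2) by (auto simp: fib_def)
      qed
      consider "q \<in> Z" | x where "x \<in> X1" "x \<in> \<alpha>" "q \<in> fibX x" | y where "y \<in> Y1" "y \<in> \<alpha>" "q \<in> fibY y"
        using q(1) \<alpha>S by (auto simp: fib_def split: if_splits)
      then show "q' \<in> Z \<union> \<Union> (fib ` \<alpha>)"
      proof cases
        case 1
        then have "(x0, q') \<notin> r" "\<And>y. y \<in> Y1 \<Longrightarrow> (y, q') \<notin> r" using tr q(3) unfolding Z_def by blast+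
        then show ?thesis by (intro low) auto
      next
        case 2
        \<comment> \<open>If \<open>q'\<close> is above \<open>x0\<close>, its target in
          \<open>X1\<close> is at most \<open>x\<close>; otherwise every element of
          \<open>Y1\<close> below \<open>q'\<close> is below \<open>x\<close>. Both are in
          \<open>\<alpha>\<close> since it is an ideal.\<close>
        have qx: "(q', x) \<in> r" using 2(3) q(3) tr unfolding fibX_def by blast
        show ?thesis
        proof (cases "(x0, q') \<in> r")
          case True
          obtain x' where x': "x' \<in> X1" "q' \<in> fibX x'" using least[OF q(2) True 2(1) qx] by blast
          then have "(x', x) \<in> r" using 2(1) qx unfolding fibX_def by blast
          then have "x' \<in> \<alpha>" using down 2(2) x'(1) by blast
          then show ?thesis using x' by (auto simp: fib_def)
        next
          case False
          then show ?thesis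
          proof (rule low)
            fix y' assume "y' \<in> Y1" "(y', q') \<in> r"
            then show "y' \<in> \<alpha>" using down[OF 2(2), of y'] tr qx by blast
          qed
        qed
      next
        case 3
        have "(x0, q') \<notin> r" using 3(3) q(3) tr unfolding fibY_def by blast
        then show ?thesis
        proof (rule low)
          fix y' assume y': "y' \<in> Y1" "(y', q') \<in> r"
          then have "(y', q) \<in> r" using tr q(3) by blast
          then have "(y', y) \<in> r" using 3(3) y'(1) unfolding fibY_def by blast
          then show "y' \<in> \<alpha>" using down[OF 3(2), of y'] y'(1) by blast
        qed
      qed
    qed
  qed
qed

theorem theorem4p8:
  fixes P S :: "'a set" and r :: "'a rel" and xs ys :: "'a list"
  assumes "finite P" and "partial_order_on P r"
    and "S \<subseteq> P" and "S = set xs \<union> set ys" and "xs \<noteq> []" and "ys \<noteq> []"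
    and "successively (covered_by r) xs" and "successively (covered_by r) ys"
    and "incomparable r (xs ! 0) (ys ! 0)"
    and "incomparable r (last xs) (last ys)"
    and "\<not> hibi_property_N TYPE('k::field) 2 S (Restr r S)"
  shows "\<not> hibi_property_N TYPE('k) 2 P r"
proof
  assume N: "hibi_property_N TYPE('k) 2 P r"
  have rf: "\<And>x. x \<in> P \<Longrightarrow> (x, x) \<in> r" and trans: "trans r"
    using assms(2) unfolding partial_order_on_def preorder_on_def by (auto dest: refl_onD)
  have chain: "(zs ! 0, z) \<in> r \<and> (z, last zs) \<in> r \<and> (\<forall>z'\<in>set zs. (z, z') \<in> r \<or> (z', z) \<in> r)"
    if zs: "successively (covered_by r) zs" "set zs \<subseteq> P" "z \<in> set zs" for zs z
  proof -
    have "successively (\<lambda>x y. (x, y) \<in> r) zs"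
      using zs(1) by (rule successively_mono) (simp add: covered_by_def)
    then have s: "sorted_wrt (\<lambda>x y. (x, y) \<in> r) zs"
      by (subst (asm) successively_conv_sorted_wrt) (use trans in \<open>auto simp: transp_def dest: transD\<close>)
    obtain i where i: "i < length zs" "z = zs ! i" using zs(3) by (metis in_set_conv_nth)
    have le: "(zs ! i, zs ! j) \<in> r" if "i \<le> j" "j < length zs" for i j
      using that sorted_wrt_nth_less[OF s, of i j] rf[OF subsetD[OF zs(2) nth_mem[OF that(2)]]] by (cases "i = j") auto
    have "(z, z') \<in> r \<or> (z', z) \<in> r" if "z' \<in> set zs" for z'
      using that le i by (metis in_set_conv_nth nle_le)
    moreover have "last zs = zs ! (length zs - 1)" using zs(3) by (intro last_conv_nth) auto
    ultimately show ?thesis using le i by auto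
  qed
  have sub: "set xs \<subseteq> P" "set ys \<subseteq> P" using assms(3,4) by auto
  have ends: "xs ! 0 \<in> set xs" "last xs \<in> set xs" "ys ! 0 \<in> set ys" "last ys \<in> set ys"
    using assms(5,6) by auto
  note X = chain[OF assms(7) sub(1)] and Y = chain[OF assms(8) sub(2)]
  \<comment> \<open>Stated for either order of the chains, because the last two cases are mirror
    images.\<close>
  have two: "hibi_property_N TYPE('k) 2 (set zs \<union> set ws) (Restr r (set zs \<union> set ws))"
    if "(zs ! 0, last ws) \<notin> r" "set zs \<subseteq> P" "set ws \<subseteq> P" "zs \<noteq> []"
      "successively (covered_by r) zs" "successively (covered_by r) ws" for zs ws
  proof (rule hibi_property_N_2_two_chains[OF assms(1,2) that(2,3) _ _ _ _ _ N])
    note Zc = chain[OF that(5,2)] and Wc = chain[OF that(6,3)]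
    show "zs ! 0 \<in> set zs" using that(4) by simp
    show "(zs ! 0, x) \<in> r" if "x \<in> set zs" for x using Zc[OF that] by blast
    show "(x, y) \<in> r \<or> (y, x) \<in> r" if "x \<in> set zs" "y \<in> set zs" for x y using Zc[OF that(1)] that(2) by blast
    show "(x, y) \<in> r \<or> (y, x) \<in> r" if "x \<in> set ws" "y \<in> set ws" for x y using Wc[OF that(1)] that(2) by blast
    \<comment> \<open>Every element of \<open>ws\<close> lies below \<open>last ws\<close>, so
      testing that one element suffices.\<close>
    show "(zs ! 0, y) \<notin> r" if "y \<in> set ws" for y
      using Wc[OF that] \<open>(zs ! 0, last ws) \<notin> r\<close> trans by (meson transD)
  qed
  consider "(xs ! 0, last ys) \<in> r" "(ys ! 0, last xs) \<in> r" | "(xs ! 0, last ys) \<notin> r" | "(ys ! 0, last xs) \<notin> r"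
    by blast
  then show False
  proof cases
    case 1
    \<comment> \<open>The bottom pair is \<open>xs ! 0\<close>, \<open>ys ! 0\<close>, the top pair
      \<open>last xs\<close>, \<open>last ys\<close>; two of the four comparisons hold along the
      chains, two by the case assumption. Coefficient degree 3 means a syzygy of degree 4.\<close>
    have "\<not> koszul_cycles (order_ideals P r) (*) (hibi_ideal TYPE('k) P r) 3
      \<subseteq> koszul_boundaries (order_ideals P r) (*) (hibi_ideal TYPE('k) P r) 3"
      by (rule koszul_pair_not_boundary[OF assms(1,2) _ _ _ _ assms(9,10)])
        (use ends sub X Y 1 in auto)
    then show False using N unfolding hibi_property_N_2_iff[OF assms(1)] by (metis numeral_eq_iff semiring_norm(88))
  next
    case 2
    then show False using two[OF 2 sub assms(5,7,8)] assms(4,11) by simp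
  next
    case 3
    then show False using two[OF 3 sub(2,1) assms(6,8,7)] assms(4,11) by (simp add: Un_commute)
  qed
qed

end
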